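(* Let $\mu$ be a probability measure on $\mathbb{C}$, and let $\{a_i\}_{i\ge1}$ and $\{b_i\}_{i\ge1}$ be two $\mu$-distributed, log-Cesàro bounded sequences of complex numbers. Suppose that $a_i\ne b_i$ for infinitely many $i$. Let $\{\xi_i\}_{i\ge1}$ be a sequence of independent random variables such that $\xi_i=a_i$ or $\xi_i=b_i$ with equal probability. For each $n\in\mathbb{N}$ let $$P_n(z):=(z-\xi_1)\cdots(z-\xi_n).$$ Then, as $n\to\infty$, $\mathcal{M}(P_n)\to\mu$ almost surely, and $\mathcal{M}(P_n^{(k)})\to\mu$ in probability for any $k\in\mathbb{N}$.
   Context: A sequence $\{a_n\}_{n\ge1}$ of complex numbers is $\mu$-distributed if $\frac1n\sum_{i=1}^n\delta_{a_i}$ converges weakly to the probability measure $\mu$. It is log-Cesàro bounded if the sequence $\{\frac1n\sum_{i=1}^n\log_+|a_i|\}_{n\ge1}$ is bounded, where $\log_+x=\max(\log x,0)$ (and $\log_+0=0$). For a non-constant polynomial $P$, $\mathcal{M}(P)$ denotes the uniform probability measure on the multiset of zeros of $P$ (zeros counted with multiplicity). $P_n^{(k)}$ is the $k$-th derivative (so $\mathcal{M}(P_n^{(k)})$ is considered for $n>k$). Convergence of random probability measures, almost surely or in probability, is with respect to the topology of weak convergence of probability measures on $\mathbb{C}$. *)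

theory Defs
  imports "HOL-Probability.Probability" "HOL-Computational_Algebra.Polynomial"
begin

text \<open>Borel probability measures under the topology of weak convergence, i.e. the coarsest topology
  making \<open>N \<mapsto> \<integral>f dN\<close> continuous for every bounded continuous real function \<open>f\<close>.\<close>

definition weak_topology :: "'a::topological_space measure topology" where
  "weak_topology = topology_generated_by
     {{N. sets N = sets borel \<and> prob_space N \<and> (\<integral>x. f x \<partial>N) \<in> U} | (f :: 'a \<Rightarrow> real) U.
        continuous_on UNIV f \<and> bounded (range f) \<and> open U}"

definition converges_in_probability ::
    "'w measure \<Rightarrow> 'b topology \<Rightarrow> (nat \<Rightarrow> 'w \<Rightarrow> 'b) \<Rightarrow> 'b \<Rightarrow> bool" where
  "converges_in_probability M T X l \<longleftrightarrow>
     l \<in> topspace T \<and>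
     (\<forall>U. openin T U \<and> l \<in> U \<longrightarrow> (\<lambda>n. measure M {\<omega> \<in> space M. X n \<omega> \<in> U}) \<longlonglongrightarrow> 1)"

text \<open>The measure \<open>(1 / size A) * (\<Sum>x\<in>#A. \<delta>\<^sub>x)\<close> on the Borel sets. For \<open>A = {#}\<close> it is an unspecified
  probability measure.\<close>

definition uniform_mset_measure :: "'a::topological_space multiset \<Rightarrow> 'a measure" where
  "uniform_mset_measure A = distr (measure_pmf (pmf_of_multiset A)) borel (\<lambda>x. x)"

text \<open>All sequences are indexed from \<open>1\<close>; their value at \<open>0\<close> is never used.\<close>

definition distributed_as :: "(nat \<Rightarrow> complex) \<Rightarrow> complex measure \<Rightarrow> bool" where
  "distributed_as a \<mu> \<longleftrightarrow>
     limitin weak_topology (\<lambda>n. uniform_mset_measure (image_mset a (mset_set {1..n}))) \<mu> sequentially"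

text \<open>At \<open>0\<close> this is \<open>0\<close>, because \<open>ln 0 = 0\<close>.\<close>

definition log_plus :: "real \<Rightarrow> real" where
  "log_plus x = max (ln x) 0"

definition log_Cesaro_bounded :: "(nat \<Rightarrow> complex) \<Rightarrow> bool" where
  "log_Cesaro_bounded a \<longleftrightarrow>
     bounded ((\<lambda>n. (\<Sum>i=1..n. log_plus (cmod (a i))) / real n) ` {1..})"

definition root_poly :: "(nat \<Rightarrow> complex) \<Rightarrow> nat \<Rightarrow> complex poly" where
  "root_poly x n = (\<Prod>i=1..n. [:- x i, 1:])"

definition zeros_measure :: "complex poly \<Rightarrow> complex measure" where
  "zeros_measure p = uniform_mset_measure (proots p)"

end

theory Submission
  imports Defs "HOL-Computational_Algebra.Fundamental_Theorem_Algebra"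
begin

text \<open>The averages over \<open>\<xi>\<close> of bounded continuous functions obey the strong law of large numbers
  (Hoeffding and Borel--Cantelli); countably many test functions suffice, which gives the first claim.

  For the second, Jensen's formula expresses the difference of the means of
  \<open>(ln |P\<^sub>n\<^sup>(\<^sup>k\<^sup>) / P\<^sub>n|) / n\<close> over two concentric circles as the integral of a compactly supported
  tent function against the difference of the two zero measures, up to \<open>O(k/n)\<close>; tents approximate
  all test functions by convolution. So it suffices that these logarithms tend to \<open>0\<close> in \<open>L\<^sup>1\<close> of
  each circle, in mean. They are bounded in \<open>L\<^sup>2\<close> by log-Cesaro boundedness, hence pointwise
  convergence in probability at almost every point of a circle is enough. There
  \<open>P\<^sub>n\<^sup>(\<^sup>k\<^sup>) / P\<^sub>n\<close> is \<open>k!\<close> times the \<open>k\<close>-th elementary symmetric polynomial of the \<open>1 / (z - \<xi>\<^sub>i)\<close>,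
  which is at most polynomially large by Borel--Cantelli, and bounded away from \<open>0\<close> with probability
  close to \<open>1\<close> by a decoupling argument reducing to anticoncentration of sums.\<close>

section \<open>Anticoncentration of elementary symmetric polynomials\<close>

text \<open>The differences between the two sequences are only known to be nonzero infinitely often
  and may decay arbitrarily fast, so no rate of anticoncentration is available. For each tolerance
  one only gets a finite block of indices and a threshold \<open>\<rho>\<close>. Conditioning on all
  other choices turns them into a fixed polynomial factor with constant term 1, so the same
  \<open>\<rho>\<close> serves all large \<open>n\<close>, and taking logarithms and dividing by
  \<open>n\<close> makes its size irrelevant. But \<open>\<rho>\<close> depends on the point
  \<open>z\<close> without any uniformity; this is why the argument goes through convergence at
  almost every point and dominated convergence instead of estimates along a whole circle.

  The randomness is kept combinatorial: an outcome is the set \<open>S\<close> of indices where the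
  second sequence is chosen, and expectations are averages over all \<open>S\<close> in
  \<open>Pow {1..n}\<close>. A single lemma, \<open>prob_le_card_pick\<close>, transfers these
  counts to the random variables.

  Zeros of derivatives may wander off to infinity, but no tightness estimate is needed: for
  probability measures with a probability limit, test functions of compact support already control
  weak convergence.\<close>

lemma card_subset_sums_ge:
  fixes d :: "'i \<Rightarrow> complex"
  assumes "finite J" "\<And>i. i \<in> J \<Longrightarrow> d i \<noteq> 0"
  shows "card J + 1 \<le> card (sum d ` Pow J)"
  using assms
proof (induction J rule: finite_induct)
  case (insert j J)
  let ?A = "sum d ` Pow J"
  have fin: "finite ?A" using insert by simp
  have eq: "sum d ` Pow (insert j J) = ?A \<union> (+) (d j) ` ?A" (is "?L = ?R")
  proof -
    have "sum d (insert j T) = d j + sum d T" if "T \<subseteq> J" for T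
      using that insert.hyps finite_subset by (subst sum.insert) auto
    then show ?thesis
      unfolding Pow_insert image_Un image_image by (intro arg_cong2[where f = "(\<union>)"] image_cong) auto
  qed
  \<comment> \<open>A finite nonempty set is not invariant under a nonzero translation: adding up
    its elements would give \<open>of_nat (card ?A) * d j = 0\<close>. So each further index creates
    at least one new sum.\<close>
  have "\<not> (+) (d j) ` ?A \<subseteq> ?A"
  proof
    assume sub: "(+) (d j) ` ?A \<subseteq> ?A"
    then have "(+) (d j) ` ?A = ?A"
      using fin by (intro card_subset_eq) (auto simp: card_image)
    then have "sum (\<lambda>x. x) ?A = sum (\<lambda>x. x) ((+) (d j) ` ?A)" by simp
    also have "\<dots> = sum (\<lambda>x. d j + x) ?A"
      by (subst sum.reindex) (auto simp: o_def)
    also have "\<dots> = of_nat (card ?A) * d j + sum (\<lambda>x. x) ?A"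
      by (simp add: sum.distrib)
    finally have "card ?A = 0" using insert.prems by auto
    then show False using fin by auto
  qed
  then have "?A \<subset> ?R" by blast
  then have "card ?A < card ?R" using fin by (intro psubset_card_mono) auto
  then show ?case using insert eq by simp
qed simp

text \<open>Divided by \<open>2 ^ card B\<close>, this is the mass at \<open>x\<close> of the law of
  a uniformly random subset sum.\<close>

definition atom_count :: "('i \<Rightarrow> complex) \<Rightarrow> 'i set \<Rightarrow> complex \<Rightarrow> nat" where
  "atom_count d B x = card {S \<in> Pow B. sum d S = x}"

text \<open>Counting form of conditioning on the choices made in \<open>J\<close>.\<close>

lemma card_Pow_union:
  assumes "finite B" "finite J" "B \<inter> J = {}"
  shows "card {S \<in> Pow (B \<union> J). P S} = (\<Sum>T\<in>Pow J. card {S \<in> Pow B. P (S \<union> T)})"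
proof -
  have "card {S \<in> Pow (B \<union> J). P S} = card (SIGMA T:Pow J. {S \<in> Pow B. P (S \<union> T)})"
  proof (rule bij_betw_same_card[symmetric], rule bij_betwI)
    show "(\<lambda>(T, S). S \<union> T) \<in> (SIGMA T:Pow J. {S \<in> Pow B. P (S \<union> T)}) \<rightarrow> {S \<in> Pow (B \<union> J). P S}"
      by auto
    show "(\<lambda>S. (S \<inter> J, S \<inter> B)) \<in> {S \<in> Pow (B \<union> J). P S} \<rightarrow> (SIGMA T:Pow J. {S \<in> Pow B. P (S \<union> T)})"
    proof
      fix S assume S: "S \<in> {S \<in> Pow (B \<union> J). P S}"
      then have "S \<inter> B \<union> S \<inter> J = S" by auto
      then show "(S \<inter> J, S \<inter> B) \<in> (SIGMA T:Pow J. {S \<in> Pow B. P (S \<union> T)})" using S by auto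
    qed
  qed (use assms in auto)
  also have "\<dots> = (\<Sum>T\<in>Pow J. card {S \<in> Pow B. P (S \<union> T)})"
    using assms by (subst card_SigmaI) auto
  finally show ?thesis .
qed

lemma atom_count_union:
  assumes "finite B" "finite J" "B \<inter> J = {}"
  shows "atom_count d (B \<union> J) x = (\<Sum>T\<in>Pow J. atom_count d B (x - sum d T))"
  unfolding atom_count_def card_Pow_union[OF assms]
proof (intro sum.cong refl arg_cong[where f = card] Collect_cong)
  fix T S assume "T \<in> Pow J"
  show "(S \<in> Pow B \<and> sum d (S \<union> T) = x) = (S \<in> Pow B \<and> sum d S = x - sum d T)"
  proof (cases "S \<in> Pow B")
    case True
    have "sum d (S \<union> T) = sum d S + sum d T"
      using True \<open>T \<in> Pow J\<close> assms by (intro sum.union_disjoint) (auto dest: finite_subset)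
    then show ?thesis by (auto simp: algebra_simps)
  qed simp
qed

lemma atom_count_sum_le:
  assumes "finite B" "finite X"
  shows "(\<Sum>x\<in>X. atom_count d B x) \<le> 2 ^ card B"
proof -
  have "(\<Sum>x\<in>X. atom_count d B x) = card (\<Union>x\<in>X. {S \<in> Pow B. sum d S = x})"
    unfolding atom_count_def using assms by (subst card_UN_disjoint) auto
  also have "\<dots> \<le> card (Pow B)" using assms by (intro card_mono) auto
  finally show ?thesis using assms by (simp add: card_Pow)
qed

text \<open>If the largest atom could not be made small, adding \<open>l\<close> further indices to a block whose
  largest atom is nearly minimal would force all subset sums of these \<open>l\<close> indices to correspond to
  atoms of comparable mass; but there are more than \<open>l\<close> distinct subset sums.\<close>

lemma small_atoms:
  fixes d :: "'i \<Rightarrow> complex"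
  assumes N: "infinite N" and d: "\<And>i. i \<in> N \<Longrightarrow> d i \<noteq> 0" and "\<eta> > 0"
  shows "\<exists>B. finite B \<and> B \<subseteq> N \<and> (\<forall>x. real (atom_count d B x) \<le> \<eta> * 2 ^ card B)"
proof (rule ccontr)
  assume "\<not> ?thesis"
  then have large: "\<exists>x. real (atom_count d B x) > \<eta> * 2 ^ card B" if "finite B" "B \<subseteq> N" for B
    using that not_le by metis
  define q where "q B x = real (atom_count d B x) / 2 ^ card B" for B x
  have q_le1: "q B x \<le> 1" if "finite B" for B x
    using atom_count_sum_le[OF that, of "{x}" d] unfolding q_def
    by (simp add: field_simps)
  \<comment> \<open>\<open>V\<close> collects the bounds that some block achieves for all its atoms
    at once. The assumption to be refuted keeps its infimum \<open>Q\<close> positive.\<close>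
  define V where "V = {r. \<exists>B. finite B \<and> B \<subseteq> N \<and> (\<forall>x. q B x \<le> r)}"
  define Q where "Q = Inf V"
  have V1: "1 \<in> V" unfolding V_def using q_le1 by (intro CollectI exI[of _ "{}"]) auto
  have V_ge: "r \<ge> \<eta>" if "r \<in> V" for r
  proof -
    from that obtain B where B: "finite B" "B \<subseteq> N" "\<And>x. q B x \<le> r" unfolding V_def by auto
    from large[OF B(1,2)] obtain x where "real (atom_count d B x) > \<eta> * 2 ^ card B" by auto
    then have "q B x > \<eta>" unfolding q_def by (simp add: field_simps)
    then show ?thesis using B(3)[of x] by linarith
  qed
  have bdd: "bdd_below V" using V_ge by (intro bdd_belowI[of _ \<eta>])
  have Q_pos: "Q > 0" using cInf_greatest[of V \<eta>] V1 V_ge \<open>\<eta> > 0\<close> unfolding Q_def by force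
  \<comment> \<open>Chosen so that \<open>l + 1\<close> atoms of mass at least \<open>Q / 4\<close>
    would exceed the total mass 1.\<close>
  obtain l :: nat where l: "4 / Q < real l" using reals_Archimedean2 by blast
  define e where "e = 1 / (2 ^ (l + 1) :: real)"
  have "Q * 1 < Q * (1 + e)" using Q_pos by (intro mult_strict_left_mono) (auto simp: e_def)
  then obtain r where r: "r \<in> V" "r < Q * (1 + e)"
    using cInf_lessD[of V "Q * (1 + e)"] V1 unfolding Q_def[symmetric] by auto
  then obtain B where B: "finite B" "B \<subseteq> N" and qr: "\<forall>x. q B x \<le> r"
    unfolding V_def by blast
  have qB: "q B x < Q * (1 + e)" for x using qr r(2) le_less_trans by blast
  obtain J where J: "finite J" "card J = l" "J \<subseteq> N - B"
    using infinite_arbitrarily_large[of "N - B" l] N B by (auto simp: Diff_infinite_finite)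
  have BJ: "B \<inter> J = {}" using J by auto
  have Q_le: "Q \<le> r" if "\<And>x. q (B \<union> J) x \<le> r" for r
    unfolding Q_def using that B J by (intro cInf_lower bdd) (auto simp: V_def intro!: exI[of _ "B \<union> J"])
  define gap where "gap = Q * (1 - 1 / 2 ^ (l + 2))"
  have "gap < Q" unfolding gap_def using Q_pos by (simp add: algebra_simps)
  then obtain x where x: "q (B \<union> J) x > gap" using Q_le[of gap] by (meson not_le)
  have q_avg: "q (B \<union> J) x = (\<Sum>T\<in>Pow J. q B (x - sum d T)) / 2 ^ l"
    unfolding q_def atom_count_union[OF B(1) J(1) BJ] using B J BJ
    by (simp add: card_Un_disjoint power_add sum_divide_distrib field_simps)
  \<comment> \<open>The mean of these \<open>2 ^ l\<close> masses exceeds \<open>gap\<close>, while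
    each of them stays below \<open>Q * (1 + e)\<close>, so a single small one could not be
    compensated. The values of \<open>e\<close> and \<open>gap\<close> are tuned to
    \<open>2 ^ l\<close> terms such that \<open>Q / 4\<close> remains.\<close>
  have big: "q B (x - sum d T) \<ge> Q / 4" if "T \<in> Pow J" for T
  proof -
    have "(\<Sum>T'\<in>Pow J - {T}. q B (x - sum d T')) \<le> real (card (Pow J - {T})) * (Q * (1 + e))"
      using qB by (intro sum_bounded_above) (auto intro: less_imp_le)
    moreover have "real (card (Pow J - {T})) = 2 ^ l - 1"
      using that J by (subst card_Diff_singleton) (auto simp: card_Pow of_nat_diff)
    moreover have "(\<Sum>T'\<in>Pow J. q B (x - sum d T')) = q B (x - sum d T) + (\<Sum>T'\<in>Pow J - {T}. q B (x - sum d T'))"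
      using J that by (subst sum.remove[of _ T]) auto
    moreover have "(\<Sum>T\<in>Pow J. q B (x - sum d T)) > 2 ^ l * gap"
      using x unfolding q_avg by (simp add: field_simps)
    ultimately have "q B (x - sum d T) > 2 ^ l * gap - (2 ^ l - 1) * (Q * (1 + e))" by simp
    also have "2 ^ l * gap - (2 ^ l - 1) * (Q * (1 + e)) = Q * (1/4 + e)"
      unfolding gap_def e_def by (simp add: field_simps)
    finally have "q B (x - sum d T) > Q * (1/4 + e)" .
    moreover have "Q * (1/4 + e) \<ge> Q * (1 / 4)" using Q_pos by (intro mult_left_mono) (auto simp: e_def)
    ultimately show ?thesis by simp
  qed
  define X where "X = (\<lambda>t. x - t) ` sum d ` Pow J"
  have finX: "finite X" unfolding X_def using J by simp
  have "card X = card (sum d ` Pow J)" unfolding X_def by (intro card_image) (auto simp: inj_on_def)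
  then have cX: "card X \<ge> l + 1" using card_subset_sums_ge[of J d] J d by auto
  have "real (card X) * (Q / 4) \<le> (\<Sum>y\<in>X. q B y)"
  proof (intro sum_bounded_below)
    fix y assume "y \<in> X"
    then show "Q / 4 \<le> q B y" using big unfolding X_def by blast
  qed
  also have "\<dots> = real (\<Sum>y\<in>X. atom_count d B y) / 2 ^ card B"
    unfolding q_def by (simp add: sum_divide_distrib)
  also have "\<dots> \<le> 1"
    using of_nat_mono[OF atom_count_sum_le[OF B(1) finX, of d], where 'a = real] by simp
  finally have "real (card X) * Q \<le> 4" by simp
  moreover have "real (card X) * Q > real l * Q" using cX Q_pos by simp
  moreover have "4 < real l * Q" using l Q_pos by (simp add: pos_divide_less_eq)
  ultimately show False by linarith
qed

section \<open>Random choices and elementary symmetric polynomials\<close>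

definition pick :: "('i \<Rightarrow> 'a) \<Rightarrow> ('i \<Rightarrow> 'a) \<Rightarrow> 'i set \<Rightarrow> 'i \<Rightarrow> 'a" where
  "pick u v S i = (if i \<in> S then v i else u i)"

text \<open>A generating polynomial: its \<open>k\<close>-th coefficient is the \<open>k\<close>-th
  elementary symmetric polynomial of the \<open>x i\<close> with \<open>i \<in> B\<close>.\<close>

definition one_plus_prod :: "'i set \<Rightarrow> ('i \<Rightarrow> complex) \<Rightarrow> complex poly" where
  "one_plus_prod B x = (\<Prod>i\<in>B. [:1, x i:])"

lemma coeff_one_plus_prod_0 [simp]: "coeff (one_plus_prod B x) 0 = 1"
proof -
  have "poly (one_plus_prod B x) 0 = 1" by (simp add: one_plus_prod_def poly_prod)
  then show ?thesis by (simp add: poly_0_coeff_0)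
qed

lemma coeff_one_plus_prod_1:
  assumes "finite B" shows "coeff (one_plus_prod B x) (Suc 0) = sum x B"
  using assms
proof (induction B rule: finite_induct)
  case (insert i B)
  have "coeff (one_plus_prod (insert i B) x) (Suc 0)
      = coeff (one_plus_prod B x) (Suc 0) + x i * coeff (one_plus_prod B x) 0"
    using insert by (simp add: one_plus_prod_def)
  then show ?case using insert by simp
qed (simp add: one_plus_prod_def)

lemma sum_pick:
  fixes u v :: "'i \<Rightarrow> complex"
  assumes "finite B" "S \<subseteq> B"
  shows "sum (pick u v S) B = sum u B + sum (\<lambda>i. v i - u i) S"
proof -
  have "sum (pick u v S) B = (\<Sum>i\<in>B. u i + (if i \<in> S then v i - u i else 0))"
    by (intro sum.cong) (auto simp: pick_def)
  also have "\<dots> = sum u B + (\<Sum>i\<in>B \<inter> S. v i - u i)"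
    using assms by (simp add: sum.distrib sum.inter_restrict)
  finally show ?thesis using assms by (simp add: Int_absorb1)
qed

lemma one_plus_prod_pick_union:
  assumes "finite B" "finite J" "B \<inter> J = {}" "S \<subseteq> B" "T \<subseteq> J"
  shows "one_plus_prod (B \<union> J) (pick u v (S \<union> T))
           = one_plus_prod B (pick u v S) * one_plus_prod J (pick u v T)"
proof -
  have "one_plus_prod (B \<union> J) (pick u v (S \<union> T))
      = one_plus_prod B (pick u v (S \<union> T)) * one_plus_prod J (pick u v (S \<union> T))"
    unfolding one_plus_prod_def using assms by (intro prod.union_disjoint)
  also have "one_plus_prod B (pick u v (S \<union> T)) = one_plus_prod B (pick u v S)"
    unfolding one_plus_prod_def using assms by (intro prod.cong) (auto simp: pick_def)
  also have "one_plus_prod J (pick u v (S \<union> T)) = one_plus_prod J (pick u v T)"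
    unfolding one_plus_prod_def using assms by (intro prod.cong) (auto simp: pick_def)
  finally show ?thesis .
qed

text \<open>Decoupling: by Cauchy--Schwarz the squared probability is at most the probability that two
  copies differing only on a first block are both small. Their difference is a polynomial divisible
  by the variable, with lowest coefficient \<open>coeff G 0\<close> times a difference of two subset sums, which
  lowers \<open>k\<close> by one.\<close>

lemma anticoncentration:
  fixes u v :: "'i \<Rightarrow> complex"
  assumes "infinite N" "\<And>i. i \<in> N \<Longrightarrow> u i \<noteq> v i" "\<eta> > 0" "\<gamma> > 0"
  shows "\<exists>B \<rho>. finite B \<and> B \<subseteq> N \<and> \<rho> > 0 \<and> (\<forall>G. cmod (coeff G 0) \<ge> \<gamma> \<longrightarrow>
      real (card {S \<in> Pow B. cmod (coeff (G * one_plus_prod B (pick u v S)) k) \<le> \<rho>}) \<le> \<eta> * 2 ^ card B)"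
  using assms
\<comment> \<open>Uniformity in \<open>G\<close> carries the induction: \<open>G\<close> absorbs the
  divided difference of the two copies here, and in the application all indices outside the block.
  \<open>N\<close> varies because the second block must avoid the first.\<close>
proof (induction k arbitrary: N \<eta> \<gamma>)
  case 0
  have "coeff (p * q) 0 = coeff p 0 * coeff q 0" for p q :: "complex poly"
    by (simp add: coeff_mult)
  \<comment> \<open>All factors have constant term 1, so the coefficient in question is
    \<open>coeff G 0\<close> and never as small as \<open>\<gamma> / 2\<close>, even with an empty
    block.\<close>
  then show ?case using 0
    by (intro exI[of _ "{}"] exI[of _ "\<gamma> / 2"]) auto
next
  case (Suc k)
  define d where "d i = v i - u i" for i
  obtain B1 where B1: "finite B1" "B1 \<subseteq> N"
    and atoms: "\<And>x. real (atom_count d B1 x) \<le> \<eta>\<^sup>2 / 2 * 2 ^ card B1"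
  proof -
    have "\<exists>B. finite B \<and> B \<subseteq> N \<and> (\<forall>x. real (atom_count d B x) \<le> \<eta>\<^sup>2 / 2 * 2 ^ card B)"
    proof (rule small_atoms)
      show "d i \<noteq> 0" if "i \<in> N" for i using Suc.prems(2)[OF that] by (simp add: d_def)
    qed (use Suc.prems in auto)
    then show thesis using that by blast
  qed
  \<comment> \<open>The nonzero distances between subset sums of the finite block.
    \<open>\<tau>\<close> is a positive lower bound for them; the inserted 1 covers the case that
    there are none.\<close>
  define D where "D = (\<lambda>(S, S'). cmod (sum d S - sum d S')) ` (Pow B1 \<times> Pow B1) - {0}"
  define \<tau> where "\<tau> = Min (insert 1 D)"
  have finD: "finite D" unfolding D_def using B1 by auto
  have \<tau>_pos: "\<tau> > 0" unfolding \<tau>_def using finD by (subst Min_gr_iff) (auto simp: D_def)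
  have \<tau>: "cmod (sum d S - sum d S') \<ge> \<tau>" if "S \<subseteq> B1" "S' \<subseteq> B1" "sum d S \<noteq> sum d S'" for S S'
  proof -
    have "cmod (sum d S - sum d S') \<in> D" unfolding D_def using that by force
    then show ?thesis unfolding \<tau>_def using finD by (intro Min_le) auto
  qed
  obtain B' \<rho>' where B': "finite B'" "B' \<subseteq> N - B1" and \<rho>': "\<rho>' > 0"
    and IH: "\<And>G. cmod (coeff G 0) \<ge> \<gamma> * \<tau> \<Longrightarrow>
      real (card {S \<in> Pow B'. cmod (coeff (G * one_plus_prod B' (pick u v S)) k) \<le> \<rho>'}) \<le> \<eta>\<^sup>2 / 2 * 2 ^ card B'"
    using Suc.IH[of "N - B1" "\<eta>\<^sup>2 / 2" "\<gamma> * \<tau>"] Suc.prems B1 \<tau>_pos by (auto simp: Diff_infinite_finite)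
  have disj: "B1 \<inter> B' = {}" using B' by auto
  have "real (card {S \<in> Pow (B1 \<union> B'). cmod (coeff (G * one_plus_prod (B1 \<union> B') (pick u v S)) (Suc k)) \<le> \<rho>' / 2})
          \<le> \<eta> * 2 ^ card (B1 \<union> B')" if G: "cmod (coeff G 0) \<ge> \<gamma>" for G
  proof -
    define F where "F S = one_plus_prod B1 (pick u v S)" for S
    define F' where "F' T = one_plus_prod B' (pick u v T)" for T
    define E where "E S T \<longleftrightarrow> cmod (coeff (G * F S * F' T) (Suc k)) \<le> \<rho>' / 2" for S T
    define c where "c T = card {S \<in> Pow B1. E S T}" for T
    let ?W = "card {S \<in> Pow (B1 \<union> B'). cmod (coeff (G * one_plus_prod (B1 \<union> B') (pick u v S)) (Suc k)) \<le> \<rho>' / 2}"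
    have W: "?W = (\<Sum>T\<in>Pow B'. c T)"
      unfolding card_Pow_union[OF B1(1) B'(1) disj] c_def E_def F_def F'_def
      by (intro sum.cong refl arg_cong[where f = card] Collect_cong)
        (auto simp: one_plus_prod_pick_union[OF B1(1) B'(1) disj] mult.assoc)
    have pair: "real (card {T \<in> Pow B'. E S T \<and> E S' T}) \<le> \<eta>\<^sup>2 / 2 * 2 ^ card B'"
      if S: "S \<subseteq> B1" "S' \<subseteq> B1" "sum d S \<noteq> sum d S'" for S S'
    proof -
      define H where "H = G * (F S - F S')"
      have H0: "coeff H 0 = 0" by (simp add: H_def F_def coeff_mult)
      \<comment> \<open>Division by the variable. The constant term of \<open>H'\<close> is the
        linear coefficient of \<open>H\<close>, in which the part \<open>sum u B1\<close> common to
        both copies cancels.\<close>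
      obtain a H' where H': "H = pCons a H'" by (cases H) auto
      have a: "a = 0" using H0 H' by simp
      have "coeff H' 0 = coeff H (Suc 0)" by (simp add: H')
      also have "\<dots> = coeff G 0 * (sum d S - sum d S')"
        unfolding H_def F_def coeff_mult d_def
        using S B1 by (simp add: coeff_one_plus_prod_1 sum_pick)
      finally have "cmod (coeff H' 0) \<ge> \<gamma> * \<tau>"
        using \<tau>[OF S] G \<tau>_pos Suc.prems by (auto simp: norm_mult intro!: mult_mono)
      from IH[OF this] have "real (card {T \<in> Pow B'. cmod (coeff (H' * F' T) k) \<le> \<rho>'}) \<le> \<eta>\<^sup>2 / 2 * 2 ^ card B'"
        by (simp add: F'_def)
      moreover have "card {T \<in> Pow B'. E S T \<and> E S' T} \<le> card {T \<in> Pow B'. cmod (coeff (H' * F' T) k) \<le> \<rho>'}"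
      proof (intro card_mono subsetI)
        fix T assume "T \<in> {T \<in> Pow B'. E S T \<and> E S' T}"
        then have T: "T \<in> Pow B'" "E S T" "E S' T" by auto
        have "coeff (H' * F' T) k = coeff (H * F' T) (Suc k)" by (simp add: H' a)
        also have "\<dots> = coeff (G * F S * F' T) (Suc k) - coeff (G * F S' * F' T) (Suc k)"
          unfolding H_def by (simp add: algebra_simps)
        also have "cmod \<dots> \<le> \<rho>' / 2 + \<rho>' / 2"
          using T unfolding E_def by (intro norm_triangle_le_diff) auto
        finally show "T \<in> {T \<in> Pow B'. cmod (coeff (H' * F' T) k) \<le> \<rho>'}" using T by simp
      qed (use B' in auto)
      ultimately show ?thesis by linarith
    qed
    define Z where "Z = {p \<in> Pow B1 \<times> Pow B1. sum d (fst p) = sum d (snd p)}"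
    have cZ: "real (card Z) \<le> \<eta>\<^sup>2 / 2 * 4 ^ card B1"
    proof -
      have "Z = (\<lambda>(x, y). (y, x)) ` (SIGMA S:Pow B1. {S' \<in> Pow B1. sum d S' = sum d S})"
        unfolding Z_def by force
      then have "card Z = card (SIGMA S:Pow B1. {S' \<in> Pow B1. sum d S' = sum d S})"
        by (auto intro!: card_image simp: inj_on_def)
      also have "\<dots> = (\<Sum>S\<in>Pow B1. atom_count d B1 (sum d S))"
        unfolding atom_count_def using B1 by (intro card_SigmaI) auto
      finally have "real (card Z) = (\<Sum>S\<in>Pow B1. real (atom_count d B1 (sum d S)))" by simp
      also have "\<dots> \<le> (\<Sum>S\<in>Pow B1. \<eta>\<^sup>2 / 2 * 2 ^ card B1)"
        by (intro sum_mono atoms)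
      also have "\<dots> = real (card (Pow B1)) * (\<eta>\<^sup>2 / 2 * 2 ^ card B1)" by simp
      also have "\<dots> = \<eta>\<^sup>2 / 2 * (2 * 2) ^ card B1"
        using B1 unfolding power_mult_distrib by (simp add: card_Pow)
      finally show ?thesis by simp
    qed
    \<comment> \<open>The square counts pairs of copies on \<open>B1\<close> that share the choice
      \<open>T\<close> on \<open>B'\<close>. Summing over \<open>T\<close> and exchanging the sums
      leaves, for each pair, the count estimated in \<open>pair\<close>.\<close>
    have sq: "(c T)\<^sup>2 = (\<Sum>p\<in>Pow B1 \<times> Pow B1. of_bool (E (fst p) T \<and> E (snd p) T))" for T
    proof -
      have "(c T)\<^sup>2 = card ({S \<in> Pow B1. E S T} \<times> {S \<in> Pow B1. E S T})"
        unfolding c_def card_cartesian_product by (simp add: power2_eq_square)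
      also have "{S \<in> Pow B1. E S T} \<times> {S \<in> Pow B1. E S T}
          = (Pow B1 \<times> Pow B1) \<inter> {p. E (fst p) T \<and> E (snd p) T}" by auto
      also have "card \<dots> = (\<Sum>p\<in>Pow B1 \<times> Pow B1. of_bool (E (fst p) T \<and> E (snd p) T))"
        using B1 by (subst sum_of_bool_eq) (auto simp: Int_def)
      finally show ?thesis .
    qed
    have "(\<Sum>T\<in>Pow B'. (c T)\<^sup>2)
        = (\<Sum>p\<in>Pow B1 \<times> Pow B1. card {T \<in> Pow B'. E (fst p) T \<and> E (snd p) T})"
      unfolding sq using B' by (subst sum.swap) (auto simp: sum_of_bool_eq Int_def intro!: sum.cong)
    then have "real (\<Sum>T\<in>Pow B'. (c T)\<^sup>2)
        = (\<Sum>p\<in>Pow B1 \<times> Pow B1. real (card {T \<in> Pow B'. E (fst p) T \<and> E (snd p) T}))" by simp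
    also have "\<dots> \<le> (\<Sum>p\<in>Pow B1 \<times> Pow B1. 2 ^ card B' * of_bool (p \<in> Z) + \<eta>\<^sup>2 / 2 * 2 ^ card B')"
    proof (intro sum_mono)
      fix p assume p: "p \<in> Pow B1 \<times> Pow B1"
      show "real (card {T \<in> Pow B'. E (fst p) T \<and> E (snd p) T}) \<le> 2 ^ card B' * of_bool (p \<in> Z) + \<eta>\<^sup>2 / 2 * 2 ^ card B'"
      proof (cases "p \<in> Z")
        case True
        have "card {T \<in> Pow B'. E (fst p) T \<and> E (snd p) T} \<le> card (Pow B')"
          using B' by (intro card_mono) auto
        then have "real (card {T \<in> Pow B'. E (fst p) T \<and> E (snd p) T}) \<le> 2 ^ card B'"
          using B' by (simp add: card_Pow)
        then show ?thesis using True by (intro order_trans[OF _ le_add_same_cancel1[THEN iffD2]]) auto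
      next
        case False
        then show ?thesis using pair[of "fst p" "snd p"] p unfolding Z_def by auto
      qed
    qed
    also have "\<dots> = 2 ^ card B' * real (card Z) + 4 ^ card B1 * (\<eta>\<^sup>2 / 2 * 2 ^ card B')"
    proof -
      have "(Pow B1 \<times> Pow B1) \<inter> Z = Z" unfolding Z_def by auto
      moreover have "(2::real) ^ card B1 * 2 ^ card B1 = 4 ^ card B1"
        unfolding power_mult_distrib[symmetric] by simp
      ultimately show ?thesis using B1
        by (simp add: sum.distrib sum_distrib_left[symmetric] sum_of_bool_eq Int_def card_cartesian_product card_Pow)
    qed
    also have "\<dots> \<le> 2 ^ card B' * (\<eta>\<^sup>2 / 2 * 4 ^ card B1) + 4 ^ card B1 * (\<eta>\<^sup>2 / 2 * 2 ^ card B')"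
      using cZ by (intro add_mono mult_left_mono) auto
    also have "\<dots> = \<eta>\<^sup>2 * 4 ^ card B1 * 2 ^ card B'" by (simp add: field_simps)
    finally have sum_sq: "real (\<Sum>T\<in>Pow B'. (c T)\<^sup>2) \<le> \<eta>\<^sup>2 * 4 ^ card B1 * 2 ^ card B'" .
    have "(real ?W)\<^sup>2 = (\<Sum>T\<in>Pow B'. real (c T))\<^sup>2" unfolding W by simp
    also have "\<dots> \<le> real (card (Pow B')) * (\<Sum>T\<in>Pow B'. (real (c T))\<^sup>2)"
      using sum_squared_le_sum_of_squares[of "\<lambda>T. real (c T)" "Pow B'"] by (simp add: mult.commute)
    also have "\<dots> \<le> 2 ^ card B' * (\<eta>\<^sup>2 * 4 ^ card B1 * 2 ^ card B')"
      using sum_sq B' by (intro mult_mono) (auto simp: card_Pow intro: sum_nonneg)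
    also have "\<dots> = (\<eta> * 2 ^ card (B1 \<union> B'))\<^sup>2"
    proof -
      have "(4::real) ^ card B1 = (2 ^ card B1)\<^sup>2" by (simp add: power2_eq_square flip: power_mult_distrib)
      then show ?thesis using B1 B' disj
        by (simp add: card_Un_disjoint power_add power_mult_distrib power2_eq_square)
    qed
    finally show ?thesis by (rule power2_le_imp_le) (use Suc.prems(3) in simp)
  qed
  moreover have "finite (B1 \<union> B')" "B1 \<union> B' \<subseteq> N" "\<rho>' / 2 > 0" using B1 B' \<rho>' by auto
  ultimately show ?case by blast
qed

section \<open>Jensen's formula\<close>

lemma sin_ge_div_pi:
  fixes x :: real
  assumes "0 \<le> x" "x \<le> pi / 2"
  shows "x / pi \<le> sin x"
\<comment> \<open>Up to \<open>pi / 3\<close> the cosine is at least 1/2 and hence at least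
  \<open>1 / pi\<close>; beyond it the sine is at least 1/2 and hence at least
  \<open>x / pi\<close>.\<close>
proof (cases "x \<le> pi / 3")
  case True
  have "sin 0 - 0 / pi \<le> sin x - x / pi"
  proof (rule DERIV_nonneg_imp_nondecreasing[OF assms(1)])
    fix t assume t: "0 \<le> t" "t \<le> x"
    have "cos (pi / 3) \<le> cos t" using t True by (intro cos_monotone_0_pi_le) auto
    moreover have "1 / pi \<le> 1 / 2" using pi_ge_two by (intro divide_left_mono) auto
    ultimately have "0 \<le> cos t - 1 / pi" unfolding cos_60 by linarith
    moreover have "((\<lambda>x. sin x - x / pi) has_real_derivative (cos t - 1 / pi)) (at t)"
      by (auto intro!: derivative_eq_intros)
    ultimately show "\<exists>y. ((\<lambda>x. sin x - x / pi) has_real_derivative y) (at t) \<and> 0 \<le> y" by blast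
  qed
  then show ?thesis by simp
next
  case False
  have "sin (pi / 6) \<le> sin x" using False assms by (intro sin_monotone_2pi_le) auto
  moreover have "x / pi \<le> 1 / 2" using assms by (simp add: field_simps)
  ultimately show ?thesis unfolding sin_30 by linarith
qed

lemma abs_sin_pi_ge:
  fixes u :: real
  assumes "\<bar>u\<bar> \<le> 1"
  shows "min \<bar>u\<bar> (1 - \<bar>u\<bar>) \<le> \<bar>sin (pi * u)\<bar>"
proof -
  have "\<bar>sin (pi * u)\<bar> = \<bar>sin (pi * \<bar>u\<bar>)\<bar>" by (cases "u \<ge> 0") auto
  moreover have "min \<bar>u\<bar> (1 - \<bar>u\<bar>) \<le> sin (pi * \<bar>u\<bar>)"
  proof (cases "\<bar>u\<bar> \<le> 1 / 2")
    case True
    then have "pi * \<bar>u\<bar> / pi \<le> sin (pi * \<bar>u\<bar>)" by (intro sin_ge_div_pi) (auto simp: field_simps)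
    then show ?thesis by simp
  next
    case False
    then have "pi * (1 - \<bar>u\<bar>) / pi \<le> sin (pi * (1 - \<bar>u\<bar>))"
      using assms by (intro sin_ge_div_pi) (auto simp: field_simps)
    also have "sin (pi * (1 - \<bar>u\<bar>)) = sin (pi * \<bar>u\<bar>)" by (simp add: right_diff_distrib sin_diff)
    finally show ?thesis by simp
  qed
  ultimately show ?thesis by linarith
qed

lemma norm_cis_diff: "cmod (cis a - cis b) = 2 * \<bar>sin ((a - b) / 2)\<bar>"
proof -
  have "(cmod (cis a - cis b))\<^sup>2 = (cos a - cos b)\<^sup>2 + (sin a - sin b)\<^sup>2" by (simp add: cmod_power2)
  also have "\<dots> = ((cos a)\<^sup>2 + (sin a)\<^sup>2) + ((cos b)\<^sup>2 + (sin b)\<^sup>2) - 2 * (cos a * cos b + sin a * sin b)"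
    by (simp add: power2_diff algebra_simps)
  also have "\<dots> = 2 - 2 * cos (a - b)" by (simp add: cos_diff)
  also have "\<dots> = 2 - 2 * cos (2 * ((a - b) / 2))" by (metis mult.commute nonzero_divide_eq_eq zero_neq_numeral)
  also have "\<dots> = (2 * \<bar>sin ((a - b) / 2)\<bar>)\<^sup>2" unfolding cos_double_sin by simp
  finally show ?thesis by (rule power2_eq_imp_eq) auto
qed

text \<open>The nearest point of the unit circle to \<open>w\<close> is \<open>w / |w|\<close>.\<close>

lemma dist_circle_ge:
  obtains s where "0 \<le> s" "s \<le> 1"
    "\<And>t. 0 \<le> t \<Longrightarrow> t \<le> 1 \<Longrightarrow> min \<bar>t - s\<bar> (1 - \<bar>t - s\<bar>) \<le> cmod (cis (2 * pi * t) - w)"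
proof -
  define s where "s = Arg2pi w / (2 * pi)"
  have s: "0 \<le> s" "s \<le> 1" using Arg2pi[of w] by (auto simp: s_def)
  have w: "w = cmod w * cis (2 * pi * s)"
    using Arg2pi[of w] by (simp add: s_def is_Arg_def cis_conv_exp)
  have "min \<bar>t - s\<bar> (1 - \<bar>t - s\<bar>) \<le> cmod (cis (2 * pi * t) - w)" if t: "0 \<le> t" "t \<le> 1" for t
  proof -
    \<comment> \<open>A detour through the radial projection of \<open>w\<close>: the radial defect
      of \<open>w\<close> is itself at most the distance to be estimated, so the chord is at most
      twice that distance.\<close>
    have "cmod (cis (2 * pi * t) - cis (2 * pi * s))
        \<le> cmod (cis (2 * pi * t) - w) + cmod (w - cis (2 * pi * s))"
      using norm_triangle_ineq[of "cis (2 * pi * t) - w" "w - cis (2 * pi * s)"] by simp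
    also have "w - cis (2 * pi * s) = complex_of_real (cmod w - 1) * cis (2 * pi * s)"
      by (subst w) (simp add: algebra_simps)
    also have "cmod \<dots> = \<bar>cmod w - cmod (cis (2 * pi * t))\<bar>" by (simp add: norm_mult del: of_real_diff)
    also have "\<dots> \<le> cmod (cis (2 * pi * t) - w)" using norm_triangle_ineq3[of "cis (2 * pi * t)" w] by (simp only: abs_minus_commute)
    finally have "cmod (cis (2 * pi * t) - w) \<ge> \<bar>sin (pi * (t - s))\<bar>"
      by (simp add: norm_cis_diff algebra_simps diff_divide_distrib)
    moreover have "min \<bar>t - s\<bar> (1 - \<bar>t - s\<bar>) \<le> \<bar>sin (pi * (t - s))\<bar>"
      using s t by (intro abs_sin_pi_ge) auto
    ultimately show ?thesis by linarith
  qed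
  with s show thesis using that by blast
qed

section \<open>Normalised arc length on the unit circle\<close>

definition circ :: "complex measure" where
  "circ = distr (uniform_measure lborel {0..1::real}) borel (\<lambda>t. cis (2 * pi * t))"

lemma sets_circ [simp, measurable_cong]: "sets circ = sets borel"
  and space_circ [simp]: "space circ = UNIV"
  by (auto simp: circ_def)

lemma measurable_cis [measurable]: "(\<lambda>t. cis (2 * pi * t)) \<in> borel_measurable borel"
  by (intro borel_measurable_continuous_onI continuous_intros)

lemma prob_space_circ: "prob_space circ"
  unfolding circ_def
  by (intro prob_space.prob_space_distr prob_space_uniform_measure) auto

interpretation circ: prob_space circ by (rule prob_space_circ)

lemma nn_integral_circ:
  assumes [measurable]: "f \<in> borel_measurable borel"
  shows "(\<integral>\<^sup>+z. f z \<partial>circ) = (\<integral>\<^sup>+t. f (cis (2 * pi * t)) * indicator {0..1} t \<partial>lborel)"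
  unfolding circ_def
  by (subst nn_integral_distr) (simp_all add: nn_integral_uniform_measure divide_ennreal_def)

lemma AE_circI:
  assumes "{z. P z} \<in> sets borel" "finite F" "\<And>t. 0 \<le> t \<Longrightarrow> t \<le> 1 \<Longrightarrow> t \<notin> F \<Longrightarrow> P (cis (2 * pi * t))"
  shows "AE z in circ. P z"
proof -
  have "AE t in lborel. t \<notin> F"
    using assms(2) finite_imp_null_set_lborel[of F] by (intro AE_not_in) auto
  then have "AE t in uniform_measure lborel {0..1}. P (cis (2 * pi * t))"
    by (intro AE_uniform_measureI) (auto intro: assms(3) elim!: eventually_mono)
  then show ?thesis unfolding circ_def using assms(1)
    by (subst AE_distr_iff) auto
qed

lemma AE_circ_norm: "AE z in circ. cmod z = 1"
  by (rule AE_circI[of _ "{}"]) auto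

lemma AE_circ_neq: "AE z in circ. z \<noteq> w"
proof -
  obtain s where s: "0 \<le> s" "s \<le> 1"
    "\<And>t. 0 \<le> t \<Longrightarrow> t \<le> 1 \<Longrightarrow> min \<bar>t - s\<bar> (1 - \<bar>t - s\<bar>) \<le> cmod (cis (2 * pi * t) - w)"
    using dist_circle_ge by blast
  show ?thesis
  proof (rule AE_circI[of _ "{s, s + 1, s - 1}"])
    fix t assume t: "0 \<le> t" "t \<le> (1::real)" "t \<notin> {s, s + 1, s - 1}"
    then have "0 < min \<bar>t - s\<bar> (1 - \<bar>t - s\<bar>)" using s by (auto simp: abs_if)
    also note s(3)[OF t(1,2)]
    finally show "cis (2 * pi * t) \<noteq> w" by auto
  qed auto
qed

text \<open>The exponent -1/2 is above the critical exponent -1 for integrability along a curve. By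
  \<open>dist_circle_ge\<close> the kernel is dominated, in the angular parameter, by three
  translates of \<open>\<bar>u\<bar> powr (-1/2)\<close>, singular at \<open>s\<close>,
  \<open>s + 1\<close> and \<open>s - 1\<close>; the position of \<open>w\<close> only shifts them,
  which gives a common bound.\<close>

lemma singular_kernel_finite:
  "\<exists>K<\<infinity>. \<forall>w. (\<integral>\<^sup>+z. ennreal (cmod (z - w) powr (-1/2)) \<partial>circ) \<le> K"
proof -
  define g :: "real \<Rightarrow> real" where "g u = \<bar>u\<bar> powr (-1/2)" for u
  have [measurable]: "g \<in> borel_measurable borel" unfolding g_def by measurable
  \<comment> \<open>The interval \<open>{-2..2}\<close> contains \<open>t - p\<close> for every
    \<open>t\<close> in the unit interval and each of the three singularities
    \<open>p\<close>.\<close>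
  define K0 where "K0 = (\<integral>\<^sup>+u. ennreal (g u) * indicator {-2..2} u \<partial>lborel)"
  have "K0 < \<infinity>"
  proof -
    define K1 where "K1 = (\<integral>\<^sup>+u. ennreal (u powr (-1/2)) * indicator {0..2} u \<partial>lborel)"
    have "((\<lambda>x. x powr (-1/2)) has_integral (2 powr (-1/2 + 1) / (-1/2 + 1))) {0..2::real}"
      by (rule has_integral_powr_from_0) auto
    from nn_integral_has_integral_lebesgue'[OF _ this] have K1: "K1 < \<infinity>" unfolding K1_def by simp
    have "K0 \<le> (\<integral>\<^sup>+u. ennreal (u powr (-1/2)) * indicator {0..2} u +
        ennreal ((0 + (-1) * u) powr (-1/2)) * indicator {0..2} (0 + (-1) * u) \<partial>lborel)"
      unfolding K0_def g_def by (intro nn_integral_mono) (auto split: split_indicator)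
    also have "\<dots> = K1 + (\<integral>\<^sup>+u. ennreal ((0 + (-1) * u) powr (-1/2)) * indicator {0..2} (0 + (-1) * u) \<partial>lborel)"
      unfolding K1_def by (rule nn_integral_add) auto
    also have "(\<integral>\<^sup>+u. ennreal ((0 + (-1) * u) powr (-1/2)) * indicator {0..2} (0 + (-1) * u) \<partial>lborel) = K1"
      unfolding K1_def by (subst (2) nn_integral_real_affine[where c = "-1" and t = 0]) auto
    finally show ?thesis using K1 by (auto simp: less_top[symmetric] top_unique)
  qed
  have shift: "(\<integral>\<^sup>+t. ennreal (g (t - p)) * indicator {0..1} t \<partial>lborel) \<le> K0" if "-1 \<le> p" "p \<le> 2" for p
  proof -
    have "(\<integral>\<^sup>+t. ennreal (g (t - p)) * indicator {0..1} t \<partial>lborel)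
        = (\<integral>\<^sup>+t. ennreal (g t) * indicator {0..1} (p + t) \<partial>lborel)"
      by (subst nn_integral_real_affine[where c = 1 and t = p]) auto
    also have "\<dots> \<le> K0" unfolding K0_def using that
      by (intro nn_integral_mono) (auto split: split_indicator)
    finally show ?thesis .
  qed
  have "(\<integral>\<^sup>+z. ennreal (cmod (z - w) powr (-1/2)) \<partial>circ) \<le> K0 + K0 + K0" for w
  proof -
    obtain s where s: "0 \<le> s" "s \<le> 1"
      "\<And>t. 0 \<le> t \<Longrightarrow> t \<le> 1 \<Longrightarrow> min \<bar>t - s\<bar> (1 - \<bar>t - s\<bar>) \<le> cmod (cis (2 * pi * t) - w)"
      using dist_circle_ge by blast
    define h where "h p t = ennreal (g (t - p)) * indicator {0..1} t" for p t
    define f where "f t = ennreal (cmod (cis (2 * pi * t) - w) powr (-1/2)) * indicator {0..1} t" for t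
    have [measurable]: "h p \<in> borel_measurable borel" for p unfolding h_def by measurable
    have "AE t in lborel. t \<notin> {s, s + 1, s - 1}"
      using finite_imp_null_set_lborel[of "{s, s + 1, s - 1}"] by (intro AE_not_in) auto
    then have ae: "AE t in lborel. f t
       \<le> (h s t + h (s + 1) t)
         + h (s - 1) t"
    proof eventually_elim
      fix t assume t: "t \<notin> {s, s + 1, s - 1}"
      show "f t
       \<le> (h s t + h (s + 1) t)
         + h (s - 1) t"
      proof (cases "0 \<le> t \<and> t \<le> 1")
        case True
        define m where "m = min \<bar>t - s\<bar> (1 - \<bar>t - s\<bar>)"
        have m0: "0 < m" using s t True unfolding m_def by (auto simp: abs_if)
        have "cmod (cis (2 * pi * t) - w) powr (-1/2) \<le> m powr (-1/2)"
          using s(3)[of t] True m0 by (intro powr_mono2') (auto simp: m_def)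
        also have "m = \<bar>t - s\<bar> \<or> m = \<bar>t - (s + 1)\<bar> \<or> m = \<bar>t - (s - 1)\<bar>"
          using s True unfolding m_def by (auto simp: min_def abs_if)
        then have "m powr (-1/2) \<le> (g (t - s) + g (t - (s + 1))) + g (t - (s - 1))"
          unfolding g_def by (elim disjE) (simp_all add: add_increasing add_increasing2)
        finally have "cmod (cis (2 * pi * t) - w) powr (-1/2) \<le> (g (t - s) + g (t - (s + 1))) + g (t - (s - 1))" .
        then have "ennreal (cmod (cis (2 * pi * t) - w) powr (-1/2)) \<le> ennreal ((g (t - s) + g (t - (s + 1))) + g (t - (s - 1)))"
          by (rule ennreal_leI)
        also have "\<dots> = ennreal (g (t - s)) + ennreal (g (t - (s + 1))) + ennreal (g (t - (s - 1)))"
          by (simp add: g_def)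
        finally show ?thesis using True by (simp add: f_def h_def)
      qed (simp add: f_def)
    qed
    have "(\<integral>\<^sup>+z. ennreal (cmod (z - w) powr (-1/2)) \<partial>circ)
        = (\<integral>\<^sup>+t. f t \<partial>lborel)"
      unfolding f_def by (rule nn_integral_circ) measurable
    also have "\<dots> \<le> (\<integral>\<^sup>+t. (h s t + h (s + 1) t)
         + h (s - 1) t \<partial>lborel)"
      by (rule nn_integral_mono_AE[OF ae])
    also have "\<dots> = (\<integral>\<^sup>+t. h s t \<partial>lborel)
        + (\<integral>\<^sup>+t. h (s + 1) t \<partial>lborel)
        + (\<integral>\<^sup>+t. h (s - 1) t \<partial>lborel)"
      by (subst nn_integral_add, measurable)+
    also have "\<dots> \<le> K0 + K0 + K0" unfolding h_def using s by (intro add_mono shift) auto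
    finally show ?thesis .
  qed
  moreover have "K0 + K0 + K0 < \<infinity>" using \<open>K0 < \<infinity>\<close> by (simp add: ennreal_add_eq_top less_top)
  ultimately show ?thesis by blast
qed

text \<open>By periodicity it does not matter where a full turn starts: the part beyond 1 is moved
  back by 1.\<close>

lemma nn_integral_circ_affine:
  assumes [measurable]: "f \<in> borel_measurable borel" and a: "0 \<le> a" "a \<le> 1"
  shows "(\<integral>\<^sup>+t. f (cis (2 * pi * t)) * indicator {a..a + 1} t \<partial>lborel) = (\<integral>\<^sup>+z. f z \<partial>circ)"
proof -
  define F where "F t = f (cis (2 * pi * t))" for t
  have per: "F (1 + t) = F t" for t
  proof -
    have "cis (2 * pi * (1 + t)) = cis (2 * pi) * cis (2 * pi * t)"
      unfolding cis_mult by (simp add: distrib_left)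
    then show ?thesis by (simp add: F_def)
  qed
  have [measurable]: "F \<in> borel_measurable borel" unfolding F_def by measurable
  have split: "(\<integral>\<^sup>+t. F t * indicator {b..c} t \<partial>lborel)
      = (\<integral>\<^sup>+t. F t * indicator {b..<m} t \<partial>lborel) + (\<integral>\<^sup>+t. F t * indicator {m..c} t \<partial>lborel)"
    if "b \<le> m" "m \<le> c" for b c m :: real
    using that by (subst nn_integral_add[symmetric]) (auto intro!: nn_integral_cong split: split_indicator)
  have null: "(\<integral>\<^sup>+t. F t * indicator {b..<c} t \<partial>lborel) = (\<integral>\<^sup>+t. F t * indicator {b..c} t \<partial>lborel)" for b c :: real
  proof (rule nn_integral_cong_AE)
    have "AE t in lborel. t \<noteq> c" by (rule AE_lborel_singleton)
    then show "AE t in lborel. F t * indicator {b..<c} t = F t * indicator {b..c} t"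
      by eventually_elim (auto split: split_indicator)
  qed
  have "(\<integral>\<^sup>+t. F t * indicator {a..a + 1} t \<partial>lborel)
      = (\<integral>\<^sup>+t. F t * indicator {a..<1} t \<partial>lborel) + (\<integral>\<^sup>+t. F t * indicator {1..a + 1} t \<partial>lborel)"
    using a by (intro split) auto
  also have "(\<integral>\<^sup>+t. F t * indicator {1..a + 1} t \<partial>lborel) = (\<integral>\<^sup>+t. F t * indicator {0..a} t \<partial>lborel)"
    by (subst nn_integral_real_affine[where c = 1 and t = 1])
      (auto simp: per intro!: nn_integral_cong split: split_indicator)
  also have "(\<integral>\<^sup>+t. F t * indicator {a..<1} t \<partial>lborel) + (\<integral>\<^sup>+t. F t * indicator {0..a} t \<partial>lborel)
      = (\<integral>\<^sup>+t. F t * indicator {0..<a} t \<partial>lborel) + (\<integral>\<^sup>+t. F t * indicator {a..1} t \<partial>lborel)"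
    by (simp add: null add.commute)
  also have "\<dots> = (\<integral>\<^sup>+t. F t * indicator {0..1} t \<partial>lborel)"
    using a by (intro split[symmetric]) auto
  also have "\<dots> = (\<integral>\<^sup>+z. f z \<partial>circ)" unfolding F_def by (rule nn_integral_circ[symmetric]) fact
  finally show ?thesis unfolding F_def .
qed

lemma distr_circ_uminus: "distr circ borel uminus = circ"
proof (rule measure_eqI)
  fix A assume A: "A \<in> sets (distr circ borel uminus)"
  then have [measurable]: "A \<in> sets borel" by simp
  have neg: "- cis (2 * pi * t) = cis (2 * pi * (1/2 + t))" for t
  proof -
    have "cis (2 * pi * (1/2 + t)) = cis pi * cis (2 * pi * t)"
      unfolding cis_mult by (simp add: distrib_left)
    then show ?thesis by simp
  qed
  have "emeasure (distr circ borel uminus) A = (\<integral>\<^sup>+z. indicator A z \<partial>distr circ borel uminus)"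
    by (rule nn_integral_indicator[symmetric]) simp
  also have "\<dots> = (\<integral>\<^sup>+z. indicator A (- z) \<partial>circ)" by (rule nn_integral_distr) simp_all
  also have "\<dots> = (\<integral>\<^sup>+t. indicator A (cis (2 * pi * (1/2 + t))) * indicator {0..1} t \<partial>lborel)"
    by (subst nn_integral_circ) (simp_all only: neg, measurable)
  also have "\<dots> = (\<integral>\<^sup>+t. indicator A (cis (2 * pi * t)) * indicator {1/2..1/2 + 1} t \<partial>lborel)"
    by (subst (2) nn_integral_real_affine[where c = 1 and t = "1/2"])
      (auto intro!: nn_integral_cong split: split_indicator)
  also have "\<dots> = (\<integral>\<^sup>+z. indicator A z \<partial>circ)" by (rule nn_integral_circ_affine) auto
  finally show "emeasure (distr circ borel uminus) A = emeasure circ A" by simp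
qed simp

lemma distr_circ_square: "distr circ borel (\<lambda>z. z\<^sup>2) = circ"
proof (rule measure_eqI)
  fix A assume A: "A \<in> sets (distr circ borel (\<lambda>z. z\<^sup>2))"
  then have [measurable]: "A \<in> sets borel" by simp
  define F :: "real \<Rightarrow> ennreal" where "F t = indicator A (cis (2 * pi * t))" for t
  have [measurable]: "F \<in> borel_measurable borel" unfolding F_def by measurable
  have sq: "(cis (2 * pi * t))\<^sup>2 = cis (2 * pi * (0 + 2 * t))" for t
    by (simp add: power2_eq_square cis_mult)
  have "emeasure (distr circ borel (\<lambda>z. z\<^sup>2)) A = (\<integral>\<^sup>+z. indicator A z \<partial>distr circ borel (\<lambda>z. z\<^sup>2))"
    by (rule nn_integral_indicator[symmetric]) simp
  also have "\<dots> = (\<integral>\<^sup>+z. indicator A (z\<^sup>2) \<partial>circ)" by (rule nn_integral_distr) simp_all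
  also have "\<dots> = (\<integral>\<^sup>+t. F (0 + 2 * t) * indicator {0..2} (0 + 2 * t) \<partial>lborel)"
    by (subst nn_integral_circ) (auto simp: sq F_def intro!: nn_integral_cong split: split_indicator)
  finally have "2 * emeasure (distr circ borel (\<lambda>z. z\<^sup>2)) A
      = ennreal \<bar>2\<bar> * (\<integral>\<^sup>+t. F (0 + 2 * t) * indicator {0..2} (0 + 2 * t) \<partial>lborel)"
    by (simp only: abs_numeral ennreal_numeral)
  also have "\<dots> = (\<integral>\<^sup>+t. F t * indicator {0..2} t \<partial>lborel)"
    by (rule nn_integral_real_affine[symmetric]) simp_all
  also have "\<dots> = (\<integral>\<^sup>+t. F t * indicator {0..0 + 1} t + F t * indicator {1..1 + 1} t \<partial>lborel)"
  proof (rule nn_integral_cong_AE)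
    have "AE t in lborel. t \<noteq> (1 :: real)" by (rule AE_lborel_singleton)
    then show "AE t in lborel. F t * indicator {0..2} t
        = F t * indicator {0..0 + 1} t + F t * indicator {1..1 + 1} t"
      by eventually_elim (auto split: split_indicator)
  qed
  also have "\<dots> = (\<integral>\<^sup>+t. F t * indicator {0..0 + 1} t \<partial>lborel) + (\<integral>\<^sup>+t. F t * indicator {1..1 + 1} t \<partial>lborel)"
    by (rule nn_integral_add) auto
  also have "\<dots> = (\<integral>\<^sup>+z. indicator A z \<partial>circ) + (\<integral>\<^sup>+z. indicator A z \<partial>circ)"
    unfolding F_def by (intro arg_cong2[where f = "(+)"] nn_integral_circ_affine) auto
  also have "\<dots> = 2 * emeasure circ A" by (simp add: mult_2)
  finally show "emeasure (distr circ borel (\<lambda>z. z\<^sup>2)) A = emeasure circ A"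
    by (simp add: ennreal_mult_cancel_left)
qed simp

section \<open>The logarithmic kernel on circles and Jensen's formula\<close>

definition log_kernel :: "complex \<Rightarrow> complex \<Rightarrow> real" where
  "log_kernel v w = ln (cmod (v - w)) - log_plus (cmod w)"

lemma log_plus_eq_ln_max: "0 \<le> x \<Longrightarrow> log_plus x = ln (max 1 x)"
  by (cases "x = 0") (auto simp: log_plus_def max_def)

lemma measurable_log_kernel [measurable]: "(\<lambda>v. log_kernel v w) \<in> borel_measurable borel"
  unfolding log_kernel_def by measurable

text \<open>Subtracting \<open>log_plus (cmod w)\<close> makes the bounds uniform in \<open>w\<close>.\<close>

lemma log_kernel_bounds:
  assumes "v \<noteq> w" "1 + cmod v \<le> B"
  shows "log_kernel v w \<le> ln B"
    and "- log_kernel v w \<le> 4 * (B / cmod (v - w)) powr (1/4)"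
proof -
  define m where "m = max 1 (cmod w)"
  define x where "x = B / cmod (v - w)"
  have B: "B \<ge> 1" using assms by (smt (verit) norm_ge_zero)
  have m1: "m \<ge> 1" "cmod w \<le> m" by (auto simp: m_def)
  have eq: "log_kernel v w = ln (cmod (v - w)) - ln m"
    unfolding log_kernel_def m_def by (simp add: log_plus_eq_ln_max)
  have pos: "cmod (v - w) > 0" using assms by simp
  have "cmod (v - w) \<le> cmod v + cmod w" by (rule norm_triangle_ineq4)
  also have "\<dots> \<le> (B - 1) * m + m"
    using m1 assms B by (intro add_mono) (use mult_mono[of "cmod v" "B - 1" 1 m] in auto)
  finally have "cmod (v - w) \<le> B * m" by (simp add: algebra_simps)
  then have "ln (cmod (v - w)) \<le> ln (B * m)" using pos by (simp add: ln_mono)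
  then show "log_kernel v w \<le> ln B" unfolding eq using B m1 by (simp add: ln_mult)
  have x: "x > 0" unfolding x_def using B pos by simp
  have "cmod w \<le> cmod (v - w) + cmod v" by (metis norm_minus_commute norm_triangle_sub add.commute)
  then have "cmod w \<le> cmod (v - w) + B" using assms(2) by linarith
  moreover have "1 \<le> cmod (v - w) + B" using B pos by linarith
  ultimately have "m \<le> cmod (v - w) + B" unfolding m_def by simp
  also have "\<dots> = cmod (v - w) * (1 + x)" unfolding x_def using pos by (simp add: distrib_left)
  finally have "ln m \<le> ln (cmod (v - w) * (1 + x))" using m1 by (simp add: ln_mono)
  then have "- log_kernel v w \<le> ln (1 + x)" unfolding eq using pos x by (simp add: ln_mult)
  \<comment> \<open>The fourth root is taken so that the square of the final bound has exponent -1/2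
    in the distance, for which the circle integrals are bounded.\<close>
  also have "\<dots> \<le> ln ((1 + x powr (1/4)) ^ 4)"
  proof -
    have "x = (x powr (1/4)) ^ 4" using x by (simp add: powr_power)
    moreover have "1 + y ^ 4 \<le> (1 + y) ^ 4" if "y \<ge> 0" for y :: real
      using that by (simp add: power4_eq_xxxx algebra_simps)
    ultimately have "1 + x \<le> (1 + x powr (1/4)) ^ 4" by (metis powr_ge_zero)
    then show ?thesis using x by (simp add: ln_mono)
  qed
  also have "\<dots> = 4 * ln (1 + x powr (1/4))" using x by (simp add: ln_realpow add_pos_nonneg)
  also have "\<dots> \<le> 4 * x powr (1/4)" using ln_add_one_self_le_self[of "x powr (1/4)"] by simp
  finally show "- log_kernel v w \<le> 4 * (B / cmod (v - w)) powr (1/4)" unfolding x_def .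
qed

lemma log_kernel_square_bound:
  assumes "v \<noteq> w" "1 + cmod v \<le> B"
  shows "(log_kernel v w)\<^sup>2 \<le> (ln B)\<^sup>2 + 16 * (B / cmod (v - w)) powr (1/2)"
proof -
  define y where "y = (B / cmod (v - w)) powr (1/4)"
  have y: "y \<ge> 0" "y\<^sup>2 = (B / cmod (v - w)) powr (1/2)"
    unfolding y_def by (simp_all add: power2_eq_square flip: powr_add)
  have B: "B \<ge> 1" using assms by (smt (verit) norm_ge_zero)
  have "\<bar>log_kernel v w\<bar> \<le> ln B \<or> \<bar>log_kernel v w\<bar> \<le> 4 * y"
    using log_kernel_bounds[OF assms] unfolding y_def by linarith
  then have "(log_kernel v w)\<^sup>2 \<le> (ln B)\<^sup>2 \<or> (log_kernel v w)\<^sup>2 \<le> (4 * y)\<^sup>2"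
    using B y by (metis abs_ge_zero abs_of_nonneg ln_ge_zero mult_nonneg_nonneg power2_abs power_mono zero_le_numeral)
  then show ?thesis unfolding y(2)[symmetric] power_mult_distrib
    by (elim disjE) (simp_all add: add_increasing add_increasing2)
qed

lemma singular_kernel_bound:
  "\<exists>K. \<forall>w. integrable circ (\<lambda>z. cmod (z - w) powr (-1/2)) \<and> (\<integral>z. cmod (z - w) powr (-1/2) \<partial>circ) \<le> K"
proof -
  obtain K where K: "K < \<infinity>" "\<And>w. (\<integral>\<^sup>+z. ennreal (cmod (z - w) powr (-1/2)) \<partial>circ) \<le> K"
    using singular_kernel_finite by blast
  have int: "integrable circ (\<lambda>z. cmod (z - w) powr (-1/2))" for w
    using K(1) K(2)[of w] by (intro integrableI_nonneg) (auto simp: order_le_less_trans)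
  have "(\<integral>z. cmod (z - w) powr (-1/2) \<partial>circ) \<le> enn2real K" for w
    using K by (subst integral_eq_nn_integral) (auto intro!: enn2real_mono)
  with int show ?thesis by blast
qed

text \<open>Since \<open>C\<close> does not depend on \<open>w\<close>, averages of the kernel over
  arbitrary zeros stay bounded in mean square, wherever these zeros lie.\<close>

lemma log_kernel_circle_bound:
  assumes "\<rho> > 0"
  shows "\<exists>C. \<forall>w. integrable circ (\<lambda>z. (log_kernel (y + of_real \<rho> * z) w)\<^sup>2) \<and>
    (\<integral>z. (log_kernel (y + of_real \<rho> * z) w)\<^sup>2 \<partial>circ) \<le> C"
proof -
  obtain K where K: "\<And>w. integrable circ (\<lambda>z. cmod (z - w) powr (-1/2))"
    "\<And>w. (\<integral>z. cmod (z - w) powr (-1/2) \<partial>circ) \<le> K"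
    using singular_kernel_bound by blast
  define B where "B = 1 + cmod y + \<rho>"
  define D where "D = 16 * (B / \<rho>) powr (1/2)"
  define g where "g w z = (ln B)\<^sup>2 + D * cmod (z - (w - y) / of_real \<rho>) powr (-1/2)" for w z
  have D: "D \<ge> 0" unfolding D_def by simp
  have int_g: "integrable circ (g w)" for w unfolding g_def using K(1) by simp
  have le: "AE z in circ. (log_kernel (y + of_real \<rho> * z) w)\<^sup>2 \<le> g w z" for w
    using AE_circ_norm AE_circ_neq[of "(w - y) / of_real \<rho>"]
  proof eventually_elim
    fix z assume z: "cmod z = 1" "z \<noteq> (w - y) / of_real \<rho>"
    define v where "v = y + of_real \<rho> * z"
    have eq: "v - w = of_real \<rho> * (z - (w - y) / of_real \<rho>)"
      using assms by (simp add: v_def field_simps)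
    have "v \<noteq> w" using eq z assms by auto
    moreover have "1 + cmod v \<le> B"
      unfolding v_def B_def using norm_triangle_ineq[of y "of_real \<rho> * z"] z assms by (simp add: norm_mult)
    ultimately have "(log_kernel v w)\<^sup>2 \<le> (ln B)\<^sup>2 + 16 * (B / cmod (v - w)) powr (1/2)"
      by (rule log_kernel_square_bound)
    also have "B / cmod (v - w) = (B / \<rho>) * inverse (cmod (z - (w - y) / of_real \<rho>))"
      unfolding eq norm_mult using assms by (simp add: divide_simps)
    also have "16 * \<dots> powr (1/2) = D * cmod (z - (w - y) / of_real \<rho>) powr (-1/2)"
      unfolding D_def using assms
      by (subst powr_mult) (auto simp: B_def powr_minus inverse_powr)
    finally show "(log_kernel (y + of_real \<rho> * z) w)\<^sup>2 \<le> g w z" unfolding g_def v_def .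
  qed
  have int: "integrable circ (\<lambda>z. (log_kernel (y + of_real \<rho> * z) w)\<^sup>2)" for w
    by (rule Bochner_Integration.integrable_bound[OF int_g[of w]])
      (use le[of w] in \<open>measurable, auto elim!: eventually_mono\<close>)
  have "(\<integral>z. (log_kernel (y + of_real \<rho> * z) w)\<^sup>2 \<partial>circ) \<le> (ln B)\<^sup>2 + D * K" for w
  proof -
    have "(\<integral>z. (log_kernel (y + of_real \<rho> * z) w)\<^sup>2 \<partial>circ) \<le> (\<integral>z. g w z \<partial>circ)"
      by (rule integral_mono_AE[OF int int_g le])
    also have "\<dots> = (ln B)\<^sup>2 + D * (\<integral>z. cmod (z - (w - y) / of_real \<rho>) powr (-1/2) \<partial>circ)"
      unfolding g_def using K(1) circ.prob_space by simp
    also have "\<dots> \<le> (ln B)\<^sup>2 + D * K" using K(2) D by (intro add_left_mono mult_left_mono)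
    finally show ?thesis .
  qed
  with int show ?thesis by blast
qed

lemma integrable_log_kernel:
  assumes "\<rho> > 0" shows "integrable circ (\<lambda>z. log_kernel (y + of_real \<rho> * z) w)"
proof (rule Bochner_Integration.integrable_bound)
  show "integrable circ (\<lambda>z. 1 + (log_kernel (y + of_real \<rho> * z) w)\<^sup>2)"
    using log_kernel_circle_bound[OF assms, of y] by auto
  have "\<bar>x\<bar> \<le> 1 + x\<^sup>2" for x :: real
    using zero_le_power2[of "\<bar>x\<bar> - 1"] by (simp add: power2_diff power2_abs)
  then show "AE z in circ. norm (log_kernel (y + of_real \<rho> * z) w)
      \<le> norm (1 + (log_kernel (y + of_real \<rho> * z) w)\<^sup>2)"
    by (simp add: abs_of_nonneg)
qed measurable

lemma log_plus_square: "0 \<le> x \<Longrightarrow> log_plus (x\<^sup>2) = 2 * log_plus x"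
  by (cases "x = 0") (simp_all add: log_plus_def ln_realpow max_def)

text \<open>Both \<open>z \<mapsto> - z\<close> and \<open>z \<mapsto> z\<^sup>2\<close> preserve the uniform measure on the circle, so the mean \<open>H\<close>
  of the log kernel satisfies \<open>H (w\<^sup>2) = 2 * H w\<close>. Being bounded, it vanishes. This is Jensen's formula.\<close>

lemma integral_log_kernel_circ: "(\<integral>z. log_kernel z w \<partial>circ) = 0"
proof -
  define H where "H w = (\<integral>z. log_kernel z w \<partial>circ)" for w
  have int: "integrable circ (\<lambda>z. log_kernel z w)" for w
    using integrable_log_kernel[of 1 0 w] by simp
  obtain C where C: "\<And>w. integrable circ (\<lambda>z. (log_kernel z w)\<^sup>2)"
      "\<And>w. (\<integral>z. (log_kernel z w)\<^sup>2 \<partial>circ) \<le> C"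
    using log_kernel_circle_bound[of 1 0] by (simp add: field_simps) blast
  have H_bound: "\<bar>H w\<bar> \<le> 1 + C" for w
  proof -
    have "\<bar>x\<bar> \<le> 1 + x\<^sup>2" for x :: real
      using zero_le_power2[of "\<bar>x\<bar> - 1"] by (simp add: power2_diff power2_abs)
    note sq = this
    have "\<bar>H w\<bar> \<le> (\<integral>z. \<bar>log_kernel z w\<bar> \<partial>circ)"
      unfolding H_def by (rule integral_abs_bound)
    also have "\<dots> \<le> (\<integral>z. 1 + (log_kernel z w)\<^sup>2 \<partial>circ)"
      using int C(1) sq by (intro integral_mono) auto
    also have "\<dots> \<le> 1 + C" using C circ.prob_space by simp
    finally show ?thesis .
  qed
  have double: "H (w\<^sup>2) = 2 * H w" for w
  proof -
    have m: "(\<integral>z. log_kernel z (w\<^sup>2) \<partial>circ) = (\<integral>z. log_kernel (z\<^sup>2) (w\<^sup>2) \<partial>circ)"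
      by (subst (1) distr_circ_square[symmetric], subst integral_distr) auto
    have minus: "(\<integral>z. log_kernel z w \<partial>circ) = (\<integral>z. log_kernel (- z) w \<partial>circ)"
      by (subst (1) distr_circ_uminus[symmetric], subst integral_distr) auto
    have int_minus: "integrable circ (\<lambda>z. log_kernel (- z) w)"
      using int[of w] by (subst (asm) distr_circ_uminus[symmetric], subst (asm) integrable_distr_eq) auto
    have "H (w\<^sup>2) = (\<integral>z. log_kernel z w + log_kernel (- z) w \<partial>circ)"
      unfolding H_def m
    proof (rule integral_cong_AE)
      show "AE z in circ. log_kernel (z\<^sup>2) (w\<^sup>2) = log_kernel z w + log_kernel (- z) w"
        using AE_circ_neq[of w] AE_circ_neq[of "- w"]
      proof eventually_elim
        fix z assume z: "z \<noteq> w" "z \<noteq> - w"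
        have "z\<^sup>2 - w\<^sup>2 = (z - w) * (z + w)" by (simp add: power2_eq_square algebra_simps)
        moreover have "cmod (z + w) = cmod (- z - w)" using norm_minus_cancel[of "z + w"] by simp
        ultimately have "cmod (z\<^sup>2 - w\<^sup>2) = cmod (z - w) * cmod (- z - w)" by (simp add: norm_mult)
        moreover have "cmod (z - w) > 0" "cmod (- z - w) > 0" using z by (auto simp: add_eq_0_iff minus_equation_iff)
        ultimately show "log_kernel (z\<^sup>2) (w\<^sup>2) = log_kernel z w + log_kernel (- z) w"
          by (simp add: log_kernel_def norm_power log_plus_square ln_mult)
      qed
    qed measurable
    also have "\<dots> = H w + H w" unfolding H_def using int int_minus minus by simp
    finally show ?thesis by simp
  qed
  have iter: "H (w ^ (2 ^ n)) = 2 ^ n * H w" for n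
  proof (induction n)
    case (Suc n)
    have "w ^ (2 ^ Suc n) = (w ^ (2 ^ n))\<^sup>2" by (simp flip: power_mult add: mult.commute)
    then show ?case using double[of "w ^ (2 ^ n)"] Suc by simp
  qed simp
  have "H w = 0"
  proof (rule ccontr)
    assume "H w \<noteq> 0"
    then obtain n :: nat where n: "(1 + C) / \<bar>H w\<bar> < 2 ^ n"
      using real_arch_pow[of 2 "(1 + C) / \<bar>H w\<bar>"] by auto
    have "2 ^ n * \<bar>H w\<bar> \<le> 1 + C" using H_bound[of "w ^ (2 ^ n)"] unfolding iter by (simp add: abs_mult)
    with n \<open>H w \<noteq> 0\<close> show False by (simp add: field_simps)
  qed
  then show ?thesis by (simp add: H_def)
qed

lemma
  assumes "\<rho> > 0"
  shows integrable_ln_circ: "integrable circ (\<lambda>z. ln (cmod (y + of_real \<rho> * z - w)))"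
    and integral_ln_circ: "(\<integral>z. ln (cmod (y + of_real \<rho> * z - w)) \<partial>circ) = ln (max \<rho> (cmod (w - y)))"
proof -
  define w' where "w' = (w - y) / of_real \<rho>"
  have eq: "AE z in circ. ln (cmod (y + of_real \<rho> * z - w)) = ln \<rho> + log_plus (cmod w') + log_kernel z w'"
    using AE_circ_neq[of w']
  proof eventually_elim
    fix z assume "z \<noteq> w'"
    moreover have "y + of_real \<rho> * z - w = of_real \<rho> * (z - w')"
      using assms by (simp add: w'_def field_simps)
    ultimately show "ln (cmod (y + of_real \<rho> * z - w)) = ln \<rho> + log_plus (cmod w') + log_kernel z w'"
      using assms by (simp add: norm_mult ln_mult log_kernel_def)
  qed
  have int: "integrable circ (\<lambda>z. log_kernel z w')"
    using integrable_log_kernel[of 1 0 w'] by simp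
  then have "integrable circ (\<lambda>z. ln \<rho> + log_plus (cmod w') + log_kernel z w')" by simp
  then show "integrable circ (\<lambda>z. ln (cmod (y + of_real \<rho> * z - w)))"
    by (subst integrable_cong_AE[OF _ _ eq]) measurable
  have "(\<integral>z. ln (cmod (y + of_real \<rho> * z - w)) \<partial>circ) = (\<integral>z. ln \<rho> + log_plus (cmod w') + log_kernel z w' \<partial>circ)"
    by (rule integral_cong_AE[OF _ _ eq]) measurable
  also have "\<dots> = ln \<rho> + ln (max 1 (cmod w'))"
    using int circ.prob_space by (simp add: integral_log_kernel_circ log_plus_eq_ln_max)
  also have "\<dots> = ln (\<rho> * max 1 (cmod w'))" using assms by (simp add: ln_mult)
  also have "\<rho> * max 1 (cmod w') = max \<rho> (cmod (w - y))"
    using assms by (simp add: w'_def norm_divide max_mult_distrib_left)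
  finally show "(\<integral>z. ln (cmod (y + of_real \<rho> * z - w)) \<partial>circ) = ln (max \<rho> (cmod (w - y)))" .
qed

section \<open>Polynomials and their zeros\<close>

lemma root_poly_0 [simp]: "root_poly x 0 = 1"
  and root_poly_Suc: "root_poly x (Suc n) = root_poly x n * [:- x (Suc n), 1:]"
  by (simp_all add: root_poly_def)

lemma poly_root_poly: "poly (root_poly x n) z = (\<Prod>i=1..n. z - x i)"
  by (simp add: root_poly_def poly_prod)

lemma root_poly_nonzero [simp]: "root_poly x n \<noteq> 0"
  by (simp add: root_poly_def)

lemma degree_root_poly [simp]: "degree (root_poly x n) = n"
  by (simp add: root_poly_def degree_prod_sum_eq)

lemma coeff_root_poly_top [simp]: "coeff (root_poly x n) n = 1"
proof -
  have "lead_coeff (root_poly x n) = 1" unfolding root_poly_def lead_coeff_prod by simp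
  then show ?thesis by simp
qed

lemma proots_root_poly: "proots (root_poly x n) = image_mset x (mset_set {1..n})"
proof (induction n)
  case (Suc n)
  have "mset_set {1..Suc n} = add_mset (Suc n) (mset_set {1..n})"
    by (subst atLeastAtMostSuc_conv) auto
  then show ?case using Suc unfolding root_poly_Suc by (subst proots_mult) auto
qed simp

lemma ex_root_poly:
  fixes p :: "complex poly"
  obtains \<eta> where "p = smult (lead_coeff p) (root_poly \<eta> (degree p))"
proof -
  obtain r where r: "smult (lead_coeff p) (\<Prod>i<degree p. [:- r i, 1:]) = p"
    by (rule complex_poly_decompose')
  have "(\<Prod>i<degree p. [:- r i, 1:]) = root_poly (\<lambda>i. r (i - 1)) (degree p)"
    unfolding root_poly_def by (rule prod.reindex_bij_witness[of _ "\<lambda>i. i - 1" Suc]) auto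
  then show thesis using r that by metis
qed

text \<open>Leibniz rule for a linear factor. At \<open>k = 0\<close> the truncated
  \<open>k - 1\<close> is harmless because of the factor \<open>of_nat k\<close>.\<close>

lemma higher_pderiv_mult_linear:
  fixes p :: "complex poly"
  shows "(pderiv ^^ k) (p * [:- a, 1:]) = [:- a, 1:] * (pderiv ^^ k) p + of_nat k * (pderiv ^^ (k - 1)) p"
proof (induction k)
  case (Suc k)
  define L where "L = [:- a, 1:]"
  have L: "pderiv L = 1" by (simp add: L_def pderiv_pCons)
  have k: "pderiv (of_nat k :: complex poly) = 0"
    by (simp add: of_nat_poly pderiv_pCons)
  have "(pderiv ^^ Suc k) (p * [:- a, 1:]) = pderiv (L * (pderiv ^^ k) p + of_nat k * (pderiv ^^ (k - 1)) p)"
    by (simp only: funpow.simps o_apply Suc L_def)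
  also have "\<dots> = L * (pderiv ^^ Suc k) p + (pderiv ^^ k) p + of_nat k * pderiv ((pderiv ^^ (k - 1)) p)"
    by (simp add: pderiv_add pderiv_mult L k)
  also have "of_nat k * pderiv ((pderiv ^^ (k - 1)) p) = of_nat k * (pderiv ^^ k) p"
    by (cases k) auto
  finally show ?case unfolding L_def by (simp only: of_nat_Suc diff_Suc_1 distrib_right mult_1 add.assoc)
qed simp

text \<open>The Taylor expansion of \<open>t \<mapsto> root_poly x n (z + t)\<close>.\<close>

lemma poly_higher_pderiv_root_poly:
  assumes "\<And>i. i \<in> {1..n} \<Longrightarrow> z \<noteq> x i"
  shows "poly ((pderiv ^^ k) (root_poly x n)) z
    = poly (root_poly x n) z * (fact k * coeff (one_plus_prod {1..n} (\<lambda>i. 1 / (z - x i))) k)"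
  using assms
proof (induction n arbitrary: k)
  case 0
  have "(pderiv ^^ k) (1 :: complex poly) = (if k = 0 then 1 else 0)"
    by (cases k) (simp_all del: funpow.simps add: funpow_Suc_right)
  then show ?case by (auto simp: one_plus_prod_def)
next
  case (Suc n)
  define X where "X i = 1 / (z - x i)" for i
  have z: "z \<noteq> x (Suc n)" using Suc.prems by auto
  have IH: "poly ((pderiv ^^ k) (root_poly x n)) z
    = poly (root_poly x n) z * (fact k * coeff (one_plus_prod {1..n} X) k)" for k
    unfolding X_def by (rule Suc.IH) (use Suc.prems in auto)
  have *: "{1..Suc n} = insert (Suc n) {1..n}" by auto
  have one: "one_plus_prod {1..Suc n} X = [:1, X (Suc n):] * one_plus_prod {1..n} X"
    unfolding one_plus_prod_def * by (subst prod.insert) auto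
  have "poly ((pderiv ^^ k) (root_poly x (Suc n))) z
      = (z - x (Suc n)) * poly ((pderiv ^^ k) (root_poly x n)) z
        + of_nat k * poly ((pderiv ^^ (k - 1)) (root_poly x n)) z"
    unfolding root_poly_Suc higher_pderiv_mult_linear by (simp add: algebra_simps)
  also have "\<dots> = poly (root_poly x (Suc n)) z * (fact k * coeff (one_plus_prod {1..Suc n} X) k)"
  proof (cases k)
    case 0
    then show ?thesis by (simp add: root_poly_Suc algebra_simps)
  next
    case (Suc j)
    \<comment> \<open>Here \<open>d\<close> is the value of the new linear factor, \<open>Y\<close>
      its inverse, \<open>m\<close> stands for \<open>k\<close>, \<open>f\<close> and
      \<open>f'\<close> for the factorials of \<open>k - 1\<close> and \<open>k\<close>, and
      \<open>c\<close> and \<open>c'\<close> for the symmetric polynomials of degrees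
      \<open>k\<close> and \<open>k - 1\<close>. The Leibniz rule thus becomes the recursion of the
      symmetric polynomials.\<close>
    have alg: "d * (P * (f' * c)) + m * (P * (f * c')) = P * d * (f' * (c + Y * c'))"
      if "d * Y = 1" "f' = m * f" for d Y f' m f c c' P :: complex
      using that by algebra
    have "(z - x (Suc n)) * X (Suc n) = 1" using z by (simp add: X_def)
    moreover have "fact k = of_nat k * (fact j :: complex)" by (simp add: Suc)
    moreover have "poly (root_poly x (Suc n)) z = poly (root_poly x n) z * (z - x (Suc n))"
      by (simp add: root_poly_Suc algebra_simps)
    moreover have "coeff (one_plus_prod {1..Suc n} X) k
        = coeff (one_plus_prod {1..n} X) k + X (Suc n) * coeff (one_plus_prod {1..n} X) j"
      unfolding one by (simp add: Suc)
    moreover have "k - 1 = j" by (simp add: Suc)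
    ultimately show ?thesis unfolding IH by (simp only: alg)
  qed
  finally show ?case unfolding X_def .
qed

text \<open>There are at most \<open>card B ^ k\<close> products of \<open>k\<close> distinct
  factors. A crude bound is enough, since its logarithm will be divided by \<open>n\<close>.\<close>

lemma coeff_one_plus_prod_le:
  assumes "finite B" "\<And>i. i \<in> B \<Longrightarrow> cmod (x i) \<le> M" "M \<ge> 0"
  shows "cmod (coeff (one_plus_prod B x) k) \<le> (real (card B) * M) ^ k"
  using assms(1,2)
proof (induction B arbitrary: k rule: finite_induct)
  case empty
  then show ?case by (cases k) (auto simp: one_plus_prod_def)
next
  case (insert i B)
  have one: "one_plus_prod (insert i B) x = [:1, x i:] * one_plus_prod B x"
    using insert by (simp add: one_plus_prod_def)
  define m where "m = real (card B)"
  have m: "m \<ge> 0" by (simp add: m_def)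
  show ?case
  proof (cases k)
    case (Suc j)
    have "cmod (coeff (one_plus_prod (insert i B) x) k)
        \<le> cmod (coeff (one_plus_prod B x) (Suc j)) + cmod (x i) * cmod (coeff (one_plus_prod B x) j)"
      unfolding one Suc by (simp add: norm_triangle_ineq flip: norm_mult)
    also have "\<dots> \<le> (m * M) ^ Suc j + M * (m * M) ^ j"
      using insert.prems assms(3) m unfolding m_def by (intro add_mono mult_mono insert.IH) auto
    also have "\<dots> = (m + 1) * M * (m * M) ^ j" by (simp add: algebra_simps)
    also have "\<dots> \<le> (m + 1) * M * ((m + 1) * M) ^ j"
      using m assms(3) by (intro mult_left_mono power_mono mult_right_mono) auto
    also have "\<dots> = (real (card (insert i B)) * M) ^ k" using insert.hyps Suc by (simp add: m_def add.commute)
    finally show ?thesis .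
  qed simp
qed

text \<open>A substitute for the maximum on the unit circle, which it dominates: it is easily
  followed through linear factors and derivatives, and what is lost enters
  \<open>critical_points_log_bound\<close> only through the constant
  \<open>k + ln 2\<close>.\<close>

definition coeff_norm :: "complex poly \<Rightarrow> real" where
  "coeff_norm p = (\<Sum>i\<le>degree p. cmod (coeff p i))"

lemma coeff_norm_altdef: "degree p \<le> m \<Longrightarrow> coeff_norm p = (\<Sum>i\<le>m. cmod (coeff p i))"
  unfolding coeff_norm_def by (intro sum.mono_neutral_left) (auto simp: coeff_eq_0)

lemma coeff_norm_nonneg [simp]: "coeff_norm p \<ge> 0"
  unfolding coeff_norm_def by (intro sum_nonneg) auto

lemma norm_poly_le_coeff_norm:
  assumes "cmod z \<le> 1" shows "cmod (poly p z) \<le> coeff_norm p"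
proof -
  have "cmod (poly p z) \<le> (\<Sum>i\<le>degree p. cmod (coeff p i) * cmod z ^ i)"
    unfolding poly_altdef by (rule norm_sum[THEN order_trans]) (simp add: norm_mult norm_power)
  also have "\<dots> \<le> coeff_norm p" unfolding coeff_norm_def
    using assms by (intro sum_mono mult_left_le power_le_one) auto
  finally show ?thesis .
qed

lemma coeff_norm_mult_linear: "coeff_norm (p * [:- a, 1:]) \<le> (1 + cmod a) * coeff_norm p"
proof -
  define d where "d = degree p"
  have "degree (p * [:- a, 1:]) \<le> Suc d" using degree_mult_le[of p "[:- a, 1:]"] by (simp add: d_def)
  then have "coeff_norm (p * [:- a, 1:]) = (\<Sum>i\<le>Suc d. cmod (coeff (p * [:- a, 1:]) i))"
    by (rule coeff_norm_altdef)
  also have "\<dots> \<le> (\<Sum>i\<le>Suc d. cmod a * cmod (coeff p i) + cmod (coeff (pCons 0 p) i))"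
  proof (intro sum_mono)
    fix i
    have "p * [:- a, 1:] = smult (- a) p + pCons 0 p" by simp
    then have "coeff (p * [:- a, 1:]) i = - a * coeff p i + coeff (pCons 0 p) i" by (metis coeff_add coeff_smult)
    then show "cmod (coeff (p * [:- a, 1:]) i) \<le> cmod a * cmod (coeff p i) + cmod (coeff (pCons 0 p) i)"
      using norm_triangle_ineq[of "- a * coeff p i" "coeff (pCons 0 p) i"] by (simp add: norm_mult)
  qed
  also have "\<dots> = cmod a * (\<Sum>i\<le>Suc d. cmod (coeff p i)) + (\<Sum>i\<le>Suc d. cmod (coeff (pCons 0 p) i))"
    by (simp add: sum.distrib sum_distrib_left distrib_left)
  also have "(\<Sum>i\<le>Suc d. cmod (coeff (pCons 0 p) i)) = (\<Sum>i\<le>d. cmod (coeff p i))"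
    by (subst sum.atMost_Suc_shift) simp
  finally show ?thesis
    using coeff_norm_altdef[of p "Suc d"] coeff_norm_altdef[of p d] by (simp add: d_def algebra_simps)
qed

lemma coeff_norm_pderiv: "coeff_norm (pderiv p) \<le> degree p * coeff_norm p"
proof -
  define d where "d = degree p"
  have "coeff_norm (pderiv p) = (\<Sum>i\<le>d. cmod (coeff (pderiv p) i))"
    by (rule coeff_norm_altdef) (simp add: degree_pderiv d_def)
  also have "\<dots> \<le> (\<Sum>i\<le>d. d * cmod (coeff p (Suc i)))"
  proof (intro sum_mono)
    fix i
    show "cmod (coeff (pderiv p) i) \<le> d * cmod (coeff p (Suc i))"
    proof (cases "Suc i \<le> d")
      case True
      then show ?thesis unfolding coeff_pderiv norm_mult norm_of_nat
        by (intro mult_right_mono of_nat_mono) auto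
    qed (simp add: coeff_pderiv coeff_eq_0 d_def)
  qed
  also have "\<dots> = d * (\<Sum>i\<le>d. cmod (coeff p (Suc i)))" by (simp add: sum_distrib_left)
  also have "\<dots> \<le> d * (\<Sum>i\<le>Suc d. cmod (coeff p i))"
    by (intro mult_left_mono) (subst sum.atMost_Suc_shift, auto)
  finally show ?thesis using coeff_norm_altdef[of p "Suc d"] by (simp add: d_def)
qed

lemma coeff_norm_higher_pderiv_root_poly:
  "coeff_norm ((pderiv ^^ k) (root_poly x n)) \<le> real n ^ k * (\<Prod>i=1..n. 1 + cmod (x i))"
proof (induction k)
  case 0
  show ?case
  proof (induction n)
    case 0 show ?case by (simp add: coeff_norm_def)
  next
    case (Suc n)
    have "coeff_norm (root_poly x (Suc n)) \<le> (1 + cmod (x (Suc n))) * coeff_norm (root_poly x n)"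
      unfolding root_poly_Suc by (rule coeff_norm_mult_linear)
    also have "\<dots> \<le> (1 + cmod (x (Suc n))) * (\<Prod>i=1..n. 1 + cmod (x i))"
      using Suc by (intro mult_left_mono) auto
    finally show ?case by (simp add: mult.commute)
  qed
next
  case (Suc k)
  have "coeff_norm ((pderiv ^^ Suc k) (root_poly x n))
      \<le> real (degree ((pderiv ^^ k) (root_poly x n))) * coeff_norm ((pderiv ^^ k) (root_poly x n))"
    using coeff_norm_pderiv by simp
  also have "\<dots> \<le> real n * (real n ^ k * (\<Prod>i=1..n. 1 + cmod (x i)))"
    using Suc by (intro mult_mono) (auto simp: degree_higher_pderiv)
  finally show ?case by (simp add: mult.assoc)
qed

text \<open>Cauchy's bound: at a zero outside the unit disc the lower terms, each at most
  \<open>cmod (coeff p i) * cmod z ^ d\<close> with \<open>d = degree p - 1\<close>, have to balance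
  the leading term.\<close>

lemma root_norm_le_coeff_norm:
  assumes "poly p z = 0" "cmod (lead_coeff p) \<ge> 1"
  shows "cmod z \<le> 1 + coeff_norm p"
proof (cases "cmod z \<le> 1")
  case True
  then show ?thesis using coeff_norm_nonneg[of p] by linarith
next
  case False
  have "degree p > 0"
  proof (rule ccontr)
    assume "\<not> degree p > 0"
    then obtain c where "p = [:c:]" using degree_eq_zeroE by blast
    then show False using assms by auto
  qed
  then obtain d where d: "degree p = Suc d" by (cases "degree p") auto
  have "0 = (\<Sum>i\<le>d. coeff p i * z ^ i) + lead_coeff p * z ^ Suc d"
    using assms(1) unfolding poly_altdef d by (simp add: d)
  then have "cmod (lead_coeff p * z ^ Suc d) = cmod (\<Sum>i\<le>d. coeff p i * z ^ i)"
    by (metis add.commute add_eq_0_iff norm_minus_cancel)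
  also have "\<dots> \<le> (\<Sum>i\<le>d. cmod (coeff p i) * cmod z ^ i)"
    by (rule norm_sum[THEN order_trans]) (simp add: norm_mult norm_power)
  also have "\<dots> \<le> (\<Sum>i\<le>d. cmod (coeff p i) * cmod z ^ d)"
    using False by (intro sum_mono mult_left_mono power_increasing) auto
  also have "\<dots> = (\<Sum>i\<le>d. cmod (coeff p i)) * cmod z ^ d" by (simp add: sum_distrib_right)
  also have "\<dots> \<le> coeff_norm p * cmod z ^ d"
    unfolding coeff_norm_def d by (intro mult_right_mono) auto
  finally have "cmod (lead_coeff p) * cmod z * cmod z ^ d \<le> coeff_norm p * cmod z ^ d"
    by (simp add: norm_mult norm_power mult.assoc)
  then have "cmod (lead_coeff p) * cmod z \<le> coeff_norm p"
    by (rule mult_right_le_imp_le) (use False in \<open>intro zero_less_power, linarith\<close>)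
  moreover have "1 * cmod z \<le> cmod (lead_coeff p) * cmod z"
    using assms(2) by (intro mult_right_mono) auto
  ultimately show ?thesis by linarith
qed

text \<open>For \<open>k \<le> n\<close> this is the falling factorial
  \<open>n * (n - 1) * ... * (n - k + 1)\<close>, the leading coefficient of the \<open>k\<close>-th
  derivative of a monic polynomial of degree \<open>n\<close>.\<close>

definition pderiv_lead :: "nat \<Rightarrow> nat \<Rightarrow> real" where
  "pderiv_lead n k = pochhammer (real (Suc (n - k))) k"

lemma pderiv_lead_ge_1: "pderiv_lead n k \<ge> 1"
proof -
  have "pderiv_lead n k = real (pochhammer (Suc (n - k)) k)"
    unfolding pderiv_lead_def pochhammer_of_nat ..
  moreover have "pochhammer (Suc (n - k)) k > 0" by (rule pochhammer_pos) simp
  ultimately show ?thesis by simp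
qed

lemma ex_critical_points:
  assumes "k \<le> n"
  obtains \<eta> where "(pderiv ^^ k) (root_poly x n) = smult (of_real (pderiv_lead n k)) (root_poly \<eta> (n - k))"
proof -
  let ?q = "(pderiv ^^ k) (root_poly x n)"
  obtain \<eta> where \<eta>: "?q = smult (lead_coeff ?q) (root_poly \<eta> (degree ?q))" by (rule ex_root_poly)
  have d: "degree ?q = n - k" by (simp add: degree_higher_pderiv)
  have "lead_coeff ?q = pochhammer (of_nat (Suc (n - k))) k"
    unfolding d coeff_higher_pderiv using assms by simp
  also have "\<dots> = of_real (pderiv_lead n k)"
    unfolding pderiv_lead_def pochhammer_of_nat by simp
  finally show thesis using \<eta> d that by metis
qed

section \<open>Integrals against empirical measures\<close>

lemma sets_uniform_mset_measure [simp]: "sets (uniform_mset_measure A) = sets borel"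
  by (simp add: uniform_mset_measure_def)

lemma prob_space_uniform_mset_measure: "prob_space (uniform_mset_measure A)"
  unfolding uniform_mset_measure_def
  by (intro prob_space.prob_space_distr prob_space_measure_pmf) auto

lemma integral_uniform_mset_measure:
  fixes f :: "complex \<Rightarrow> real"
  assumes [measurable]: "f \<in> borel_measurable borel" and "finite I" "I \<noteq> {}"
  shows "(\<integral>z. f z \<partial>uniform_mset_measure (image_mset x (mset_set I))) = (\<Sum>i\<in>I. f (x i)) / card I"
proof -
  have "pmf_of_multiset (image_mset x (mset_set I)) = map_pmf x (pmf_of_set I)"
    using assms by (simp add: map_pmf_of_set)
  then have "(\<integral>z. f z \<partial>uniform_mset_measure (image_mset x (mset_set I)))
      = measure_pmf.expectation (map_pmf x (pmf_of_set I)) f"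
    unfolding uniform_mset_measure_def by (subst integral_distr) auto
  also have "\<dots> = (\<Sum>i\<in>I. f (x i)) / card I"
    using assms by (simp add: integral_pmf_of_set)
  finally show ?thesis .
qed

lemma integral_zeros_measure:
  fixes f :: "complex \<Rightarrow> real"
  assumes "f \<in> borel_measurable borel" "c \<noteq> 0" "n \<ge> 1"
  shows "(\<integral>z. f z \<partial>zeros_measure (smult c (root_poly x n))) = (\<Sum>i=1..n. f (x i)) / n"
  using integral_uniform_mset_measure[of f "{1..n}" x] assms
  by (simp add: zeros_measure_def proots_root_poly)

section \<open>Weak convergence through countably many test functions\<close>

text \<open>Finite maxima of cones with rational parameters: a countable family of Lipschitz functions of
  compact support, with increasing limits to every nonnegative continuous function.\<close>

definition spike :: "rat \<times> rat \<times> rat \<times> nat \<Rightarrow> complex \<Rightarrow> real" where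
  "spike = (\<lambda>(a, b, q, L) x. max 0 (of_rat q - real (Suc L) * dist x (Complex (of_rat a) (of_rat b))))"

fun spikes :: "(rat \<times> rat \<times> rat \<times> nat) list \<Rightarrow> complex \<Rightarrow> real" where
  "spikes [] x = 0"
| "spikes (p # ps) x = max (spike p x) (spikes ps x)"

lemma spikes_nonneg [simp]: "0 \<le> spikes ps x"
  by (induction ps) (auto simp: le_max_iff_disj)

lemma spikes_lipschitz: "\<exists>K\<ge>0. \<forall>x y. \<bar>spikes ps x - spikes ps y\<bar> \<le> K * dist x y"
proof (induction ps)
  case (Cons p ps)
  obtain a b q L where p: "p = (a, b, q, L)" by (cases p) auto
  define c where "c = Complex (of_rat a) (of_rat b)"
  from Cons obtain K where K: "K \<ge> 0" "\<And>x y. \<bar>spikes ps x - spikes ps y\<bar> \<le> K * dist x y" by auto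
  have "\<bar>spikes (p # ps) x - spikes (p # ps) y\<bar> \<le> max K (Suc L) * dist x y" for x y
  proof -
    have "\<bar>dist x c - dist y c\<bar> \<le> dist x y"
      using dist_triangle[of x c y] dist_triangle[of y c x] by (simp add: dist_commute)
    then have "\<bar>real (Suc L) * dist x c - real (Suc L) * dist y c\<bar> \<le> Suc L * dist x y"
      unfolding right_diff_distrib[symmetric] abs_mult by (simp add: mult_left_mono del: of_nat_Suc)
    moreover have "\<bar>max 0 (r - s) - max 0 (r - t)\<bar> \<le> \<bar>s - t\<bar>" for r s t :: real
      by (simp add: max_def abs_minus_commute)
    ultimately have "\<bar>spike p x - spike p y\<bar> \<le> Suc L * dist x y"
      unfolding spike_def p prod.case c_def[symmetric] by (rule order_trans[rotated])
    moreover have "Suc L * dist x y \<le> max K (Suc L) * dist x y" "K * dist x y \<le> max K (Suc L) * dist x y"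
      by (intro mult_right_mono; simp)+
    moreover have "\<bar>max a b - max c d\<bar> \<le> m" if "\<bar>a - c\<bar> \<le> m" "\<bar>b - d\<bar> \<le> m" for a b c d m :: real
      using that by linarith
    ultimately show ?thesis using K(2)[of x y] unfolding spikes.simps by force
  qed
  then show ?case using K(1) by (intro exI[of _ "max K (Suc L)"]) (simp add: max_def)
qed auto

lemma continuous_spikes: "continuous_on UNIV (spikes ps)"
proof -
  obtain K where K: "K \<ge> 0" "\<And>x y. \<bar>spikes ps x - spikes ps y\<bar> \<le> K * dist x y"
    using spikes_lipschitz by blast
  then have "K-lipschitz_on UNIV (spikes ps)" by (intro lipschitz_onI) (auto simp: dist_real_def)
  then show ?thesis by (rule lipschitz_on_continuous_on)
qed

lemma measurable_spikes [measurable]: "spikes ps \<in> borel_measurable borel"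
  by (rule borel_measurable_continuous_onI[OF continuous_spikes])

lemma spikes_bounded: "\<exists>C. \<forall>x. spikes ps x \<le> C"
proof (induction ps)
  case (Cons p ps)
  obtain a b q L where p: "p = (a, b, q, L)" by (cases p) auto
  from Cons obtain C where "\<And>x. spikes ps x \<le> C" by auto
  moreover have "spike p x \<le> max 0 (of_rat q)" for x
    unfolding p spike_def prod.case by (intro max.mono) auto
  ultimately have "spikes (p # ps) x \<le> max (max 0 (of_rat q)) C" for x
    unfolding spikes.simps by (intro max.mono)
  then show ?case by blast
qed auto

lemma spikes_compact_support: "\<exists>R. \<forall>x. R < cmod x \<longrightarrow> spikes ps x = 0"
proof (induction ps)
  case (Cons p ps)
  obtain a b q L where p: "p = (a, b, q, L)" by (cases p) auto
  define c where "c = Complex (of_rat a) (of_rat b)"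
  from Cons obtain R where R: "\<And>x. R < cmod x \<Longrightarrow> spikes ps x = 0" by auto
  have "spikes (p # ps) x = 0" if "max R (cmod c + \<bar>of_rat q\<bar>) < cmod x" for x
  proof -
    have "\<bar>of_rat q\<bar> \<le> dist x c" using that norm_triangle_ineq2[of x c] by (simp add: dist_norm)
    also have "\<dots> \<le> Suc L * dist x c" using mult_right_mono[of 1 "real (Suc L)" "dist x c"] by simp
    finally have "of_rat q - Suc L * dist x c \<le> 0" by linarith
    then have "spike p x = 0" unfolding p spike_def prod.case c_def[symmetric] by (rule max_absorb1)
    then show ?thesis using R[of x] that by simp
  qed
  then show ?case by blast
qed auto

text \<open>The height \<open>q\<close> lies below \<open>f\<close> on the ball where
  \<open>f\<close> varies by less than \<open>e / 2\<close>, and the slope is so steep that the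
  spike has vanished outside this ball. The height costs at most \<open>3 * e / 4\<close> and the
  offset of the rational centre at most \<open>e / 4\<close>.\<close>

lemma ex_spike:
  assumes f: "continuous_on UNIV f" "\<And>x. 0 \<le> f x" and "e > 0" "e < f x"
  shows "\<exists>p. (\<forall>y. spike p y \<le> f y) \<and> f x - e < spike p x"
proof -
  obtain \<delta> where \<delta>: "\<delta> > 0" "\<And>y. dist y x < \<delta> \<Longrightarrow> dist (f y) (f x) < e / 2"
    using f(1) assms(3) unfolding continuous_on_iff by (meson UNIV_I half_gt_zero)
  obtain q where q: "f x - 3 * e / 4 < of_rat q" "of_rat q < f x - e / 2"
    using of_rat_dense[of "f x - 3 * e / 4" "f x - e / 2"] assms(3) by auto
  obtain L :: nat where L: "2 * \<bar>of_rat q\<bar> / \<delta> < real L" using reals_Archimedean2 by blast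
  define K where "K = real (Suc L)"
  have K: "K > 0" "\<bar>of_rat q\<bar> \<le> K * (\<delta> / 2)"
    using L \<delta>(1) by (auto simp: K_def field_simps)
  define s where "s = min (\<delta> / 2) (e / (4 * K))"
  have s: "s > 0" unfolding s_def using \<delta> K assms by simp
  obtain a where a: "Re x < of_rat a" "of_rat a < Re x + s / 2" using of_rat_dense[of "Re x" "Re x + s / 2"] s by auto
  obtain b where b: "Im x < of_rat b" "of_rat b < Im x + s / 2" using of_rat_dense[of "Im x" "Im x + s / 2"] s by auto
  define c where "c = Complex (of_rat a) (of_rat b)"
  have "dist x c \<le> \<bar>Re (x - c)\<bar> + \<bar>Im (x - c)\<bar>" unfolding dist_norm by (rule cmod_le)
  also have "\<dots> < s" using a b by (simp add: c_def)
  finally have xc: "dist x c < s" .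
  define p where "p = (a, b, q, L)"
  have spike: "spike p y = max 0 (of_rat q - K * dist y c)" for y by (simp add: p_def spike_def K_def c_def)
  have "spike p y \<le> f y" for y
  proof (cases "dist y x < \<delta>")
    case True
    have "of_rat q \<le> f y" using \<delta>(2)[OF True] q unfolding dist_real_def by linarith
    moreover have "0 \<le> K * dist y c" using K by simp
    ultimately show ?thesis unfolding spike using f(2)[of y] by auto
  next
    case False
    then have "\<delta> / 2 \<le> dist y c" using xc dist_triangle[of y x c] by (auto simp: s_def dist_commute)
    then have "K * (\<delta> / 2) \<le> K * dist y c" using K by (intro mult_left_mono) auto
    then have "of_rat q \<le> K * dist y c" using K(2) abs_ge_self[of "of_rat q :: real"] by linarith
    then show ?thesis unfolding spike using f(2)[of y] by simp
  qed
  moreover have "f x - e < spike p x"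
  proof -
    have "K * dist x c \<le> K * (e / (4 * K))" using xc K unfolding s_def by (intro mult_left_mono) auto
    also have "\<dots> = e / 4" using K by simp
    finally show ?thesis unfolding spike using q by auto
  qed
  ultimately show ?thesis by blast
qed

lemma spikes_mono: "set ps \<subseteq> set qs \<Longrightarrow> spikes ps x \<le> spikes qs x"
proof (induction ps)
  case (Cons p ps)
  have "spike p x \<le> spikes qs x" if "p \<in> set qs" using that by (induction qs) (auto simp: le_max_iff_disj)
  then show ?case using Cons by auto
qed simp

lemma spikes_le: "(\<And>p. p \<in> set ps \<Longrightarrow> spike p x \<le> c) \<Longrightarrow> 0 \<le> c \<Longrightarrow> spikes ps x \<le> c"
  by (induction ps) auto

lemma ex_spikes_integral:
  assumes \<mu>: "prob_space \<mu>" "sets \<mu> = sets borel"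
    and f: "continuous_on UNIV f" "\<And>x. 0 \<le> f x" "\<And>x. f x \<le> C" and "e > 0"
  shows "\<exists>ps. (\<forall>x. spikes ps x \<le> f x) \<and> (\<integral>x. f x \<partial>\<mu>) - e < (\<integral>x. spikes ps x \<partial>\<mu>)"
proof -
  interpret prob_space \<mu> by fact
  have [measurable_cong]: "sets \<mu> = sets borel" by fact
  have [measurable]: "f \<in> borel_measurable borel" by (rule borel_measurable_continuous_onI) fact
  define en :: "nat \<Rightarrow> rat \<times> rat \<times> rat \<times> nat" where "en = from_nat"
  \<comment> \<open>The spikes lying below \<open>f\<close>, taken in a fixed enumeration, so that
    their maxima increase with \<open>m\<close>.\<close>
  define ps where "ps m = map en (filter (\<lambda>j. \<forall>x. spike (en j) x \<le> f x) [0..<m])" for m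
  have le: "spikes (ps m) x \<le> f x" for m x
    by (rule spikes_le) (use f(2) in \<open>auto simp: ps_def\<close>)
  have lim: "(\<lambda>m. spikes (ps m) x) \<longlonglongrightarrow> f x" for x
  proof (rule LIMSEQ_I)
    fix r :: real assume r: "r > 0"
    have "\<exists>m0. f x - r < spikes (ps m0) x"
    proof (cases "r / 2 < f x")
      case True
      then obtain p where p: "\<forall>y. spike p y \<le> f y" "f x - r / 2 < spike p x"
        using ex_spike[OF f(1,2), of "r / 2" x] r by auto
      define j where "j = to_nat p"
      have "en j = p" by (simp add: en_def j_def)
      then have "p \<in> set (ps (Suc j))" using p(1) by (auto simp: ps_def intro!: image_eqI[of _ _ j])
      then have "spikes [p] x \<le> spikes (ps (Suc j)) x" by (intro spikes_mono) auto
      then show ?thesis using p(2) r by (intro exI[of _ "Suc j"]) auto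
    next
      case False
      then show ?thesis using r spikes_nonneg[of "ps 0" x] by (intro exI[of _ 0]) linarith
    qed
    then obtain m0 where m0: "f x - r < spikes (ps m0) x" by blast
    have "norm (spikes (ps m) x - f x) < r" if "m \<ge> m0" for m
    proof -
      have "spikes (ps m0) x \<le> spikes (ps m) x" using that by (intro spikes_mono) (auto simp: ps_def)
      then show ?thesis using le[of m x] m0 by simp
    qed
    then show "\<exists>no. \<forall>m\<ge>no. norm (spikes (ps m) x - f x) < r" by blast
  qed
  have "(\<lambda>m. \<integral>x. spikes (ps m) x \<partial>\<mu>) \<longlonglongrightarrow> (\<integral>x. f x \<partial>\<mu>)"
  proof (rule integral_dominated_convergence[where w = "\<lambda>_. C"])
    show "AE x in \<mu>. norm (spikes (ps m) x) \<le> C" for m using order_trans[OF le f(3)] by auto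
    show "AE x in \<mu>. (\<lambda>m. spikes (ps m) x) \<longlonglongrightarrow> f x" using lim by simp
  qed (simp, measurable)
  then have "eventually (\<lambda>m. (\<integral>x. f x \<partial>\<mu>) - e < (\<integral>x. spikes (ps m) x \<partial>\<mu>)) sequentially"
    using \<open>e > 0\<close> by (intro order_tendstoD(1)) auto
  then obtain m where "(\<integral>x. f x \<partial>\<mu>) - e < (\<integral>x. spikes (ps m) x \<partial>\<mu>)"
    by (auto simp: eventually_sequentially)
  with le show ?thesis by blast
qed

lemma integrable_bounded_continuous:
  fixes f :: "complex \<Rightarrow> real"
  assumes "prob_space N" "sets N = sets borel" "continuous_on UNIV f" "bounded (range f)"
  shows "integrable N f"
proof -
  interpret prob_space N by fact
  have [measurable]: "f \<in> borel_measurable borel" by (rule borel_measurable_continuous_onI) fact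
  have [measurable_cong]: "sets N = sets borel" by fact
  obtain C where "\<And>x. norm (f x) \<le> C" using assms(4) unfolding bounded_iff by auto
  then show ?thesis by (intro integrable_const_bound[of _ C]) auto
qed

lemma bounded_spikes: "bounded (range (spikes ps))"
proof -
  obtain C where "\<And>x. spikes ps x \<le> C" using spikes_bounded by blast
  then show ?thesis by (intro boundedI[of _ C]) auto
qed

text \<open>Approximation from below is applied to both \<open>f + C\<close> and
  \<open>C - f\<close>. Each gives a one-sided estimate for the integral of \<open>f\<close> under
  \<open>N\<close>; since \<open>N\<close> and \<open>\<mu>\<close> both have mass 1, the constants
  cancel and the two estimates together are two-sided. One \<open>e\<close> comes from the
  approximation under \<open>\<mu>\<close>, the other from the closeness of
  \<open>N\<close>.\<close>

lemma spikes_control: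
  assumes \<mu>: "prob_space \<mu>" "sets \<mu> = sets borel"
    and f: "continuous_on UNIV f" "bounded (range f)" and "e > 0"
  obtains ps qs where "\<And>N. prob_space N \<Longrightarrow> sets N = sets borel \<Longrightarrow>
      \<bar>(\<integral>x. spikes ps x \<partial>N) - (\<integral>x. spikes ps x \<partial>\<mu>)\<bar> < e \<Longrightarrow>
      \<bar>(\<integral>x. spikes qs x \<partial>N) - (\<integral>x. spikes qs x \<partial>\<mu>)\<bar> < e \<Longrightarrow>
      \<bar>(\<integral>x. f x \<partial>N) - (\<integral>x. f x \<partial>\<mu>)\<bar> < 2 * e"
proof -
  obtain C where C: "\<And>x. \<bar>f x\<bar> \<le> C" using f(2) unfolding bounded_iff by auto
  have bd: "- C \<le> f x" "f x \<le> C" for x using C[of x] by auto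
  have f1: "continuous_on UNIV (\<lambda>x. f x + C)" "continuous_on UNIV (\<lambda>x. C - f x)"
    by (intro continuous_intros f(1))+
  obtain ps where ps: "\<And>x. spikes ps x \<le> f x + C" "(\<integral>x. f x + C \<partial>\<mu>) - e < (\<integral>x. spikes ps x \<partial>\<mu>)"
  proof -
    have "\<exists>ps. (\<forall>x. spikes ps x \<le> f x + C) \<and> (\<integral>x. f x + C \<partial>\<mu>) - e < (\<integral>x. spikes ps x \<partial>\<mu>)"
    proof (rule ex_spikes_integral[OF \<mu> f1(1)])
      show "0 \<le> f x + C" "f x + C \<le> 2 * C" for x using bd[of x] by linarith+
    qed fact
    then show thesis using that by blast
  qed
  obtain qs where qs: "\<And>x. spikes qs x \<le> C - f x" "(\<integral>x. C - f x \<partial>\<mu>) - e < (\<integral>x. spikes qs x \<partial>\<mu>)"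
  proof -
    have "\<exists>qs. (\<forall>x. spikes qs x \<le> C - f x) \<and> (\<integral>x. C - f x \<partial>\<mu>) - e < (\<integral>x. spikes qs x \<partial>\<mu>)"
    proof (rule ex_spikes_integral[OF \<mu> f1(2)])
      show "0 \<le> C - f x" "C - f x \<le> 2 * C" for x using bd[of x] by linarith+
    qed fact
    then show thesis using that by blast
  qed
  have int: "(\<integral>x. f x + C \<partial>N) = (\<integral>x. f x \<partial>N) + C \<and> (\<integral>x. C - f x \<partial>N) = C - (\<integral>x. f x \<partial>N)
      \<and> (\<integral>x. spikes ps x \<partial>N) \<le> (\<integral>x. f x + C \<partial>N) \<and> (\<integral>x. spikes qs x \<partial>N) \<le> (\<integral>x. C - f x \<partial>N)"
    if N: "prob_space N" "sets N = sets borel" for N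
  proof -
    interpret N: prob_space N by fact
    have i: "integrable N f" "integrable N (spikes rs)" for rs
      using integrable_bounded_continuous[OF N] f continuous_spikes bounded_spikes by blast+
    have "(\<integral>x. spikes ps x \<partial>N) \<le> (\<integral>x. f x + C \<partial>N)" "(\<integral>x. spikes qs x \<partial>N) \<le> (\<integral>x. C - f x \<partial>N)"
      by (intro integral_mono ps(1) qs(1) i; simp add: i)+
    then show ?thesis using i by (simp add: N.prob_space)
  qed
  show thesis
  proof (rule that[of ps qs])
    fix N :: "complex measure" assume N: "prob_space N" "sets N = sets borel"
    assume "\<bar>(\<integral>x. spikes ps x \<partial>N) - (\<integral>x. spikes ps x \<partial>\<mu>)\<bar> < e"
      "\<bar>(\<integral>x. spikes qs x \<partial>N) - (\<integral>x. spikes qs x \<partial>\<mu>)\<bar> < e"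
    then show "\<bar>(\<integral>x. f x \<partial>N) - (\<integral>x. f x \<partial>\<mu>)\<bar> < 2 * e"
      using int[OF N] int[OF \<mu>] ps(2) qs(2) by linarith
  qed
qed

section \<open>The weak topology and its modes of convergence\<close>

abbreviation weak_subbasis :: "'a::topological_space measure set set" where
  "weak_subbasis \<equiv> {{N. sets N = sets borel \<and> prob_space N \<and> (\<integral>x. f x \<partial>N) \<in> V} | (f :: 'a \<Rightarrow> real) V.
     continuous_on UNIV f \<and> bounded (range f) \<and> open V}"

lemma openin_weak_topology_iff: "openin weak_topology U \<longleftrightarrow> generate_topology_on weak_subbasis U"
  unfolding weak_topology_def openin_topology_generated_by_iff ..

lemma openin_weak_topology_basic:
  assumes "continuous_on UNIV f" "bounded (range f)" "open V"
  shows "openin weak_topology {N. sets N = sets borel \<and> prob_space N \<and> (\<integral>x. f x \<partial>N) \<in> (V :: real set)}"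
  unfolding openin_weak_topology_iff using assms by (intro generate_topology_on.Basis) auto

lemma in_topspace_weak_topology:
  assumes "prob_space N" "sets N = sets borel"
  shows "N \<in> topspace weak_topology"
proof -
  have "openin weak_topology {N. sets N = sets borel \<and> prob_space N \<and> (\<integral>x. 0 \<partial>N) \<in> (UNIV :: real set)}"
    by (rule openin_weak_topology_basic) auto
  then show ?thesis using openin_subset assms by blast
qed

lemma limitin_weak_topologyD:
  assumes "limitin weak_topology N \<mu> F" "prob_space \<mu>" "sets \<mu> = sets borel"
    and f: "continuous_on UNIV f" "bounded (range f)"
  shows "((\<lambda>n. \<integral>x. f x \<partial>N n) \<longlongrightarrow> (\<integral>x. f x \<partial>\<mu> :: real)) F"
proof (rule topological_tendstoI)
  fix V :: "real set" assume V: "open V" "(\<integral>x. f x \<partial>\<mu>) \<in> V"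
  show "\<forall>\<^sub>F n in F. (\<integral>x. f x \<partial>N n) \<in> V"
    using limitinD[OF assms(1) openin_weak_topology_basic[OF f V(1)]] assms V
    by (auto elim: eventually_mono)
qed

lemma limitin_weak_topologyI:
  assumes N: "\<And>n. prob_space (N n)" "\<And>n. sets (N n) = sets borel"
    and \<mu>: "prob_space \<mu>" "sets \<mu> = sets borel"
    and lim: "\<And>ps. ((\<lambda>n. \<integral>x. spikes ps x \<partial>N n) \<longlongrightarrow> (\<integral>x. spikes ps x \<partial>\<mu>)) F"
  shows "limitin weak_topology N \<mu> F"
  unfolding limitin_def
proof (intro conjI allI impI)
  show "\<mu> \<in> topspace weak_topology" using \<mu> by (rule in_topspace_weak_topology)
  fix U assume "openin weak_topology U \<and> \<mu> \<in> U"
  then have "generate_topology_on weak_subbasis U" "\<mu> \<in> U"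
    by (auto simp: openin_weak_topology_iff)
  then show "\<forall>\<^sub>F n in F. N n \<in> U"
  proof (induction U)
    case (Int A B)
    then show ?case by (simp add: eventually_conj)
  next
    case (UN K)
    then obtain k where "k \<in> K" "\<mu> \<in> k" by auto
    then have "\<forall>\<^sub>F n in F. N n \<in> k" using UN.IH by blast
    then show ?case by (rule eventually_mono) (use \<open>k \<in> K\<close> in auto)
  next
    case (Basis U)
    then obtain f :: "complex \<Rightarrow> real" and V
      where U: "U = {N. sets N = sets borel \<and> prob_space N \<and> (\<integral>x. f x \<partial>N) \<in> V}"
        and f: "continuous_on UNIV f" "bounded (range f)" "open V" by blast
    have "(\<integral>x. f x \<partial>\<mu>) \<in> V" using Basis U by simp
    then obtain e where e: "e > 0" "\<And>y. dist y (\<integral>x. f x \<partial>\<mu>) < e \<Longrightarrow> y \<in> V"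
      using f(3) unfolding open_dist by blast
    obtain ps qs where pq: "\<And>N. prob_space N \<Longrightarrow> sets N = sets borel \<Longrightarrow>
      \<bar>(\<integral>x. spikes ps x \<partial>N) - (\<integral>x. spikes ps x \<partial>\<mu>)\<bar> < e / 2 \<Longrightarrow>
      \<bar>(\<integral>x. spikes qs x \<partial>N) - (\<integral>x. spikes qs x \<partial>\<mu>)\<bar> < e / 2 \<Longrightarrow>
      \<bar>(\<integral>x. f x \<partial>N) - (\<integral>x. f x \<partial>\<mu>)\<bar> < 2 * (e / 2)"
      using spikes_control[OF \<mu> f(1,2), of "e / 2"] e(1) by (metis half_gt_zero)
    have ev: "\<forall>\<^sub>F n in F. \<bar>(\<integral>x. spikes rs x \<partial>N n) - (\<integral>x. spikes rs x \<partial>\<mu>)\<bar> < e / 2" for rs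
      using tendstoD[OF lim, of "e / 2" rs] e(1) by (simp add: dist_real_def)
    show ?case using ev[of ps] ev[of qs]
    proof eventually_elim
      case (elim n)
      then show ?case using pq[OF N(1)[of n] N(2)[of n]] e(2) N[of n] unfolding U by (simp add: dist_real_def)
    qed
  qed simp
qed

text \<open>Measurability is demanded for every open set and not only for sub-basic ones: an open
  set may be an uncountable union, and \<open>measure\<close> is 0 on sets that are not
  measurable.\<close>

lemma (in prob_space) converges_in_probability_weak_topologyI:
  assumes X: "\<And>n \<omega>. prob_space (X n \<omega>)" "\<And>n \<omega>. sets (X n \<omega>) = sets borel"
    and \<mu>: "prob_space \<mu>" "sets \<mu> = sets borel"
    and meas: "\<And>n U. openin weak_topology U \<Longrightarrow> {\<omega> \<in> space M. X n \<omega> \<in> U} \<in> events"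
    and lim: "\<And>ps e. e > 0 \<Longrightarrow>
      (\<lambda>n. prob {\<omega> \<in> space M. \<bar>(\<integral>x. spikes ps x \<partial>X n \<omega>) - (\<integral>x. spikes ps x \<partial>\<mu>)\<bar> < e}) \<longlonglongrightarrow> 1"
  shows "converges_in_probability M weak_topology X \<mu>"
proof -
  \<comment> \<open>Inclusion-exclusion. It serves for intersections, and with \<open>A = B\<close>
    also for passing to a larger event.\<close>
  have squeeze: "(\<lambda>n. prob (C n)) \<longlonglongrightarrow> 1"
    if "(\<lambda>n. prob (A n)) \<longlonglongrightarrow> 1" "(\<lambda>n. prob (B n)) \<longlonglongrightarrow> 1"
      "\<And>n. A n \<in> events" "\<And>n. B n \<in> events" "\<And>n. C n \<in> events" "\<And>n. A n \<inter> B n \<subseteq> C n"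
    for A B C :: "nat \<Rightarrow> _ set"
  proof (rule tendsto_sandwich[of "\<lambda>n. prob (A n) + prob (B n) - 1" _ _ "\<lambda>_. 1"])
    have "prob (A n) + prob (B n) - 1 \<le> prob (C n)" for n
    proof -
      have "prob (A n \<union> B n) = prob (A n) + prob (B n) - prob (A n \<inter> B n)"
        using that by (intro measure_Un3) (auto simp: fmeasurable_eq_sets)
      moreover have "prob (A n \<union> B n) \<le> 1" by simp
      moreover have "prob (A n \<inter> B n) \<le> prob (C n)" using that by (intro finite_measure_mono) auto
      ultimately show ?thesis by linarith
    qed
    then show "\<forall>\<^sub>F n in sequentially. prob (A n) + prob (B n) - 1 \<le> prob (C n)" by simp
    have "(\<lambda>n. prob (A n) + prob (B n) - 1) \<longlonglongrightarrow> 1 + 1 - 1" by (intro tendsto_intros that)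
    then show "(\<lambda>n. prob (A n) + prob (B n) - 1) \<longlonglongrightarrow> 1" by simp
  qed auto
  have "(\<lambda>n. prob {\<omega> \<in> space M. X n \<omega> \<in> U}) \<longlonglongrightarrow> 1" if U: "openin weak_topology U" "\<mu> \<in> U" for U
  proof -
    have "generate_topology_on weak_subbasis U"
      using U(1) by (simp add: openin_weak_topology_iff)
    then show ?thesis using U(2)
    proof (induction U)
      case (Int A B)
      have A: "openin weak_topology A" and B: "openin weak_topology B"
        using Int by (auto simp: openin_weak_topology_iff)
      show ?case
      proof (rule squeeze[of "\<lambda>n. {\<omega> \<in> space M. X n \<omega> \<in> A}" "\<lambda>n. {\<omega> \<in> space M. X n \<omega> \<in> B}"])
        show "{\<omega> \<in> space M. X n \<omega> \<in> A \<inter> B} \<in> events" for n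
          by (rule meas[OF openin_Int[OF A B]])
      qed (use Int meas[OF A] meas[OF B] in auto)
    next
      case (UN K)
      then obtain k where k: "k \<in> K" "\<mu> \<in> k" by auto
      have ok: "openin weak_topology k" "openin weak_topology (\<Union>K)"
        using UN k by (auto simp: openin_weak_topology_iff intro!: generate_topology_on.UN)
      show ?case
      proof (rule squeeze[of "\<lambda>n. {\<omega> \<in> space M. X n \<omega> \<in> k}" "\<lambda>n. {\<omega> \<in> space M. X n \<omega> \<in> k}"])
        show "{\<omega> \<in> space M. X n \<omega> \<in> \<Union>K} \<in> events" for n by (rule meas[OF ok(2)])
      qed (use UN.IH k meas[OF ok(1)] in auto)
    next
      case (Basis U)
      then obtain f :: "complex \<Rightarrow> real" and V
        where U: "U = {N. sets N = sets borel \<and> prob_space N \<and> (\<integral>x. f x \<partial>N) \<in> V}"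
          and f: "continuous_on UNIV f" "bounded (range f)" "open V" by blast
      have oU: "openin weak_topology U" using openin_weak_topology_basic[OF f] U by simp
      have "(\<integral>x. f x \<partial>\<mu>) \<in> V" using Basis U by simp
      then obtain e where e: "e > 0" "\<And>y. dist y (\<integral>x. f x \<partial>\<mu>) < e \<Longrightarrow> y \<in> V"
        using f(3) unfolding open_dist by blast
      obtain ps qs where pq: "\<And>N. prob_space N \<Longrightarrow> sets N = sets borel \<Longrightarrow>
        \<bar>(\<integral>x. spikes ps x \<partial>N) - (\<integral>x. spikes ps x \<partial>\<mu>)\<bar> < e / 2 \<Longrightarrow>
        \<bar>(\<integral>x. spikes qs x \<partial>N) - (\<integral>x. spikes qs x \<partial>\<mu>)\<bar> < e / 2 \<Longrightarrow>
        \<bar>(\<integral>x. f x \<partial>N) - (\<integral>x. f x \<partial>\<mu>)\<bar> < 2 * (e / 2)"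
        using spikes_control[OF \<mu> f(1,2), of "e / 2"] e(1) by (metis half_gt_zero)
      define A where "A rs n = {\<omega> \<in> space M. \<bar>(\<integral>x. spikes rs x \<partial>X n \<omega>) - (\<integral>x. spikes rs x \<partial>\<mu>)\<bar> < e / 2}" for rs n
      have A_meas: "A rs n \<in> events" for rs n
      proof -
        have "openin weak_topology {N. sets N = sets borel \<and> prob_space N \<and>
            (\<integral>x. spikes rs x \<partial>N) \<in> ball (\<integral>x. spikes rs x \<partial>\<mu>) (e / 2)}"
          by (intro openin_weak_topology_basic continuous_spikes bounded_spikes) auto
        from meas[OF this, of n] show ?thesis
          unfolding A_def using X by (simp add: dist_real_def abs_minus_commute)
      qed
      show ?case
      proof (rule squeeze[of "A ps" "A qs"])
        show "A ps n \<inter> A qs n \<subseteq> {\<omega> \<in> space M. X n \<omega> \<in> U}" for n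
          using pq X e(2) unfolding A_def U by (auto simp: dist_real_def)
      qed (use lim[of "e / 2"] e(1) A_meas meas[OF oU] in \<open>auto simp: A_def\<close>)
    qed simp
  qed
  then show ?thesis unfolding converges_in_probability_def using in_topspace_weak_topology[OF \<mu>] by blast
qed

section \<open>Continuity of the zeros\<close>

lemma bounded_family_convergent_subsequence:
  fixes \<eta> :: "nat \<Rightarrow> nat \<Rightarrow> complex"
  assumes "\<And>m j. j \<in> {1..d} \<Longrightarrow> cmod (\<eta> m j) \<le> K"
  shows "\<exists>r l. strict_mono r \<and> (\<forall>j\<in>{1..d}. (\<lambda>m. \<eta> (r m) j) \<longlonglongrightarrow> l j)"
  using assms
proof (induction d)
  case 0
  show ?case by (intro exI[of _ id]) (auto simp: strict_mono_id)
next
  case (Suc d)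
  obtain r l where r: "strict_mono r" "\<And>j. j \<in> {1..d} \<Longrightarrow> (\<lambda>m. \<eta> (r m) j) \<longlonglongrightarrow> l j"
    using Suc.IH Suc.prems by force
  have "bounded (range (\<lambda>m. \<eta> (r m) (Suc d)))"
    using Suc.prems by (intro boundedI[of _ K]) auto
  from bounded_imp_convergent_subsequence[OF this]
  obtain l' r' where r': "strict_mono r'" "((\<lambda>m. \<eta> (r m) (Suc d)) \<circ> r') \<longlonglongrightarrow> l'" by blast
  have "(\<lambda>m. \<eta> ((r \<circ> r') m) j) \<longlonglongrightarrow> (l(Suc d := l')) j" if "j \<in> {1..Suc d}" for j
  proof (cases "j = Suc d")
    case True
    then show ?thesis using r'(2) by (simp add: o_def)
  next
    case False
    then have "j \<in> {1..d}" using that by auto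
    from LIMSEQ_subseq_LIMSEQ[OF r(2)[OF this] r'(1)] show ?thesis using False by (simp add: o_def)
  qed
  then show ?case using strict_mono_o[OF r(1) r'(1)] by blast
qed

lemma tendsto_poly_higher_pderiv_root_poly:
  assumes "\<And>i. (\<lambda>m. xs m i) \<longlonglongrightarrow> x i"
  shows "(\<lambda>m. poly ((pderiv ^^ k) (root_poly (xs m) n)) z) \<longlonglongrightarrow> poly ((pderiv ^^ k) (root_poly x n)) z"
proof (induction n arbitrary: k)
  case (Suc n)
  have eq: "poly ((pderiv ^^ k) (root_poly y (Suc n))) z
      = (z - y (Suc n)) * poly ((pderiv ^^ k) (root_poly y n)) z
        + of_nat k * poly ((pderiv ^^ (k - 1)) (root_poly y n)) z" for y
    unfolding root_poly_Suc higher_pderiv_mult_linear by (simp add: algebra_simps)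
  show ?case unfolding eq by (intro tendsto_intros assms Suc)
qed simp

text \<open>Along a convergent sequence \<open>x\<close> the zeros stay bounded, so a subsequence of them converges,
  necessarily to the zeros of the limit polynomial.\<close>

lemma continuous_integral_zeros_measure:
  fixes f :: "complex \<Rightarrow> real"
  assumes f: "continuous_on UNIV f"
  shows "continuous_on UNIV (\<lambda>x. \<integral>z. f z \<partial>zeros_measure ((pderiv ^^ k) (root_poly x n)))"
    (is "continuous_on _ ?F")
proof (cases "k < n")
  \<comment> \<open>The derivative is constant, so every \<open>x\<close> yields the same default
    measure.\<close>
  case False
  have "proots ((pderiv ^^ k) (root_poly x n)) = {#}" for x
  proof -
    have "degree ((pderiv ^^ k) (root_poly x n)) = 0" using False by (simp add: degree_higher_pderiv)
    then obtain c where "(pderiv ^^ k) (root_poly x n) = [:c:]" by (rule degree_eq_zeroE)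
    then show ?thesis by simp
  qed
  then show ?thesis by (simp add: zeros_measure_def)
next
  case True
  define d where "d = n - k"
  define c where "c = complex_of_real (pderiv_lead n k)"
  have d: "d \<ge> 1" using True by (simp add: d_def)
  have c: "cmod c \<ge> 1" "c \<noteq> 0" using pderiv_lead_ge_1[of n k] by (auto simp: c_def)
  have [measurable]: "f \<in> borel_measurable borel" by (rule borel_measurable_continuous_onI) fact
  \<comment> \<open>Continuity through preimages of closed sets. Closedness may be tested with
    sequences, as the product has countably many coordinates; a subsequence then suffices to place
    the limit in the preimage.\<close>
  have "closed (?F -` B)" if B: "closed B" for B
    unfolding closed_sequential_limits
  proof (intro allI impI, elim conjE)
    fix xs x assume xs: "\<forall>m. xs m \<in> ?F -` B" and lim: "xs \<longlonglongrightarrow> x"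
    have lim_i: "(\<lambda>m. xs m i) \<longlonglongrightarrow> x i" for i
    proof -
      have "continuous_on UNIV (\<lambda>y::nat \<Rightarrow> complex. y i)" by (rule continuous_on_product_coordinates)
      then have "isCont (\<lambda>y::nat \<Rightarrow> complex. y i) x"
        unfolding continuous_on_eq_continuous_at[OF open_UNIV] by blast
      from isCont_tendsto_compose[OF this lim] show ?thesis .
    qed
    have "\<exists>\<eta>. (pderiv ^^ k) (root_poly (xs m) n) = smult c (root_poly \<eta> d)" for m
      using ex_critical_points[of k n "xs m"] True unfolding c_def d_def by (metis less_imp_le)
    then obtain \<eta> where \<eta>: "\<And>m. (pderiv ^^ k) (root_poly (xs m) n) = smult c (root_poly (\<eta> m) d)"
      by metis
    have "(\<lambda>m. real n ^ k * (\<Prod>i=1..n. 1 + cmod (xs m i))) \<longlonglongrightarrow> real n ^ k * (\<Prod>i=1..n. 1 + cmod (x i))"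
      by (intro tendsto_intros lim_i)
    then have "Bseq (\<lambda>m. real n ^ k * (\<Prod>i=1..n. 1 + cmod (xs m i)))"
      by (intro convergent_imp_Bseq) (auto simp: convergent_def)
    then obtain K where K: "\<And>m. \<bar>real n ^ k * (\<Prod>i=1..n. 1 + cmod (xs m i))\<bar> \<le> K"
      by (auto simp: Bseq_def)
    have "cmod (\<eta> m j) \<le> 1 + K" if j: "j \<in> {1..d}" for m j
    proof -
      let ?q = "(pderiv ^^ k) (root_poly (xs m) n)"
      have "poly ?q (\<eta> m j) = 0" unfolding \<eta> poly_smult poly_root_poly using j by auto
      moreover have "cmod (lead_coeff ?q) \<ge> 1" unfolding \<eta> lead_coeff_smult using c by simp
      ultimately have "cmod (\<eta> m j) \<le> 1 + coeff_norm ?q" by (rule root_norm_le_coeff_norm)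
      also have "\<dots> \<le> 1 + K"
        using coeff_norm_higher_pderiv_root_poly[of k "xs m" n] K[of m] by linarith
      finally show ?thesis .
    qed
    from bounded_family_convergent_subsequence[of d \<eta> "1 + K", OF this]
    obtain r l where r: "strict_mono r" and l: "\<And>j. j \<in> {1..d} \<Longrightarrow> (\<lambda>m. \<eta> (r m) j) \<longlonglongrightarrow> l j"
      by blast
    have "poly ((pderiv ^^ k) (root_poly x n)) z = poly (smult c (root_poly l d)) z" for z
    proof (rule LIMSEQ_unique)
      show "(\<lambda>m. poly ((pderiv ^^ k) (root_poly (xs (r m)) n)) z) \<longlonglongrightarrow> poly ((pderiv ^^ k) (root_poly x n)) z"
        using LIMSEQ_subseq_LIMSEQ[OF tendsto_poly_higher_pderiv_root_poly[OF lim_i] r] by (simp add: o_def)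
      show "(\<lambda>m. poly ((pderiv ^^ k) (root_poly (xs (r m)) n)) z) \<longlonglongrightarrow> poly (smult c (root_poly l d)) z"
        unfolding \<eta> poly_smult poly_root_poly by (intro tendsto_intros l)
    qed
    then have "poly ((pderiv ^^ k) (root_poly x n)) = poly (smult c (root_poly l d))" by (rule ext)
    then have q: "(pderiv ^^ k) (root_poly x n) = smult c (root_poly l d)"
      by (simp only: poly_eq_poly_eq_iff)
    have F: "?F y = (\<Sum>i=1..d. f (\<theta> i)) / d" if "(pderiv ^^ k) (root_poly y n) = smult c (root_poly \<theta> d)" for y \<theta>
      unfolding that using c d by (intro integral_zeros_measure) auto
    have "(\<lambda>m. ?F (xs (r m))) \<longlonglongrightarrow> ?F x"
    proof -
      have "(\<lambda>m. f (\<eta> (r m) j)) \<longlonglongrightarrow> f (l j)" if "j \<in> {1..d}" for j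
        using f l[OF that] by (intro isCont_tendsto_compose[of _ f]) (auto simp: continuous_on_eq_continuous_at)
      then show ?thesis unfolding F[OF \<eta>] F[OF q] using d by (intro tendsto_intros) auto
    qed
    then show "x \<in> ?F -` B"
      using closed_sequentially[OF B, of "\<lambda>m. ?F (xs (r m))" "?F x"] xs by auto
  qed
  then show ?thesis by (simp add: continuous_on_closed_vimage[of UNIV])
qed

lemma prob_space_zeros_measure: "prob_space (zeros_measure p)"
  and sets_zeros_measure [simp]: "sets (zeros_measure p) = sets borel"
  by (simp_all add: zeros_measure_def prob_space_uniform_mset_measure)

lemma open_zeros_measure_vimage:
  assumes "openin weak_topology U"
  shows "open {x. zeros_measure ((pderiv ^^ k) (root_poly x n)) \<in> U}"
proof -
  have "generate_topology_on weak_subbasis U"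
    using assms by (simp add: openin_weak_topology_iff)
  then show ?thesis
  proof (induction U)
    case (Int A B)
    then show ?case using open_Int by (simp add: Collect_conj_eq)
  next
    case (UN K)
    have "{x. zeros_measure ((pderiv ^^ k) (root_poly x n)) \<in> \<Union>K}
        = (\<Union>A\<in>K. {x. zeros_measure ((pderiv ^^ k) (root_poly x n)) \<in> A})" by auto
    then show ?case using UN by auto
  next
    case (Basis U)
    then obtain f :: "complex \<Rightarrow> real" and V
      where U: "U = {N. sets N = sets borel \<and> prob_space N \<and> (\<integral>x. f x \<partial>N) \<in> V}"
        and f: "continuous_on UNIV f" "open V" by blast
    have "{x. zeros_measure ((pderiv ^^ k) (root_poly x n)) \<in> U}
        = (\<lambda>x. \<integral>z. f z \<partial>zeros_measure ((pderiv ^^ k) (root_poly x n))) -` V"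
      unfolding U by (auto simp: prob_space_zeros_measure)
    then show ?case using open_vimage[OF f(2) continuous_integral_zeros_measure[OF f(1)]] by simp
  qed simp
qed

lemma root_poly_cong: "(\<And>i. i \<in> {1..n} \<Longrightarrow> x i = y i) \<Longrightarrow> root_poly x n = root_poly y n"
  unfolding root_poly_def by (intro prod.cong) auto

text \<open>Supplies the measurability that convergence in probability relies on. Openness of the
  preimage gives it without any measurable selection of the zeros.\<close>

lemma zeros_measure_event:
  assumes "openin weak_topology U" "\<And>i. i \<ge> 1 \<Longrightarrow> \<xi> i \<in> borel_measurable M"
  shows "{\<omega> \<in> space M. zeros_measure ((pderiv ^^ k) (root_poly (\<lambda>i. \<xi> i \<omega>) n)) \<in> U} \<in> sets M"
proof -
  \<comment> \<open>Nothing is known about \<open>\<xi> 0\<close>, so it is replaced by a constant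
    to make all coordinates measurable.\<close>
  define x where "x \<omega> i = (if i = 0 then 0 else \<xi> i \<omega>)" for \<omega> and i :: nat
  have [measurable]: "x \<in> borel_measurable M"
  proof (rule measurable_coordinatewise_then_product)
    show "(\<lambda>\<omega>. x \<omega> i) \<in> borel_measurable M" for i
      by (cases "i = 0") (simp_all add: x_def assms)
  qed
  have [measurable]: "{x. zeros_measure ((pderiv ^^ k) (root_poly x n)) \<in> U} \<in> sets borel"
    by (intro borel_open open_zeros_measure_vimage assms)
  have "root_poly (\<lambda>i. \<xi> i \<omega>) n = root_poly (x \<omega>) n" for \<omega>
    by (rule root_poly_cong) (auto simp: x_def)
  then have "{\<omega> \<in> space M. zeros_measure ((pderiv ^^ k) (root_poly (\<lambda>i. \<xi> i \<omega>) n)) \<in> U}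
      = x -` {x. zeros_measure ((pderiv ^^ k) (root_poly x n)) \<in> U} \<inter> space M" by auto
  also have "\<dots> \<in> sets M" by measurable
  finally show ?thesis .
qed

section \<open>Logarithmic potentials of the derivatives\<close>

text \<open>Only the finite block \<open>B\<close> is treated as random. The other indices up to
  \<open>n\<close> form the factor \<open>G\<close> with constant term 1, so neither
  \<open>B\<close> nor \<open>\<rho>\<close> depends on \<open>n\<close>.\<close>

lemma anticoncentration_full:
  fixes u v :: "nat \<Rightarrow> complex"
  assumes "infinite {i. i \<ge> 1 \<and> u i \<noteq> v i}" "\<eta> > 0"
  shows "\<exists>\<rho>>0. \<forall>\<^sub>F n in sequentially.
    real (card {S \<in> Pow {1..n}. cmod (coeff (one_plus_prod {1..n} (pick u v S)) k) \<le> \<rho>}) \<le> \<eta> * 2 ^ n"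
proof -
  obtain B \<rho> where B: "finite B" "B \<subseteq> {i. i \<ge> 1 \<and> u i \<noteq> v i}" and \<rho>: "\<rho> > 0"
    and AC: "\<And>G. cmod (coeff G 0) \<ge> 1 \<Longrightarrow>
      real (card {S \<in> Pow B. cmod (coeff (G * one_plus_prod B (pick u v S)) k) \<le> \<rho>}) \<le> \<eta> * 2 ^ card B"
  proof -
    have "\<exists>B \<rho>. finite B \<and> B \<subseteq> {i. i \<ge> 1 \<and> u i \<noteq> v i} \<and> \<rho> > 0 \<and> (\<forall>G. cmod (coeff G 0) \<ge> 1 \<longrightarrow>
      real (card {S \<in> Pow B. cmod (coeff (G * one_plus_prod B (pick u v S)) k) \<le> \<rho>}) \<le> \<eta> * 2 ^ card B)"
      by (rule anticoncentration[OF assms(1) _ assms(2)]) simp_all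
    then show thesis using that by blast
  qed
  obtain n0 where n0: "\<And>i. i \<in> B \<Longrightarrow> i \<le> n0"
    using B(1) unfolding finite_nat_set_iff_bounded_le by auto
  have "real (card {S \<in> Pow {1..n}. cmod (coeff (one_plus_prod {1..n} (pick u v S)) k) \<le> \<rho>}) \<le> \<eta> * 2 ^ n"
    if n: "n \<ge> n0" for n
  proof -
    define J where "J = {1..n} - B"
    have un: "{1..n} = B \<union> J" using B n0 n by (force simp: J_def)
    have J: "finite J" "B \<inter> J = {}" by (auto simp: J_def)
    have card: "n = card B + card J" using card_Un_disjoint[OF B(1) J] un[symmetric] by simp
    have "real (card {S \<in> Pow (B \<union> J). cmod (coeff (one_plus_prod (B \<union> J) (pick u v S)) k) \<le> \<rho>})
        = (\<Sum>T\<in>Pow J. real (card {S \<in> Pow B. cmod (coeff (one_plus_prod (B \<union> J) (pick u v (S \<union> T))) k) \<le> \<rho>}))"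
      unfolding card_Pow_union[OF B(1) J] by simp
    also have "\<dots> \<le> (\<Sum>T\<in>Pow J. \<eta> * 2 ^ card B)"
    proof (intro sum_mono)
      fix T assume T: "T \<in> Pow J"
      have "{S \<in> Pow B. cmod (coeff (one_plus_prod (B \<union> J) (pick u v (S \<union> T))) k) \<le> \<rho>}
          = {S \<in> Pow B. cmod (coeff (one_plus_prod J (pick u v T) * one_plus_prod B (pick u v S)) k) \<le> \<rho>}"
        using T by (intro Collect_cong) (auto simp: one_plus_prod_pick_union[OF B(1) J] mult.commute)
      then show "real (card {S \<in> Pow B. cmod (coeff (one_plus_prod (B \<union> J) (pick u v (S \<union> T))) k) \<le> \<rho>})
          \<le> \<eta> * 2 ^ card B"
        using AC[of "one_plus_prod J (pick u v T)"] by simp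
    qed
    also have "\<dots> = \<eta> * 2 ^ n" using J by (simp add: card_Pow card power_add)
    finally show ?thesis unfolding un .
  qed
  then show ?thesis using \<rho> unfolding eventually_sequentially by blast
qed

text \<open>Up to a constant coming from the leading coefficient, the difference of the logarithmic
  potentials of the two sets of zeros, both divided by \<open>n\<close>.\<close>

definition log_ratio :: "nat \<Rightarrow> (nat \<Rightarrow> complex) \<Rightarrow> nat \<Rightarrow> complex \<Rightarrow> real" where
  "log_ratio k x n z = (ln (cmod (poly ((pderiv ^^ k) (root_poly x n)) z)) - ln (cmod (poly (root_poly x n) z))) / n"

lemma log_ratio_pointwise:
  assumes ab: "infinite {i. i \<ge> 1 \<and> a i \<noteq> b i}"
    and z: "\<And>i. i \<ge> 1 \<Longrightarrow> z \<noteq> a i" "\<And>i. i \<ge> 1 \<Longrightarrow> z \<noteq> b i"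
    and C: "\<And>i. i \<ge> 1 \<Longrightarrow> 1 / cmod (z - a i) \<le> C * real i ^ 4" "\<And>i. i \<ge> 1 \<Longrightarrow> 1 / cmod (z - b i) \<le> C * real i ^ 4"
    and "\<epsilon> > 0"
  shows "(\<lambda>n. real (card {S \<in> Pow {1..n}. \<bar>log_ratio k (pick a b S) n z\<bar> > \<epsilon>}) / 2 ^ n) \<longlonglongrightarrow> 0"
proof (rule LIMSEQ_I)
  fix r :: real assume "r > 0"
  define u where "u i = 1 / (z - a i)" for i
  define v where "v i = 1 / (z - b i)" for i
  define D where "D = max 1 C"
  have "{i. i \<ge> 1 \<and> u i \<noteq> v i} = {i. i \<ge> 1 \<and> a i \<noteq> b i}"
    using z by (auto simp: u_def v_def)
  then obtain \<rho> where \<rho>: "\<rho> > 0" and AC: "\<forall>\<^sub>F n in sequentially.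
      real (card {S \<in> Pow {1..n}. cmod (coeff (one_plus_prod {1..n} (pick u v S)) k) \<le> \<rho>}) \<le> (r / 2) * 2 ^ n"
    using anticoncentration_full[of u v "r / 2" k] ab \<open>r > 0\<close> by auto
  \<comment> \<open>Bounds \<open>n * \<bar>log_ratio\<bar>\<close> outside the exceptional choices:
    \<open>n\<close> reciprocals of size at most \<open>D * n ^ 4\<close> make the symmetric
    polynomial at most \<open>(D * n ^ 5) ^ k\<close>, and \<open>\<rho>\<close> bounds it from
    below.\<close>
  define g where "g n = ln (fact k) + \<bar>ln \<rho>\<bar> + real k * (ln D + 5 * ln (real n))" for n :: nat
  have "(\<lambda>n. (ln (fact k) + \<bar>ln \<rho>\<bar> + real k * ln D) * (1 / real n) + real k * 5 * (ln (real n) / real n)) \<longlonglongrightarrow>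
      (ln (fact k) + \<bar>ln \<rho>\<bar> + real k * ln D) * 0 + real k * 5 * 0"
    by (intro tendsto_intros lim_1_over_n lim_ln_over_n)
  moreover have "(\<lambda>n. (ln (fact k) + \<bar>ln \<rho>\<bar> + real k * ln D) * (1 / real n) + real k * 5 * (ln (real n) / real n)) = (\<lambda>n. g n / n)"
    unfolding g_def by (intro ext) (simp add: add_divide_distrib algebra_simps)
  ultimately have "(\<lambda>n. g n / n) \<longlonglongrightarrow> 0" by simp
  then have g: "\<forall>\<^sub>F n in sequentially. g n / n < \<epsilon>" using \<open>\<epsilon> > 0\<close> by (rule order_tendstoD)
  have "\<forall>\<^sub>F n in sequentially. norm (real (card {S \<in> Pow {1..n}. \<bar>log_ratio k (pick a b S) n z\<bar> > \<epsilon>}) / 2 ^ n - 0) < r"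
    using AC g eventually_gt_at_top[of 0]
  proof eventually_elim
    case (elim n)
    have "{S \<in> Pow {1..n}. \<bar>log_ratio k (pick a b S) n z\<bar> > \<epsilon>}
        \<subseteq> {S \<in> Pow {1..n}. cmod (coeff (one_plus_prod {1..n} (pick u v S)) k) \<le> \<rho>}"
    proof (intro subsetI CollectI conjI; elim CollectE conjE)
      fix S assume S: "\<epsilon> < \<bar>log_ratio k (pick a b S) n z\<bar>"
      show "cmod (coeff (one_plus_prod {1..n} (pick u v S)) k) \<le> \<rho>"
      proof (rule ccontr)
        define x where "x = pick a b S"
        define c where "c = cmod (coeff (one_plus_prod {1..n} (pick u v S)) k)"
        assume "\<not> cmod (coeff (one_plus_prod {1..n} (pick u v S)) k) \<le> \<rho>"
        then have c: "c > \<rho>" by (simp add: c_def)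
        have x: "z \<noteq> x i" if "i \<in> {1..n}" for i using that z by (auto simp: x_def pick_def)
        have P: "poly (root_poly x n) z \<noteq> 0" using x by (auto simp: poly_root_poly)
        have eq: "(\<lambda>i. 1 / (z - x i)) = pick u v S" by (auto simp: x_def pick_def u_def v_def)
        have "cmod (poly ((pderiv ^^ k) (root_poly x n)) z) = cmod (poly (root_poly x n) z) * (fact k * c)"
          using poly_higher_pderiv_root_poly[of n z x k] x unfolding eq c_def by (simp add: norm_mult)
        then have "ln (cmod (poly ((pderiv ^^ k) (root_poly x n)) z)) - ln (cmod (poly (root_poly x n) z)) = ln (fact k) + ln c"
          using P c \<rho> by (simp add: ln_mult)
        then have lr: "log_ratio k x n z = (ln (fact k) + ln c) / n" by (simp add: log_ratio_def)
        have "c \<le> (real (card {1..n}) * (D * real n ^ 4)) ^ k"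
          unfolding c_def
        proof (rule coeff_one_plus_prod_le)
          fix i assume i: "i \<in> {1..n}"
          have "cmod (pick u v S i) \<le> C * real i ^ 4"
            using i C[of i] by (auto simp: pick_def u_def v_def norm_divide)
          also have "\<dots> \<le> D * real n ^ 4" using i by (intro mult_mono power_mono) (auto simp: D_def)
          finally show "cmod (pick u v S i) \<le> D * real n ^ 4" .
        qed (auto simp: D_def)
        also have "\<dots> = (D * real n ^ 5) ^ k" by (simp add: numeral_eq_Suc mult_ac)
        finally have "ln c \<le> ln ((D * real n ^ 5) ^ k)" using c \<rho> by (intro ln_mono) auto
        also have "\<dots> = real k * (ln D + 5 * ln (real n))"
          using elim by (simp add: ln_realpow ln_mult D_def)
        finally have 1: "ln c \<le> real k * (ln D + 5 * ln (real n))" .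
        have 2: "ln \<rho> \<le> ln c" using c \<rho> by simp
        have 3: "0 \<le> ln (fact k :: real)" by (simp add: fact_ge_1)
        have 4: "0 \<le> real k * (ln D + 5 * ln (real n))" using elim by (auto simp: D_def)
        have "\<bar>ln (fact k) + ln c\<bar> \<le> g n" unfolding g_def using 1 2 3 4 by linarith
        then have "\<bar>log_ratio k x n z\<bar> \<le> g n / n" unfolding lr abs_divide by (simp add: divide_right_mono)
        then show False using S elim unfolding x_def by linarith
      qed
    qed auto
    then have "card {S \<in> Pow {1..n}. \<bar>log_ratio k (pick a b S) n z\<bar> > \<epsilon>}
        \<le> card {S \<in> Pow {1..n}. cmod (coeff (one_plus_prod {1..n} (pick u v S)) k) \<le> \<rho>}"
      by (intro card_mono) auto
    then have "real (card {S \<in> Pow {1..n}. \<bar>log_ratio k (pick a b S) n z\<bar> > \<epsilon>}) \<le> (r / 2) * 2 ^ n"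
      using elim(1) by linarith
    also have "\<dots> < r * 2 ^ n" using \<open>r > 0\<close> by simp
    finally show ?case by (simp add: pos_divide_less_eq)
  qed
  then show "\<exists>no. \<forall>n\<ge>no. norm (real (card {S \<in> Pow {1..n}. \<bar>log_ratio k (pick a b S) n z\<bar> > \<epsilon>}) / 2 ^ n - 0) < r"
    by (simp add: eventually_sequentially)
qed

text \<open>For the second claim: \<open>\<Sum>i. cmod (z - w i) powr (-1/2) / i\<^sup>2\<close> has finite integral.\<close>

lemma AE_circ_distance:
  assumes "\<rho> > 0"
  shows "AE z in circ. \<forall>i\<ge>1. y + of_real \<rho> * z \<noteq> a i"
    and "AE z in circ. \<exists>C. \<forall>i\<ge>1. 1 / cmod (y + of_real \<rho> * z - a i) \<le> C * real i ^ 4"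
proof -
  define w where "w i = (a i - y) / of_real \<rho>" for i
  have eq: "y + of_real \<rho> * z - a i = of_real \<rho> * (z - w i)" for z i
    using assms by (simp add: w_def field_simps)
  have neq: "AE z in circ. \<forall>i. z \<noteq> w i" using AE_circ_neq by (simp add: AE_all_countable)
  then show "AE z in circ. \<forall>i\<ge>1. y + of_real \<rho> * z \<noteq> a i"
  proof eventually_elim
    case (elim z)
    then have "y + of_real \<rho> * z - a i \<noteq> 0" for i unfolding eq using assms by simp
    then show ?case by auto
  qed
  obtain K where K: "\<And>w. integrable circ (\<lambda>z. cmod (z - w) powr (-1/2))"
    "\<And>w. (\<integral>z. cmod (z - w) powr (-1/2) \<partial>circ) \<le> K"
    using singular_kernel_bound by blast
  have K0: "K \<ge> 0" using K(2)[of 0] by (rule order_trans[rotated]) simp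
  define s where "s i z = cmod (z - w (Suc i)) powr (-1/2)" for i z
  have s_le: "(\<integral>\<^sup>+z. ennreal (s i z / (real (Suc i))\<^sup>2) \<partial>circ) \<le> ennreal (K * inverse ((real (Suc i))\<^sup>2))" for i
  proof -
    have "(\<integral>\<^sup>+z. ennreal (s i z / (real (Suc i))\<^sup>2) \<partial>circ) = ennreal (\<integral>z. s i z / (real (Suc i))\<^sup>2 \<partial>circ)"
      unfolding s_def using K by (intro nn_integral_eq_integral) auto
    also have "(\<integral>z. s i z / (real (Suc i))\<^sup>2 \<partial>circ) = (\<integral>z. s i z \<partial>circ) / (real (Suc i))\<^sup>2" by simp
    also have "\<dots> \<le> K / (real (Suc i))\<^sup>2" unfolding s_def using K by (intro divide_right_mono) auto
    finally show ?thesis by (simp add: ennreal_leI divide_inverse)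
  qed
  have "(\<integral>\<^sup>+z. (\<Sum>i. ennreal (s i z / (real (Suc i))\<^sup>2)) \<partial>circ) = (\<Sum>i. \<integral>\<^sup>+z. ennreal (s i z / (real (Suc i))\<^sup>2) \<partial>circ)"
    by (rule nn_integral_suminf) (simp add: s_def)
  also have "\<dots> \<le> (\<Sum>i. ennreal (K * inverse ((real (Suc i))\<^sup>2)))"
    by (intro suminf_le s_le) auto
  also have "\<dots> < top"
    unfolding less_top[symmetric]
  proof (rule ennreal_suminf_neq_top)
    have "summable (\<lambda>i. inverse ((real i)\<^sup>2))" using inverse_power_summable[of 2, where 'a = real] by simp
    then show "summable (\<lambda>i. K * inverse ((real (Suc i))\<^sup>2))"
      by (intro summable_mult) (subst (asm) summable_Suc_iff[symmetric])
  qed (use K0 in simp)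
  finally have "(\<integral>\<^sup>+z. (\<Sum>i. ennreal (s i z / (real (Suc i))\<^sup>2)) \<partial>circ) \<noteq> \<infinity>" by simp
  then have "AE z in circ. (\<Sum>i. ennreal (s i z / (real (Suc i))\<^sup>2)) \<noteq> \<infinity>"
    by (intro nn_integral_PInf_AE) (auto simp: s_def)
  with neq show "AE z in circ. \<exists>C. \<forall>i\<ge>1. 1 / cmod (y + of_real \<rho> * z - a i) \<le> C * real i ^ 4"
  proof eventually_elim
    case (elim z)
    define D where "D = enn2real (\<Sum>i. ennreal (s i z / (real (Suc i))\<^sup>2))"
    have D: "s i z \<le> D * (real (Suc i))\<^sup>2" for i
    proof -
      have "ennreal (s i z / (real (Suc i))\<^sup>2) \<le> (\<Sum>i. ennreal (s i z / (real (Suc i))\<^sup>2))"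
        using sum_le_suminf[of "\<lambda>i. ennreal (s i z / (real (Suc i))\<^sup>2)" "{i}"] by simp
      also have "\<dots> = ennreal D" unfolding D_def using elim by (simp add: less_top)
      finally have "s i z / (real (Suc i))\<^sup>2 \<le> D" by (simp add: D_def ennreal_le_iff)
      then show ?thesis by (simp add: pos_divide_le_eq)
    qed
    \<comment> \<open>The convergent series gives \<open>s j z \<le> D * real i ^ 2\<close>, and
      \<open>s j z\<close> is the inverse square root of a distance; squaring produces the fourth
      power.\<close>
    have "1 / cmod (y + of_real \<rho> * z - a i) \<le> (D\<^sup>2 / \<rho>) * real i ^ 4" if i: "i \<ge> 1" for i
    proof -
      obtain j where j: "i = Suc j" using i by (cases i) auto
      define t where "t = cmod (z - w i)"
      have t: "t > 0" using elim by (simp add: t_def)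
      have "(s j z)\<^sup>2 \<le> (D * (real i)\<^sup>2)\<^sup>2" using D[of j] unfolding j by (intro power_mono) (auto simp: s_def)
      moreover have "(s j z)\<^sup>2 = 1 / t"
        using t unfolding s_def j[symmetric] t_def[symmetric]
        by (simp add: power2_eq_square powr_minus_divide flip: powr_add)
      ultimately have "1 / t \<le> D\<^sup>2 * real i ^ 4" by (simp add: power_mult_distrib flip: power_mult)
      then have "(1 / t) / \<rho> \<le> (D\<^sup>2 * real i ^ 4) / \<rho>" using assms by (intro divide_right_mono) auto
      then show ?thesis unfolding eq norm_mult using assms by (simp add: t_def mult.commute)
    qed
    then show ?case by blast
  qed
qed

section \<open>Mean-square bounds for the logarithmic ratio on circles\<close>

lemma measure_circ_UNIV [simp]: "measure circ UNIV = 1"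
  using circ.prob_space by simp

lemma measurable_poly [measurable]: "poly p \<in> borel_measurable borel"
  for p :: "complex poly"
  by (intro borel_measurable_continuous_onI continuous_intros)

lemma measurable_log_ratio [measurable]: "log_ratio k x n \<in> borel_measurable borel"
  unfolding log_ratio_def by measurable

lemma AE_ln_poly:
  assumes "c > 0" "\<rho> > 0"
  shows "AE z in circ. ln (cmod (poly (smult (of_real c) (root_poly \<eta> d)) (y + of_real \<rho> * z)))
      = ln c + (\<Sum>j=1..d. ln (cmod (y + of_real \<rho> * z - \<eta> j)))"
  using AE_circ_distance(1)[OF assms(2), of y \<eta>]
proof eventually_elim
  case (elim z)
  have nz: "cmod (y + of_real \<rho> * z - \<eta> j) > 0" if "j \<in> {1..d}" for j using elim that by auto
  then have "ln (\<Prod>j=1..d. cmod (y + of_real \<rho> * z - \<eta> j)) = (\<Sum>j=1..d. ln (cmod (y + of_real \<rho> * z - \<eta> j)))"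
    by (intro ln_prod) auto
  moreover have "(\<Prod>j=1..d. cmod (y + of_real \<rho> * z - \<eta> j)) > 0" by (intro prod_pos) (use nz in auto)
  moreover have "cmod (poly (smult (of_real c) (root_poly \<eta> d)) (y + of_real \<rho> * z))
      = c * (\<Prod>j=1..d. cmod (y + of_real \<rho> * z - \<eta> j))"
    using assms by (simp add: poly_root_poly norm_mult prod_norm)
  ultimately show ?case using assms by (simp only: ln_mult_pos)
qed

lemma
  assumes "c > 0" "\<rho> > 0"
  shows integrable_ln_poly: "integrable circ (\<lambda>z. ln (cmod (poly (smult (of_real c) (root_poly \<eta> d)) (y + of_real \<rho> * z))))"
    and integral_ln_poly: "(\<integral>z. ln (cmod (poly (smult (of_real c) (root_poly \<eta> d)) (y + of_real \<rho> * z))) \<partial>circ)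
      = ln c + (\<Sum>j=1..d. ln (max \<rho> (cmod (\<eta> j - y))))"
proof -
  note ae = AE_ln_poly[OF assms, of \<eta> d y]
  have int: "integrable circ (\<lambda>z. ln c + (\<Sum>j=1..d. ln (cmod (y + of_real \<rho> * z - \<eta> j))))"
    by (intro Bochner_Integration.integrable_add Bochner_Integration.integrable_sum integrable_ln_circ assms) simp
  show "integrable circ (\<lambda>z. ln (cmod (poly (smult (of_real c) (root_poly \<eta> d)) (y + of_real \<rho> * z))))"
    by (rule integrable_cong_AE[THEN iffD2, OF _ _ ae int]) measurable
  have "(\<integral>z. ln (cmod (poly (smult (of_real c) (root_poly \<eta> d)) (y + of_real \<rho> * z))) \<partial>circ)
      = (\<integral>z. ln c + (\<Sum>j=1..d. ln (cmod (y + of_real \<rho> * z - \<eta> j))) \<partial>circ)"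
    by (rule integral_cong_AE[OF _ _ ae]) measurable
  also have "\<dots> = ln c + (\<Sum>j=1..d. ln (max \<rho> (cmod (\<eta> j - y))))"
    using integrable_ln_circ[OF assms(2)] by (simp add: integral_ln_circ[OF assms(2)])
  finally show "(\<integral>z. ln (cmod (poly (smult (of_real c) (root_poly \<eta> d)) (y + of_real \<rho> * z))) \<partial>circ)
      = ln c + (\<Sum>j=1..d. ln (max \<rho> (cmod (\<eta> j - y))))" .
qed

text \<open>By Jensen's formula the left-hand side is the mean of the logarithm of the derivative
  over the unit circle, its logarithmic Mahler measure, which the coefficient norm controls. In this
  way the log-Cesaro bound passes from the zeros to the zeros of the derivative, leading coefficient
  included.\<close>

lemma critical_points_log_bound:
  assumes "(pderiv ^^ k) (root_poly x n) = smult (of_real c) (root_poly \<eta> d)" "c \<ge> 1" "n \<ge> 1"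
    and A: "(\<Sum>i=1..n. log_plus (cmod (x i))) \<le> A * n"
  shows "ln c + (\<Sum>j=1..d. log_plus (cmod (\<eta> j))) \<le> (k + ln 2 + A) * n"
proof -
  let ?q = "smult (of_real c) (root_poly \<eta> d)"
  let ?B = "real k * ln n + (\<Sum>i=1..n. ln (1 + cmod (x i)))"
  have c: "c > 0" using assms by simp
  have "ln c + (\<Sum>j=1..d. log_plus (cmod (\<eta> j))) = (\<integral>z. ln (cmod (poly ?q z)) \<partial>circ)"
    using integral_ln_poly[OF c, of 1 \<eta> d 0] by (simp add: log_plus_eq_ln_max)
  also have "\<dots> \<le> (\<integral>z. ?B \<partial>circ)"
  proof (rule integral_mono_AE)
    show "integrable circ (\<lambda>z. ln (cmod (poly ?q z)))" using integrable_ln_poly[OF c, of 1 \<eta> d 0] by simp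
    have "AE z in circ. \<forall>i\<ge>1. 0 + of_real 1 * z \<noteq> \<eta> i" by (rule AE_circ_distance) simp
    with AE_circ_norm show "AE z in circ. ln (cmod (poly ?q z)) \<le> ?B"
    proof eventually_elim
      case (elim z)
      have "cmod (poly ?q z) \<le> coeff_norm ?q" using elim by (intro norm_poly_le_coeff_norm) simp
      also have "\<dots> \<le> real n ^ k * (\<Prod>i=1..n. 1 + cmod (x i))"
        unfolding assms(1)[symmetric] by (rule coeff_norm_higher_pderiv_root_poly)
      finally have le: "cmod (poly ?q z) \<le> real n ^ k * (\<Prod>i=1..n. 1 + cmod (x i))" .
      have "poly ?q z \<noteq> 0" using elim c by (auto simp: poly_root_poly)
      then have "ln (cmod (poly ?q z)) \<le> ln (real n ^ k * (\<Prod>i=1..n. 1 + cmod (x i)))"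
        using le by (intro ln_mono) auto
      also have "\<dots> = ?B"
      proof -
        have pos: "(\<Prod>i=1..n. 1 + cmod (x i)) > 0" by (intro prod_pos) (auto simp: add_pos_nonneg)
        have nz: "1 + cmod (x i) \<noteq> 0" "1 + cmod (x i) > 0" for i
          using norm_ge_zero[of "x i"] by linarith+
        have "ln (\<Prod>i=1..n. 1 + cmod (x i)) = (\<Sum>i=1..n. ln (1 + cmod (x i)))"
          by (intro ln_prod) (auto simp: nz)
        moreover have "ln (real n ^ k * (\<Prod>i=1..n. 1 + cmod (x i))) = ln (real n ^ k) + ln (\<Prod>i=1..n. 1 + cmod (x i))"
          using pos assms(3) by (intro ln_mult_pos) auto
        ultimately show ?thesis using assms(3) by (simp add: ln_realpow)
      qed
      finally show ?case .
    qed
  qed simp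
  also have "\<dots> = ?B" by simp
  also have "\<dots> \<le> real k * n + (\<Sum>i=1..n. ln 2 + log_plus (cmod (x i)))"
  proof (intro add_mono mult_left_mono sum_mono)
    show "ln (real n) \<le> real n" using assms(3) ln_le_minus_one[of "real n"] by simp
    fix i
    have "ln (1 + cmod (x i)) \<le> ln (2 * max 1 (cmod (x i)))"
      by (intro ln_mono) (auto simp: add_pos_nonneg)
    then show "ln (1 + cmod (x i)) \<le> ln 2 + log_plus (cmod (x i))"
      by (simp add: ln_mult_pos log_plus_eq_ln_max less_max_iff_disj)
  qed simp
  also have "\<dots> \<le> (k + ln 2 + A) * n" using A by (simp add: sum.distrib algebra_simps)
  finally show ?thesis .
qed

lemma square_mean_le:
  fixes h :: "nat \<Rightarrow> real"
  assumes "d \<le> n" "n \<ge> 1"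
  shows "((\<Sum>j=1..d. h j) / n)\<^sup>2 \<le> (\<Sum>j=1..d. (h j)\<^sup>2) / n"
proof -
  have "(\<Sum>j=1..d. h j)\<^sup>2 \<le> (\<Sum>j=1..d. (h j)\<^sup>2) * d"
    using sum_squared_le_sum_of_squares[of h "{1..d}"] by simp
  also have "\<dots> \<le> (\<Sum>j=1..d. (h j)\<^sup>2) * n" using assms by (intro mult_left_mono sum_nonneg) auto
  finally show ?thesis using assms by (simp add: power_divide power2_eq_square divide_simps)
qed

text \<open>The identity \<open>ln (cmod (v - w)) = log_kernel v w + log_plus (cmod w)\<close>
  splits the ratio into a constant \<open>\<alpha> - \<beta>\<close>, bounded by log-Cesaro
  boundedness, and two averages of kernels, whose mean squares are bounded by Cauchy--Schwarz
  whatever the positions of the zeros.\<close>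

lemma log_ratio_L2_bound:
  assumes "\<rho> > 0"
  shows "\<exists>C. \<forall>x n. k < n \<longrightarrow> (\<Sum>i=1..n. log_plus (cmod (x i))) \<le> A * n \<longrightarrow>
    integrable circ (\<lambda>z. (log_ratio k x n (y + of_real \<rho> * z))\<^sup>2) \<and>
    (\<integral>z. (log_ratio k x n (y + of_real \<rho> * z))\<^sup>2 \<partial>circ) \<le> C"
proof -
  obtain C0 where C0: "\<And>w. integrable circ (\<lambda>z. (log_kernel (y + of_real \<rho> * z) w)\<^sup>2)"
    "\<And>w. (\<integral>z. (log_kernel (y + of_real \<rho> * z) w)\<^sup>2 \<partial>circ) \<le> C0"
    using log_kernel_circle_bound[OF assms, of y] by blast
  define D where "D = k + ln 2 + A"
  have "integrable circ (\<lambda>z. (log_ratio k x n (y + of_real \<rho> * z))\<^sup>2) \<and>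
    (\<integral>z. (log_ratio k x n (y + of_real \<rho> * z))\<^sup>2 \<partial>circ) \<le> 3 * (D\<^sup>2 + C0 + C0)"
    if n: "k < n" and A: "(\<Sum>i=1..n. log_plus (cmod (x i))) \<le> A * n" for x n
  proof -
    define d where "d = n - k"
    define c where "c = pderiv_lead n k"
    have c: "c \<ge> 1" "c > 0" using pderiv_lead_ge_1[of n k] by (auto simp: c_def)
    have d: "d \<le> n" by (simp add: d_def)
    have n1: "n \<ge> 1" using n by simp
    obtain \<eta> where \<eta>: "(pderiv ^^ k) (root_poly x n) = smult (of_real c) (root_poly \<eta> d)"
      using ex_critical_points[of k n x] n unfolding c_def d_def by (metis less_imp_le)
    define \<alpha> where "\<alpha> = (ln c + (\<Sum>j=1..d. log_plus (cmod (\<eta> j)))) / n"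
    define \<beta> where "\<beta> = (\<Sum>i=1..n. log_plus (cmod (x i))) / n"
    have lp: "log_plus t \<ge> 0" for t by (simp add: log_plus_def)
    have \<alpha>: "0 \<le> \<alpha>" unfolding \<alpha>_def using c by (intro divide_nonneg_nonneg add_nonneg_nonneg sum_nonneg lp) auto
    have \<alpha>': "\<alpha> \<le> D" unfolding \<alpha>_def D_def
      using critical_points_log_bound[OF \<eta> c(1) n1 A] n1 by (simp add: pos_divide_le_eq)
    have \<beta>: "0 \<le> \<beta>" unfolding \<beta>_def by (intro divide_nonneg_nonneg sum_nonneg lp) auto
    have \<beta>': "\<beta> \<le> A" unfolding \<beta>_def using A n1 by (simp add: pos_divide_le_eq)
    have "A \<le> D" unfolding D_def by simp
    then have \<alpha>\<beta>: "(\<alpha> - \<beta>)\<^sup>2 \<le> D\<^sup>2" using \<alpha> \<alpha>' \<beta> \<beta>' by (intro abs_le_square_iff[THEN iffD1]) auto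
    define h where "h w z = log_kernel (y + of_real \<rho> * z) w" for w z
    define G where "G z = 3 * (D\<^sup>2 + (\<Sum>j=1..d. (h (\<eta> j) z)\<^sup>2) / n + (\<Sum>i=1..n. (h (x i) z)\<^sup>2) / n)" for z
    have int_h: "integrable circ (\<lambda>z. (h w z)\<^sup>2)" for w unfolding h_def by (rule C0)
    have int_G: "integrable circ G" unfolding G_def using int_h by simp
    have le: "AE z in circ. (log_ratio k x n (y + of_real \<rho> * z))\<^sup>2 \<le> G z"
      using AE_ln_poly[OF c(2) assms, of \<eta> d y] AE_ln_poly[OF zero_less_one assms, of x n y]
    proof eventually_elim
      case (elim z)
      define v where "v = y + of_real \<rho> * z"
      have ln: "ln (cmod (v - w)) = h w z + log_plus (cmod w)" for w
        by (simp add: h_def log_kernel_def v_def)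
      have "log_ratio k x n v = ((ln c + (\<Sum>j=1..d. ln (cmod (v - \<eta> j)))) - (\<Sum>i=1..n. ln (cmod (v - x i)))) / n"
        using elim unfolding log_ratio_def \<eta> v_def by simp
      also have "\<dots> = (\<alpha> - \<beta>) + (\<Sum>j=1..d. h (\<eta> j) z) / n - (\<Sum>i=1..n. h (x i) z) / n"
        unfolding ln \<alpha>_def \<beta>_def by (simp add: sum.distrib add_divide_distrib diff_divide_distrib)
      finally have eq: "log_ratio k x n v = (\<alpha> - \<beta>) + (\<Sum>j=1..d. h (\<eta> j) z) / n - (\<Sum>i=1..n. h (x i) z) / n" .
      have three: "(p + q - r)\<^sup>2 \<le> 3 * (p\<^sup>2 + q\<^sup>2 + r\<^sup>2)" for p q r :: real
      proof -
        have "3 * (p\<^sup>2 + q\<^sup>2 + r\<^sup>2) - (p + q - r)\<^sup>2 = (p - q)\<^sup>2 + (p + r)\<^sup>2 + (q + r)\<^sup>2"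
          by (simp add: power2_eq_square algebra_simps)
        moreover have "\<dots> \<ge> 0" by simp
        ultimately show ?thesis by linarith
      qed
      have "(log_ratio k x n v)\<^sup>2 \<le> 3 * ((\<alpha> - \<beta>)\<^sup>2 + ((\<Sum>j=1..d. h (\<eta> j) z) / n)\<^sup>2 + ((\<Sum>i=1..n. h (x i) z) / n)\<^sup>2)"
        unfolding eq by (rule three)
      also have "\<dots> \<le> G z" unfolding G_def
        by (intro mult_left_mono add_mono \<alpha>\<beta> square_mean_le d n1) auto
      finally show ?case unfolding v_def .
    qed
    have int: "integrable circ (\<lambda>z. (log_ratio k x n (y + of_real \<rho> * z))\<^sup>2)"
      by (rule Bochner_Integration.integrable_bound[OF int_G])
        (use le in \<open>measurable, auto elim!: eventually_mono\<close>)
    have mean: "(\<Sum>j=1..m. (\<integral>z. (h (\<theta> j) z)\<^sup>2 \<partial>circ)) / n \<le> C0" if "m \<le> n" for m and \<theta> :: "nat \<Rightarrow> complex"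
    proof -
      have "0 \<le> C0" using C0(2)[of 0] by (rule order_trans[rotated]) simp
      have "(\<Sum>j=1..m. (\<integral>z. (h (\<theta> j) z)\<^sup>2 \<partial>circ)) \<le> (\<Sum>j=1..m. C0)"
        unfolding h_def by (intro sum_mono C0)
      also have "\<dots> \<le> C0 * n" using that \<open>0 \<le> C0\<close> by (simp add: mult.commute mult_left_mono)
      finally show ?thesis using n1 by (simp add: pos_divide_le_eq)
    qed
    have "(\<integral>z. (log_ratio k x n (y + of_real \<rho> * z))\<^sup>2 \<partial>circ) \<le> (\<integral>z. G z \<partial>circ)"
      by (rule integral_mono_AE[OF int int_G le])
    also have "\<dots> = 3 * (D\<^sup>2 + (\<Sum>j=1..d. (\<integral>z. (h (\<eta> j) z)\<^sup>2 \<partial>circ)) / n + (\<Sum>i=1..n. (\<integral>z. (h (x i) z)\<^sup>2 \<partial>circ)) / n)"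
      unfolding G_def using int_h by simp
    also have "\<dots> \<le> 3 * (D\<^sup>2 + C0 + C0)" by (intro mult_left_mono add_mono mean d) auto
    finally show ?thesis using int by blast
  qed
  then show ?thesis by blast
qed

lemma integrable_log_ratio:
  assumes "\<rho> > 0" "k < n"
  shows "integrable circ (\<lambda>z. log_ratio k x n (y + of_real \<rho> * z))"
proof -
  have c: "pderiv_lead n k > 0" using pderiv_lead_ge_1[of n k] by simp
  obtain \<eta> where \<eta>: "(pderiv ^^ k) (root_poly x n) = smult (of_real (pderiv_lead n k)) (root_poly \<eta> (n - k))"
    using ex_critical_points[of k n x] assms by (metis less_imp_le)
  show ?thesis unfolding log_ratio_def \<eta>
    using integrable_ln_poly[OF c assms(1), of \<eta> "n - k" y] integrable_ln_poly[OF zero_less_one assms(1), of x n y]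
    by simp
qed

text \<open>Uniform integrability by hand: \<open>\<bar>t\<bar>\<close> is at most
  \<open>\<epsilon> + \<delta> * t ^ 2\<close>, plus \<open>1 / (4 * \<delta>)\<close> where
  \<open>\<bar>t\<bar> > \<epsilon>\<close>. The mean-square bound takes care of the second term.
  The third averages to the proportion of choices with \<open>\<bar>t\<bar> > \<epsilon>\<close>,
  which is at most 1 and tends to 0 at almost every \<open>z\<close>, so that dominated convergence
  applies.\<close>

lemma log_ratio_mean_tendsto_0:
  assumes ab: "infinite {i. i \<ge> 1 \<and> a i \<noteq> b i}" and "\<rho> > 0"
    and A: "\<And>S n. n \<ge> 1 \<Longrightarrow> (\<Sum>i=1..n. log_plus (cmod (pick a b S i))) \<le> A * n"
  shows "(\<lambda>n. (\<Sum>S\<in>Pow {1..n}. \<integral>z. \<bar>log_ratio k (pick a b S) n (y + of_real \<rho> * z)\<bar> \<partial>circ) / 2 ^ n) \<longlonglongrightarrow> 0"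
proof (rule LIMSEQ_I)
  fix r :: real assume r: "r > 0"
  obtain C where C: "\<And>x n. k < n \<Longrightarrow> (\<Sum>i=1..n. log_plus (cmod (x i))) \<le> A * n \<Longrightarrow>
    integrable circ (\<lambda>z. (log_ratio k x n (y + of_real \<rho> * z))\<^sup>2) \<and>
    (\<integral>z. (log_ratio k x n (y + of_real \<rho> * z))\<^sup>2 \<partial>circ) \<le> C"
    using log_ratio_L2_bound[OF \<open>\<rho> > 0\<close>, of k A y] by blast
  define D where "D = max 1 C"
  \<comment> \<open>The constants are such that each of the three terms finally contributes at most
    \<open>r / 4\<close>.\<close>
  define \<epsilon> where "\<epsilon> = r / 4"
  define \<delta> where "\<delta> = r / (4 * D)"
  have pos: "D > 0" "\<epsilon> > 0" "\<delta> > 0" using r by (auto simp: D_def \<epsilon>_def \<delta>_def)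
  have \<delta>C: "\<delta> * C \<le> r / 4"
  proof -
    have "\<delta> * C \<le> \<delta> * D" using pos by (intro mult_left_mono) (auto simp: D_def)
    then show ?thesis using pos by (simp add: \<delta>_def)
  qed
  define Y where "Y n S z = log_ratio k (pick a b S) n (y + of_real \<rho> * z)" for n S z
  have [measurable]: "Y n S \<in> borel_measurable borel" for n S unfolding Y_def by measurable
  define frac where "frac n z = real (card {S \<in> Pow {1..n}. \<bar>Y n S z\<bar> > \<epsilon>}) / 2 ^ n" for n z
  have frac_sum: "frac n z = (\<Sum>S\<in>Pow {1..n}. indicator {z. \<bar>Y n S z\<bar> > \<epsilon>} z) / 2 ^ n" for n z
    unfolding frac_def indicator_def by (simp add: sum_of_bool_eq Int_def)
  have "(\<lambda>n. \<integral>z. frac n z \<partial>circ) \<longlonglongrightarrow> (\<integral>z. 0 \<partial>circ)"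
  proof (rule integral_dominated_convergence[where w = "\<lambda>_. 1"])
    show "frac n \<in> borel_measurable circ" for n unfolding frac_sum[abs_def] by measurable
    show "AE z in circ. norm (frac n z) \<le> 1" for n
    proof (rule AE_I2)
      fix z
      have "card {S \<in> Pow {1..n}. \<bar>Y n S z\<bar> > \<epsilon>} \<le> card (Pow {1..n})" by (intro card_mono) auto
      then have "real (card {S \<in> Pow {1..n}. \<bar>Y n S z\<bar> > \<epsilon>}) \<le> 2 ^ n" by (simp add: card_Pow)
      then show "norm (frac n z) \<le> 1" by (simp add: frac_def pos_divide_le_eq)
    qed
    show "AE z in circ. (\<lambda>n. frac n z) \<longlonglongrightarrow> 0"
      using AE_circ_distance[OF \<open>\<rho> > 0\<close>, of y a] AE_circ_distance[OF \<open>\<rho> > 0\<close>, of y b]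
    proof eventually_elim
      case (elim z)
      then obtain C1 C2 where C1: "\<And>i. i \<ge> 1 \<Longrightarrow> 1 / cmod (y + of_real \<rho> * z - a i) \<le> C1 * real i ^ 4"
        and C2: "\<And>i. i \<ge> 1 \<Longrightarrow> 1 / cmod (y + of_real \<rho> * z - b i) \<le> C2 * real i ^ 4" by blast
      have "C1 * real i ^ 4 \<le> max C1 C2 * real i ^ 4" "C2 * real i ^ 4 \<le> max C1 C2 * real i ^ 4" for i
        by (intro mult_right_mono; simp)+
      note le = order_trans[OF C1 this(1)] order_trans[OF C2 this(2)]
      show ?case unfolding frac_def Y_def
        by (rule log_ratio_pointwise[OF ab _ _ le pos(2)]) (use elim in auto)
    qed
  qed simp_all
  then have "(\<lambda>n. \<integral>z. frac n z \<partial>circ) \<longlonglongrightarrow> 0" by simp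
  then have "\<forall>\<^sub>F n in sequentially. (\<integral>z. frac n z \<partial>circ) < \<delta> * r"
    using pos r by (intro order_tendstoD) auto
  then have "\<forall>\<^sub>F n in sequentially.
    norm ((\<Sum>S\<in>Pow {1..n}. \<integral>z. \<bar>Y n S z\<bar> \<partial>circ) / 2 ^ n - 0) < r"
    using eventually_gt_at_top[of k]
  proof eventually_elim
    case (elim n)
    define p :: "nat set \<Rightarrow> real" where "p S = (\<integral>z. indicator {z. \<bar>Y n S z\<bar> > \<epsilon>} z \<partial>circ)" for S
    have bound: "(\<integral>z. \<bar>Y n S z\<bar> \<partial>circ) \<le> \<epsilon> + \<delta> * C + (1 / (4 * \<delta>)) * p S" for S
    proof -
      have C': "integrable circ (\<lambda>z. (Y n S z)\<^sup>2)" "(\<integral>z. (Y n S z)\<^sup>2 \<partial>circ) \<le> C"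
        using C[of n "pick a b S"] A[of n S] elim unfolding Y_def by auto
      have int_ind: "integrable circ (\<lambda>z. indicator {z. \<bar>Y n S z\<bar> > \<epsilon>} z :: real)"
        by (intro circ.integrable_const_bound[of _ 1]) auto
      have amgm: "\<bar>t\<bar> \<le> \<delta> * t\<^sup>2 + 1 / (4 * \<delta>)" for t :: real
      proof -
        have "0 \<le> (2 * \<delta> * \<bar>t\<bar> - 1)\<^sup>2" by simp
        then have "4 * \<delta> * \<bar>t\<bar> \<le> 4 * \<delta> * (\<delta> * t\<^sup>2) + 1"
          by (simp add: power2_diff power_mult_distrib power2_eq_square algebra_simps)
        then have "4 * \<delta> * \<bar>t\<bar> \<le> 4 * \<delta> * (\<delta> * t\<^sup>2 + 1 / (4 * \<delta>))" using pos by (simp add: distrib_left)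
        then show ?thesis using pos by (subst (asm) mult_le_cancel_left_pos) auto
      qed
      have "(\<integral>z. \<bar>Y n S z\<bar> \<partial>circ)
          \<le> (\<integral>z. \<epsilon> + \<delta> * (Y n S z)\<^sup>2 + (1 / (4 * \<delta>)) * indicator {z. \<bar>Y n S z\<bar> > \<epsilon>} z \<partial>circ)"
      proof (rule integral_mono)
        show "integrable circ (\<lambda>z. \<bar>Y n S z\<bar>)"
          unfolding Y_def by (intro integrable_abs integrable_log_ratio) (use \<open>\<rho> > 0\<close> elim in auto)
        show "integrable circ (\<lambda>z. \<epsilon> + \<delta> * (Y n S z)\<^sup>2 + (1 / (4 * \<delta>)) * indicator {z. \<bar>Y n S z\<bar> > \<epsilon>} z)"
          using C' int_ind by simp
        fix z
        show "\<bar>Y n S z\<bar> \<le> \<epsilon> + \<delta> * (Y n S z)\<^sup>2 + (1 / (4 * \<delta>)) * indicator {z. \<bar>Y n S z\<bar> > \<epsilon>} z"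
          using amgm[of "Y n S z"] pos by (auto simp: indicator_def intro: add_increasing2)
      qed
      also have "\<dots> = \<epsilon> + \<delta> * (\<integral>z. (Y n S z)\<^sup>2 \<partial>circ) + (1 / (4 * \<delta>)) * p S"
        unfolding p_def using C' int_ind by simp
      also have "\<dots> \<le> \<epsilon> + \<delta> * C + (1 / (4 * \<delta>)) * p S"
        using C' pos by (intro add_mono mult_left_mono) auto
      finally show ?thesis .
    qed
    have int_ind: "integrable circ (\<lambda>z. indicator {z. \<bar>Y n S z\<bar> > \<epsilon>} z :: real)" for S
      by (intro circ.integrable_const_bound[of _ 1]) auto
    have "(\<Sum>S\<in>Pow {1..n}. \<integral>z. \<bar>Y n S z\<bar> \<partial>circ)
        \<le> (\<Sum>S\<in>Pow {1..n}. \<epsilon> + \<delta> * C + (1 / (4 * \<delta>)) * p S)"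
      by (intro sum_mono bound)
    also have "\<dots> = 2 ^ n * (\<epsilon> + \<delta> * C) + (1 / (4 * \<delta>)) * (\<Sum>S\<in>Pow {1..n}. p S)"
      by (simp add: sum.distrib card_Pow sum_distrib_left)
    also have "(\<Sum>S\<in>Pow {1..n}. p S) = 2 ^ n * (\<integral>z. frac n z \<partial>circ)"
      unfolding frac_sum p_def using int_ind by simp
    finally have "(\<Sum>S\<in>Pow {1..n}. \<integral>z. \<bar>Y n S z\<bar> \<partial>circ)
        \<le> 2 ^ n * (\<epsilon> + \<delta> * C + (1 / (4 * \<delta>)) * (\<integral>z. frac n z \<partial>circ))" by (simp add: algebra_simps)
    then have "(\<Sum>S\<in>Pow {1..n}. \<integral>z. \<bar>Y n S z\<bar> \<partial>circ) / 2 ^ n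
        \<le> \<epsilon> + \<delta> * C + (1 / (4 * \<delta>)) * (\<integral>z. frac n z \<partial>circ)"
      by (simp add: pos_divide_le_eq mult.commute)
    also have "\<dots> < r"
    proof -
      have "(1 / (4 * \<delta>)) * (\<integral>z. frac n z \<partial>circ) \<le> (1 / (4 * \<delta>)) * (\<delta> * r)"
        using elim pos by (intro mult_left_mono) auto
      then show ?thesis using \<delta>C pos r by (simp add: \<epsilon>_def)
    qed
    finally have "(\<Sum>S\<in>Pow {1..n}. \<integral>z. \<bar>Y n S z\<bar> \<partial>circ) / 2 ^ n < r" .
    moreover have "0 \<le> (\<Sum>S\<in>Pow {1..n}. \<integral>z. \<bar>Y n S z\<bar> \<partial>circ) / 2 ^ n"
      by (intro divide_nonneg_nonneg sum_nonneg) auto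
    ultimately show ?case by simp
  qed
  then show "\<exists>no. \<forall>n\<ge>no. norm ((\<Sum>S\<in>Pow {1..n}. \<integral>z. \<bar>log_ratio k (pick a b S) n (y + of_real \<rho> * z)\<bar> \<partial>circ) / 2 ^ n - 0) < r"
    unfolding Y_def eventually_sequentially .
qed

section \<open>Comparison of the zero measures\<close>

text \<open>By Jensen's formula this is the difference of the means of \<open>\<lambda>z. ln (cmod (z - x))\<close> over the circles
  of radii \<open>2 * r\<close> and \<open>r\<close> about the origin.\<close>

definition log_tent :: "real \<Rightarrow> complex \<Rightarrow> real" where
  "log_tent r x = ln (max (2 * r) (cmod x)) - ln (max r (cmod x))"

lemma log_tent_nonneg: "r > 0 \<Longrightarrow> 0 \<le> log_tent r x"
  unfolding log_tent_def by (auto intro!: ln_mono)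

lemma log_tent_le: assumes "r > 0" shows "log_tent r x \<le> ln 2"
proof -
  have "ln (max (2 * r) (cmod x)) \<le> ln (2 * max r (cmod x))" using assms by (intro ln_mono) auto
  also have "\<dots> = ln 2 + ln (max r (cmod x))" using assms by (intro ln_mult_pos) auto
  finally show ?thesis by (simp add: log_tent_def)
qed

lemma log_tent_eq_0: "r > 0 \<Longrightarrow> 2 * r \<le> cmod x \<Longrightarrow> log_tent r x = 0"
  by (simp add: log_tent_def max_def)

lemma log_tent_eq_ln2: "r > 0 \<Longrightarrow> cmod x \<le> r \<Longrightarrow> log_tent r x = ln 2"
  by (simp add: log_tent_def max_absorb1 ln_mult_pos)

lemma continuous_log_tent: "r > 0 \<Longrightarrow> continuous_on UNIV (log_tent r)"
  unfolding log_tent_def by (intro continuous_intros) (auto simp: max_def)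

lemma measurable_log_tent: "r > 0 \<Longrightarrow> log_tent r \<in> borel_measurable borel"
  by (intro borel_measurable_continuous_onI continuous_log_tent)

lemma log_tent_minus: "log_tent r (x - u) = log_tent r (u - x)"
  by (simp add: log_tent_def norm_minus_commute)

lemma integrable_bounded_support:
  fixes g :: "complex \<Rightarrow> real"
  assumes [measurable]: "g \<in> borel_measurable borel" and "\<And>x. \<bar>g x\<bar> \<le> C" "\<And>x. R < cmod x \<Longrightarrow> g x = 0"
  shows "integrable lborel g"
proof (rule Bochner_Integration.integrable_bound)
  have "emeasure lborel (cball (0::complex) R) < \<infinity>" by (rule emeasure_lborel_cball_finite)
  then show "integrable lborel (\<lambda>x :: complex. C * indicator (cball 0 R) x :: real)"
    by (intro integrable_mult_right integrable_real_indicator) auto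
  have "\<bar>g x\<bar> \<le> C * indicator (cball 0 R) x" for x
    using assms(2)[of x] assms(3)[of x] by (auto simp: indicator_def)
  then show "AE x in lborel. norm (g x) \<le> norm (C * indicator (cball 0 R) x)"
    by (auto intro: order_trans[OF _ abs_ge_self])
qed simp

lemma integrable_log_tent: "r > 0 \<Longrightarrow> integrable lborel (log_tent r)"
  by (rule integrable_bounded_support[of _ "ln 2" "2 * r"])
    (auto simp: measurable_log_tent log_tent_nonneg log_tent_le log_tent_eq_0)

lemma
  assumes "r > 0"
  shows integrable_log_tent_shift: "integrable lborel (\<lambda>u. log_tent r (x - u))"
    and integral_log_tent_shift: "(\<integral>u. log_tent r (x - u) \<partial>lborel) = (\<integral>u. log_tent r u \<partial>lborel)"
proof -
  have [measurable]: "log_tent r \<in> borel_measurable borel" by (rule measurable_log_tent) fact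
  have eq: "log_tent r (x - u) = log_tent r (- x + u)" for u by (simp add: log_tent_minus[of r x])
  have "integrable (distr lborel borel ((+) (- x))) (log_tent r)"
    unfolding lborel_distr_plus by (rule integrable_log_tent) fact
  then show "integrable lborel (\<lambda>u. log_tent r (x - u))"
    unfolding eq by (subst (asm) integrable_distr_eq) auto
  have "(\<integral>u. log_tent r u \<partial>lborel) = (\<integral>u. log_tent r u \<partial>distr lborel borel ((+) (- x)))"
    unfolding lborel_distr_plus ..
  also have "\<dots> = (\<integral>u. log_tent r (x - u) \<partial>lborel)"
    unfolding eq by (subst integral_distr) auto
  finally show "(\<integral>u. log_tent r (x - u) \<partial>lborel) = (\<integral>u. log_tent r u \<partial>lborel)" ..
qed

lemma integral_log_tent_pos:
  assumes "r > 0" shows "(\<integral>u. log_tent r u \<partial>lborel) > 0"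
proof -
  have fin: "emeasure lborel (cball (0::complex) r) < \<infinity>" by (rule emeasure_lborel_cball_finite)
  have "0 < ln 2 * measure lborel (cball (0::complex) r)" using content_cball_pos[OF assms] by simp
  also have "\<dots> = (\<integral>u. ln 2 * indicator (cball 0 r) u \<partial>(lborel :: complex measure))" by simp
  also have "\<dots> \<le> (\<integral>u. log_tent r u \<partial>lborel)"
  proof (rule integral_mono)
    show "integrable lborel (\<lambda>u :: complex. ln 2 * indicator (cball 0 r) u :: real)"
      by (intro integrable_mult_right integrable_real_indicator) (use fin in auto)
    fix u :: complex
    show "ln 2 * indicator (cball 0 r) u \<le> log_tent r u"
      using assms by (auto simp: indicator_def log_tent_eq_ln2 log_tent_nonneg)
  qed (rule integrable_log_tent[OF assms])
  finally show ?thesis .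
qed

section \<open>Zeros and critical points tested against tents and spikes\<close>

definition crit_diff :: "nat \<Rightarrow> (nat \<Rightarrow> complex) \<Rightarrow> nat \<Rightarrow> (complex \<Rightarrow> real) \<Rightarrow> real" where
  "crit_diff k x n \<phi> = (\<integral>z. \<phi> z \<partial>zeros_measure ((pderiv ^^ k) (root_poly x n)))
     - (\<integral>z. \<phi> z \<partial>zeros_measure (root_poly x n))"

lemma ex_crit_diff:
  assumes "k < n"
  obtains \<eta> where "(pderiv ^^ k) (root_poly x n) = smult (of_real (pderiv_lead n k)) (root_poly \<eta> (n - k))"
    and "\<And>\<phi>. \<phi> \<in> borel_measurable borel \<Longrightarrow>
      crit_diff k x n \<phi> = (\<Sum>j=1..n - k. \<phi> (\<eta> j)) / (n - k) - (\<Sum>i=1..n. \<phi> (x i)) / n"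
proof -
  obtain \<eta> where \<eta>: "(pderiv ^^ k) (root_poly x n) = smult (of_real (pderiv_lead n k)) (root_poly \<eta> (n - k))"
    using ex_critical_points[of k n x] assms by (metis less_imp_le)
  have "of_real (pderiv_lead n k) \<noteq> (0::complex)" using pderiv_lead_ge_1[of n k] by simp
  moreover have "n - k \<ge> 1" "n \<ge> 1" using assms by auto
  ultimately have "crit_diff k x n \<phi> = (\<Sum>j=1..n - k. \<phi> (\<eta> j)) / (n - k) - (\<Sum>i=1..n. \<phi> (x i)) / n"
    if "\<phi> \<in> borel_measurable borel" for \<phi>
    using integral_zeros_measure[of \<phi> 1 n x] integral_zeros_measure[of \<phi> "of_real (pderiv_lead n k)" "n - k" \<eta>] that
    unfolding crit_diff_def \<eta> by simp
  with \<eta> show thesis using that by blast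
qed

text \<open>Jensen's formula on the circles of radii \<open>2 * r\<close> and \<open>r\<close> about
  \<open>y\<close>. The last term pays for normalising the \<open>n - k\<close> critical points by
  \<open>n - k\<close>, while \<open>log_ratio\<close> divides by \<open>n\<close>; it stays small
  because the tent lies between 0 and \<open>ln 2\<close>.\<close>

lemma crit_diff_log_tent:
  assumes "k < n" "r > 0"
  shows "\<bar>crit_diff k x n (\<lambda>z. log_tent r (z - y))\<bar>
    \<le> (\<integral>z. \<bar>log_ratio k x n (y + of_real (2 * r) * z)\<bar> \<partial>circ) + (\<integral>z. \<bar>log_ratio k x n (y + of_real r * z)\<bar> \<partial>circ)
      + ln 2 * k / n"
proof -
  define d where "d = n - k"
  define c where "c = pderiv_lead n k"
  have c: "c > 0" using pderiv_lead_ge_1[of n k] by (simp add: c_def)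
  have d: "d \<ge> 1" "n \<ge> 1" "real d = real n - real k" using assms by (auto simp: d_def)
  obtain \<eta> where \<eta>: "(pderiv ^^ k) (root_poly x n) = smult (of_real c) (root_poly \<eta> d)"
    and diff: "\<And>\<phi>. \<phi> \<in> borel_measurable borel \<Longrightarrow>
      crit_diff k x n \<phi> = (\<Sum>j=1..d. \<phi> (\<eta> j)) / d - (\<Sum>i=1..n. \<phi> (x i)) / n"
    using ex_crit_diff[OF assms(1)] unfolding c_def d_def by metis
  have [measurable]: "log_tent r \<in> borel_measurable borel" by (rule measurable_log_tent) fact
  define T where "T z = log_tent r (z - y)" for z
  have T[measurable]: "T \<in> borel_measurable borel" unfolding T_def by measurable
  have mean: "(\<integral>z. log_ratio k x n (y + of_real \<rho> * z) \<partial>circ)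
      = (ln c + (\<Sum>j=1..d. ln (max \<rho> (cmod (\<eta> j - y)))) - (\<Sum>i=1..n. ln (max \<rho> (cmod (x i - y))))) / n"
    if "\<rho> > 0" for \<rho>
    using integrable_ln_poly[OF c that, of \<eta> d y] integrable_ln_poly[OF zero_less_one that, of x n y]
      integral_ln_poly[OF c that, of \<eta> d y] integral_ln_poly[OF zero_less_one that, of x n y]
    unfolding log_ratio_def \<eta> by simp
  define I where "I \<rho> = (\<integral>z. log_ratio k x n (y + of_real \<rho> * z) \<partial>circ)" for \<rho>
  define I' where "I' \<rho> = (\<integral>z. \<bar>log_ratio k x n (y + of_real \<rho> * z)\<bar> \<partial>circ)" for \<rho>
  have I: "\<bar>I \<rho>\<bar> \<le> I' \<rho>" for \<rho> unfolding I_def I'_def by (rule integral_abs_bound)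
  \<comment> \<open>The contribution \<open>ln c\<close> of the leading coefficient is the same for
    both radii and cancels.\<close>
  have sumT: "(\<Sum>j=1..d. T (\<eta> j)) / n - (\<Sum>i=1..n. T (x i)) / n = I (2 * r) - I r"
  proof -
    have "2 * r > 0" using assms(2) by simp
    from mean[OF this] mean[OF assms(2)] show ?thesis
      unfolding I_def T_def log_tent_def by (simp only: sum_subtractf diff_divide_distrib add_divide_distrib)
  qed
  have T_bound: "0 \<le> (\<Sum>j=1..d. T (\<eta> j))" "(\<Sum>j=1..d. T (\<eta> j)) \<le> d * ln 2"
    unfolding T_def using sum_bounded_above[of "{1..d}" "\<lambda>j. log_tent r (\<eta> j - y)" "ln 2"]
    by (auto intro!: sum_nonneg log_tent_nonneg log_tent_le assms)
  have "(\<Sum>j=1..d. T (\<eta> j)) / d - (\<Sum>j=1..d. T (\<eta> j)) / n = (\<Sum>j=1..d. T (\<eta> j)) * (real k / (real d * real n))"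
  proof -
    have k: "real k = real n - real d" using d by simp
    show ?thesis unfolding k using d(1,2) by (simp add: field_simps)
  qed
  moreover have "0 \<le> (\<Sum>j=1..d. T (\<eta> j)) * (real k / (real d * real n))"
    by (intro mult_nonneg_nonneg T_bound) simp
  moreover have "(\<Sum>j=1..d. T (\<eta> j)) * (real k / (real d * real n)) \<le> (d * ln 2) * (real k / (real d * real n))"
    by (intro mult_right_mono T_bound) simp
  moreover have "(d * ln 2) * (real k / (real d * real n)) = ln 2 * k / n" using d by simp
  ultimately have "\<bar>(\<Sum>j=1..d. T (\<eta> j)) / d - (\<Sum>j=1..d. T (\<eta> j)) / n\<bar> \<le> ln 2 * k / n"
    by (simp only: abs_of_nonneg)
  then have "\<bar>crit_diff k x n T\<bar> \<le> I' (2 * r) + I' r + ln 2 * k / n"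
    unfolding diff[OF T] using sumT I[of "2 * r"] I[of r] by linarith
  then show ?thesis unfolding T_def I'_def .
qed

lemma abs_crit_diff_log_tent_le:
  assumes "k < n" "r > 0"
  shows "\<bar>crit_diff k x n (\<lambda>z. log_tent r (z - y))\<bar> \<le> ln 2"
proof -
  have [measurable]: "log_tent r \<in> borel_measurable borel" by (rule measurable_log_tent) fact
  obtain \<eta> where diff: "\<And>\<phi>. \<phi> \<in> borel_measurable borel \<Longrightarrow>
      crit_diff k x n \<phi> = (\<Sum>j=1..n - k. \<phi> (\<eta> j)) / (n - k) - (\<Sum>i=1..n. \<phi> (x i)) / n"
    using ex_crit_diff[OF assms(1)] by metis
  have "0 \<le> (\<Sum>j=1..m. log_tent r (\<theta> j - y)) / m \<and> (\<Sum>j=1..m. log_tent r (\<theta> j - y)) / m \<le> ln 2"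
    if "m \<ge> 1" for m and \<theta> :: "nat \<Rightarrow> complex"
    using sum_bounded_above[of "{1..m}" "\<lambda>j. log_tent r (\<theta> j - y)" "ln 2"] that
    by (auto intro!: divide_nonneg_nonneg sum_nonneg log_tent_nonneg log_tent_le assms simp: pos_divide_le_eq mult.commute)
  note bounds = this
  have "n - k \<ge> 1" "n \<ge> 1" using assms by auto
  from bounds[OF this(1), of \<eta>] bounds[OF this(2), of x]
  moreover have "\<bar>p - q\<bar> \<le> m" if "0 \<le> p \<and> p \<le> m" "0 \<le> q \<and> q \<le> m" for p q m :: real
    using that by linarith
  ultimately have "\<bar>(\<Sum>j=1..n - k. log_tent r (\<eta> j - y)) / (n - k) - (\<Sum>i=1..n. log_tent r (x i - y)) / n\<bar> \<le> ln 2"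
    by blast
  then show ?thesis by (subst diff) auto
qed

lemma measurable_crit_diff_log_tent:
  assumes "k < n" "r > 0"
  shows "(\<lambda>y. crit_diff k x n (\<lambda>z. log_tent r (z - y))) \<in> borel_measurable borel"
proof -
  have [measurable]: "log_tent r \<in> borel_measurable borel" by (rule measurable_log_tent) fact
  obtain \<eta> where diff: "\<And>\<phi>. \<phi> \<in> borel_measurable borel \<Longrightarrow>
      crit_diff k x n \<phi> = (\<Sum>j=1..n - k. \<phi> (\<eta> j)) / (n - k) - (\<Sum>i=1..n. \<phi> (x i)) / n"
    using ex_crit_diff[OF assms(1)] by metis
  show ?thesis by (subst diff) measurable
qed

text \<open>\<open>spikes ps\<close> is replaced by its normalised convolution with the log tent.\<close>

lemma abs_crit_diff_spikes_le:
  assumes "k < n" "r > 0" and K: "\<And>x y. \<bar>spikes ps x - spikes ps y\<bar> \<le> K * dist x y" "K \<ge> 0"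
  defines "c \<equiv> (\<integral>u. log_tent r u \<partial>lborel)"
  shows "\<bar>crit_diff k x n (spikes ps)\<bar> \<le> 4 * r * K
    + (\<integral>u. spikes ps u * \<bar>crit_diff k x n (\<lambda>z. log_tent r (z - u))\<bar> \<partial>lborel) / c"
proof -
  define g where "g = spikes ps"
  define d where "d = n - k"
  have [measurable]: "log_tent r \<in> borel_measurable borel" by (rule measurable_log_tent) fact
  have [measurable]: "g \<in> borel_measurable borel" unfolding g_def by measurable
  have c: "c > 0" unfolding c_def by (rule integral_log_tent_pos) fact
  have d: "d \<ge> 1" "n \<ge> 1" using assms by (auto simp: d_def)
  obtain \<eta> where diff: "\<And>\<phi>. \<phi> \<in> borel_measurable borel \<Longrightarrow>
      crit_diff k x n \<phi> = (\<Sum>j=1..d. \<phi> (\<eta> j)) / d - (\<Sum>i=1..n. \<phi> (x i)) / n"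
    using ex_crit_diff[OF assms(1)] unfolding d_def by metis
  obtain Cg where Cg: "\<And>x. \<bar>g x\<bar> \<le> Cg" using spikes_bounded[of ps] unfolding g_def by auto
  obtain R where R: "\<And>x. R < cmod x \<Longrightarrow> g x = 0" using spikes_compact_support[of ps] unfolding g_def by auto
  have int_g: "integrable lborel g" by (rule integrable_bounded_support[OF _ Cg R]) auto
  have int_bdd: "integrable lborel (\<lambda>u. g u * h u)" if [measurable]: "h \<in> borel_measurable borel" and "\<And>u. \<bar>h u\<bar> \<le> ln 2" for h
  proof (rule integrable_bounded_support[of _ "Cg * ln 2" R])
    have "0 \<le> Cg" using Cg[of 0] by linarith
    then show "\<bar>g u * h u\<bar> \<le> Cg * ln 2" for u unfolding abs_mult using Cg that(2) by (intro mult_mono) auto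
  qed (auto simp: R)
  have T_abs: "\<bar>log_tent r z\<bar> \<le> ln 2" for z
    using log_tent_nonneg[OF assms(2), of z] log_tent_le[OF assms(2), of z] by simp
  have int_gT: "integrable lborel (\<lambda>u. g u * log_tent r (w - u))" for w
    by (rule int_bdd) (auto simp: T_abs)
  define G where "G w = (\<integral>u. g u * log_tent r (w - u) \<partial>lborel)" for w
  \<comment> \<open>The tent about \<open>w\<close> vanishes beyond distance \<open>2 * r\<close>,
    within which \<open>g\<close> moves by at most \<open>2 * r * K\<close>. This error enters once
    for each of the two measures, whence \<open>4 * r * K\<close>.\<close>
  have approx: "\<bar>g w * c - G w\<bar> \<le> 2 * r * K * c" for w
  proof -
    have "g w * c - G w = (\<integral>u. (g w - g u) * log_tent r (w - u) \<partial>lborel)"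
      unfolding G_def c_def using integrable_log_tent_shift[OF assms(2), of w] int_gT[of w]
      by (simp add: left_diff_distrib integral_log_tent_shift[OF assms(2)])
    also have "\<bar>\<dots>\<bar> \<le> (\<integral>u. \<bar>(g w - g u) * log_tent r (w - u)\<bar> \<partial>lborel)" by (rule integral_abs_bound)
    also have "\<dots> \<le> (\<integral>u. (2 * r * K) * log_tent r (w - u) \<partial>lborel)"
    proof (rule integral_mono)
      show "integrable lborel (\<lambda>u. \<bar>(g w - g u) * log_tent r (w - u)\<bar>)"
        unfolding left_diff_distrib using integrable_log_tent_shift[OF assms(2), of w] int_gT[of w]
        by (intro integrable_abs Bochner_Integration.integrable_diff integrable_mult_right) auto
      show "integrable lborel (\<lambda>u. (2 * r * K) * log_tent r (w - u))"
        using integrable_log_tent_shift[OF assms(2), of w] by simp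
      fix u
      show "\<bar>(g w - g u) * log_tent r (w - u)\<bar> \<le> (2 * r * K) * log_tent r (w - u)"
      proof (cases "cmod (w - u) \<le> 2 * r")
        case True
        have "\<bar>g w - g u\<bar> \<le> K * dist w u" unfolding g_def by (rule K)
        also have "\<dots> \<le> K * (2 * r)" using True K(2) by (intro mult_left_mono) (auto simp: dist_norm)
        finally have "\<bar>g w - g u\<bar> \<le> 2 * r * K" by (simp add: mult_ac)
        then show ?thesis using log_tent_nonneg[OF assms(2), of "w - u"]
          by (simp add: abs_mult mult_right_mono)
      next
        case False
        then have "log_tent r (w - u) = 0" using assms by (intro log_tent_eq_0) auto
        then show ?thesis by simp
      qed
    qed
    also have "\<dots> = 2 * r * K * c"
      using integral_log_tent_shift[OF assms(2), of w] by (simp add: c_def)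
    finally show ?thesis .
  qed
  have avg: "\<bar>(\<Sum>j=1..m. g (\<theta> j)) / m * c - (\<Sum>j=1..m. G (\<theta> j)) / m\<bar> \<le> 2 * r * K * c"
    if "m \<ge> 1" for m and \<theta> :: "nat \<Rightarrow> complex"
  proof -
    have "(\<Sum>j=1..m. g (\<theta> j)) / m * c - (\<Sum>j=1..m. G (\<theta> j)) / m = (\<Sum>j=1..m. g (\<theta> j) * c - G (\<theta> j)) / m"
      by (simp add: sum_subtractf sum_distrib_right diff_divide_distrib)
    also have "\<bar>\<dots>\<bar> \<le> (\<Sum>j=1..m. \<bar>g (\<theta> j) * c - G (\<theta> j)\<bar>) / m"
      by (simp add: abs_divide divide_right_mono sum_abs)
    also have "\<dots> \<le> (\<Sum>j=1..m. 2 * r * K * c) / m"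
      by (intro divide_right_mono sum_mono approx) auto
    also have "\<dots> = 2 * r * K * c" using that by simp
    finally show ?thesis .
  qed
  define H where "H = (\<Sum>j=1..d. G (\<eta> j)) / d - (\<Sum>i=1..n. G (x i)) / n"
  have "H = (\<integral>u. g u * crit_diff k x n (\<lambda>z. log_tent r (z - u)) \<partial>lborel)"
  proof -
    have "H = (\<integral>u. (\<Sum>j=1..d. g u * log_tent r (\<eta> j - u)) / d - (\<Sum>i=1..n. g u * log_tent r (x i - u)) / n \<partial>lborel)"
      unfolding H_def G_def using int_gT by simp
    also have "\<dots> = (\<integral>u. g u * crit_diff k x n (\<lambda>z. log_tent r (z - u)) \<partial>lborel)"
      by (intro Bochner_Integration.integral_cong refl, subst diff)
        (auto simp: sum_distrib_left right_diff_distrib)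
    finally show ?thesis .
  qed
  then have "\<bar>H\<bar> \<le> (\<integral>u. \<bar>g u * crit_diff k x n (\<lambda>z. log_tent r (z - u))\<bar> \<partial>lborel)"
    by (simp only: integral_abs_bound)
  also have "\<dots> = (\<integral>u. g u * \<bar>crit_diff k x n (\<lambda>z. log_tent r (z - u))\<bar> \<partial>lborel)"
    by (simp add: abs_mult g_def)
  finally have H: "\<bar>H\<bar> \<le> (\<integral>u. g u * \<bar>crit_diff k x n (\<lambda>z. log_tent r (z - u))\<bar> \<partial>lborel)" .
  have "crit_diff k x n g * c = (\<Sum>j=1..d. g (\<eta> j)) / d * c - (\<Sum>i=1..n. g (x i)) / n * c"
    by (subst diff) (auto simp: left_diff_distrib)
  moreover have "\<bar>p\<bar> \<le> \<bar>h\<bar> + 2 * m"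
    if "p = s - t" "h = s' - t'" "\<bar>s - s'\<bar> \<le> m" "\<bar>t - t'\<bar> \<le> m" for p h m s s' t t' :: real
    using that by linarith
  ultimately have "\<bar>crit_diff k x n g * c\<bar> \<le> \<bar>H\<bar> + 2 * (2 * r * K * c)"
    using avg[OF d(1), of \<eta>] avg[OF d(2), of x] H_def by blast
  then have "\<bar>crit_diff k x n g\<bar> * c \<le> (4 * r * K + (\<integral>u. g u * \<bar>crit_diff k x n (\<lambda>z. log_tent r (z - u))\<bar> \<partial>lborel) / c) * c"
    using H c by (simp add: abs_mult distrib_right)
  then show ?thesis using c unfolding g_def by simp
qed

text \<open>For each centre \<open>u\<close> the mean tends to 0 because it does so on the two
  circles about \<open>u\<close>. The bound \<open>ln 2\<close> and the compact support of the
  spikes then allow dominated convergence in \<open>u\<close>.\<close>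

lemma crit_diff_mean_tendsto_0:
  assumes ab: "infinite {i. i \<ge> 1 \<and> a i \<noteq> b i}"
    and A: "\<And>S n. n \<ge> 1 \<Longrightarrow> (\<Sum>i=1..n. log_plus (cmod (pick a b S i))) \<le> A * n"
  shows "(\<lambda>n. (\<Sum>S\<in>Pow {1..n}. \<bar>crit_diff k (pick a b S) n (spikes ps)\<bar>) / 2 ^ n) \<longlonglongrightarrow> 0"
proof (rule LIMSEQ_I)
  fix e :: real assume e: "e > 0"
  obtain K where K: "K \<ge> 0" "\<And>x y. \<bar>spikes ps x - spikes ps y\<bar> \<le> K * dist x y"
    using spikes_lipschitz by blast
  define g where "g = spikes ps"
  have [measurable]: "g \<in> borel_measurable borel" unfolding g_def by measurable
  obtain Cg where Cg: "\<And>x. \<bar>g x\<bar> \<le> Cg" using spikes_bounded[of ps] unfolding g_def by auto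
  obtain R where R: "\<And>x. R < cmod x \<Longrightarrow> g x = 0" using spikes_compact_support[of ps] unfolding g_def by auto
  have int_g: "integrable lborel g" by (rule integrable_bounded_support[OF _ Cg R]) auto
  \<comment> \<open>Makes the approximation error \<open>4 * r * K\<close> at most
    \<open>e / 2\<close>; \<open>K + 1\<close> avoids dividing by zero when
    \<open>K = 0\<close>.\<close>
  define r where "r = e / (8 * (K + 1))"
  have r: "r > 0" using e K by (simp add: r_def)
  have rK: "4 * r * K \<le> e / 2"
  proof -
    have "4 * r * K \<le> 4 * r * (K + 1)" using r by (intro mult_left_mono) auto
    also have "\<dots> = e / 2" using K by (simp add: r_def field_simps)
    finally show ?thesis .
  qed
  define c where "c = (\<integral>u. log_tent r u \<partial>lborel)"
  have c: "c > 0" unfolding c_def by (rule integral_log_tent_pos[OF r])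
  define D where "D n S u = (if k < n then \<bar>crit_diff k (pick a b S) n (\<lambda>z. log_tent r (z - u))\<bar> else 0)" for n S u
  have [measurable]: "D n S \<in> borel_measurable borel" for n S
    unfolding D_def using measurable_crit_diff_log_tent[OF _ r] by (cases "k < n") auto
  have D_le: "0 \<le> D n S u" "D n S u \<le> ln 2" for n S u
    unfolding D_def using abs_crit_diff_log_tent_le[OF _ r] by auto
  define E where "E n u = (\<Sum>S\<in>Pow {1..n}. D n S u) / 2 ^ n" for n u
  have E_nonneg: "0 \<le> E n u" for n u unfolding E_def by (intro divide_nonneg_nonneg sum_nonneg D_le) auto
  have E_le: "E n u \<le> ln 2" for n u
  proof -
    have "(\<Sum>S\<in>Pow {1..n}. D n S u) \<le> (\<Sum>S\<in>Pow {1..n}. ln 2)" by (intro sum_mono D_le)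
    also have "\<dots> = 2 ^ n * ln 2" by (simp add: card_Pow)
    finally show ?thesis unfolding E_def by (simp add: pos_divide_le_eq mult.commute)
  qed
  have E_lim: "(\<lambda>n. E n u) \<longlonglongrightarrow> 0" for u
  proof (rule tendsto_sandwich[of "\<lambda>_. 0"])
    define J where "J \<rho> n = (\<Sum>S\<in>Pow {1..n}. \<integral>z. \<bar>log_ratio k (pick a b S) n (u + of_real \<rho> * z)\<bar> \<partial>circ) / 2 ^ n" for \<rho> n
    have J: "J \<rho> \<longlonglongrightarrow> 0" if "\<rho> > 0" for \<rho>
      unfolding J_def by (rule log_ratio_mean_tendsto_0[OF ab that A])
    have "(\<lambda>n. J (2 * r) n + J r n + ln 2 * k * (1 / n)) \<longlonglongrightarrow> 0 + 0 + ln 2 * k * 0"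
      using r by (intro tendsto_intros J lim_1_over_n) auto
    then show "(\<lambda>n. J (2 * r) n + J r n + ln 2 * k / n) \<longlonglongrightarrow> 0" by simp
    show "\<forall>\<^sub>F n in sequentially. E n u \<le> J (2 * r) n + J r n + ln 2 * k / n"
      using eventually_gt_at_top[of k]
    proof eventually_elim
      case (elim n)
      have "(\<Sum>S\<in>Pow {1..n}. D n S u) \<le> (\<Sum>S\<in>Pow {1..n}.
          (\<integral>z. \<bar>log_ratio k (pick a b S) n (u + of_real (2 * r) * z)\<bar> \<partial>circ)
          + (\<integral>z. \<bar>log_ratio k (pick a b S) n (u + of_real r * z)\<bar> \<partial>circ) + ln 2 * k / n)"
        unfolding D_def using crit_diff_log_tent[OF elim r] elim by (intro sum_mono) simp
      also have "\<dots> = 2 ^ n * (J (2 * r) n + J r n + ln 2 * k / n)"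
        unfolding J_def by (simp add: sum.distrib card_Pow distrib_left)
      finally show ?case unfolding E_def by (simp add: pos_divide_le_eq mult.commute)
    qed
  qed (simp_all add: E_nonneg)
  have "(\<lambda>n. \<integral>u. g u * E n u \<partial>lborel) \<longlonglongrightarrow> (\<integral>u. 0 \<partial>(lborel :: complex measure))"
  proof (rule integral_dominated_convergence[where w = "\<lambda>u. ln 2 * \<bar>g u\<bar>"])
    show "integrable lborel (\<lambda>u. ln 2 * \<bar>g u\<bar>)" using int_g by simp
    show "AE u in lborel. (\<lambda>n. g u * E n u) \<longlonglongrightarrow> 0" using tendsto_mult_right_zero[OF E_lim] by simp
    have "\<bar>g u * E n u\<bar> = E n u * \<bar>g u\<bar>" for n u by (simp add: abs_mult E_nonneg)
    moreover have "E n u * \<bar>g u\<bar> \<le> ln 2 * \<bar>g u\<bar>" for n u by (intro mult_right_mono E_le) auto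
    ultimately show "AE u in lborel. norm (g u * E n u) \<le> ln 2 * \<bar>g u\<bar>" for n by simp
    show "(\<lambda>u. g u * E n u) \<in> borel_measurable lborel" for n unfolding E_def by measurable
  qed simp
  then have "(\<lambda>n. (\<integral>u. g u * E n u \<partial>lborel) / c) \<longlonglongrightarrow> 0" using tendsto_divide_zero by fastforce
  then have "\<forall>\<^sub>F n in sequentially. (\<integral>u. g u * E n u \<partial>lborel) / c < e / 2"
    using e by (intro order_tendstoD) auto
  then have "\<forall>\<^sub>F n in sequentially. norm ((\<Sum>S\<in>Pow {1..n}. \<bar>crit_diff k (pick a b S) n (spikes ps)\<bar>) / 2 ^ n - 0) < e"
    using eventually_gt_at_top[of k]
  proof eventually_elim
    case (elim n)
    have int_gD: "integrable lborel (\<lambda>u. g u * D n S u)" for S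
    proof (rule Bochner_Integration.integrable_bound)
      show "integrable lborel (\<lambda>u. ln 2 * \<bar>g u\<bar>)" using int_g by simp
      have "\<bar>g u * D n S u\<bar> = D n S u * \<bar>g u\<bar>" for u by (simp add: abs_mult D_le)
      moreover have "D n S u * \<bar>g u\<bar> \<le> ln 2 * \<bar>g u\<bar>" for u by (intro mult_right_mono D_le) auto
      ultimately show "AE u in lborel. norm (g u * D n S u) \<le> norm (ln 2 * \<bar>g u\<bar>)" by simp
    qed measurable
    have "(\<Sum>S\<in>Pow {1..n}. \<bar>crit_diff k (pick a b S) n (spikes ps)\<bar>)
        \<le> (\<Sum>S\<in>Pow {1..n}. 4 * r * K + (\<integral>u. g u * D n S u \<partial>lborel) / c)"
      using abs_crit_diff_spikes_le[OF elim(2) r K(2,1)] elim(2)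
      unfolding D_def g_def c_def by (intro sum_mono) simp
    also have "\<dots> = 2 ^ n * (4 * r * K) + (\<integral>u. (\<Sum>S\<in>Pow {1..n}. g u * D n S u) \<partial>lborel) / c"
      using int_gD by (simp add: sum.distrib card_Pow sum_divide_distrib)
    also have "(\<integral>u. (\<Sum>S\<in>Pow {1..n}. g u * D n S u) \<partial>lborel) = 2 ^ n * (\<integral>u. g u * E n u \<partial>lborel)"
      unfolding E_def by (simp add: sum_distrib_left)
    finally have "(\<Sum>S\<in>Pow {1..n}. \<bar>crit_diff k (pick a b S) n (spikes ps)\<bar>) / 2 ^ n
        \<le> 4 * r * K + (\<integral>u. g u * E n u \<partial>lborel) / c"
      by (simp add: pos_divide_le_eq) (simp add: algebra_simps)
    also have "\<dots> < e" using rK elim(1) by linarith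
    finally show ?case by (simp add: sum_nonneg)
  qed
  then show "\<exists>no. \<forall>n\<ge>no. norm ((\<Sum>S\<in>Pow {1..n}. \<bar>crit_diff k (pick a b S) n (spikes ps)\<bar>) / 2 ^ n - 0) < e"
    unfolding eventually_sequentially .
qed

section \<open>Random zeros\<close>

locale random_choice = prob_space M for M :: "'w measure" +
  fixes a b :: "nat \<Rightarrow> complex" and \<xi> :: "nat \<Rightarrow> 'w \<Rightarrow> complex"
  assumes indep: "indep_vars (\<lambda>_. borel) \<xi> {1..}"
    and law: "\<And>i. i \<ge> 1 \<Longrightarrow> distr M borel (\<xi> i) = uniform_mset_measure {#a i, b i#}"
begin

lemma measurable_\<xi>: "i \<ge> 1 \<Longrightarrow> \<xi> i \<in> borel_measurable M"
  using indep by (auto simp: indep_vars_def)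

lemma integral_law:
  fixes f :: "complex \<Rightarrow> real"
  assumes "f \<in> borel_measurable borel"
  shows "(\<integral>z. f z \<partial>uniform_mset_measure {#u, v#}) = (f u + f v) / 2"
proof -
  \<comment> \<open>Indexing by two labels keeps the multiplicity when \<open>u = v\<close>.\<close>
  have "{#u, v#} = image_mset (\<lambda>j. if j = 0 then u else v) (mset_set {0, 1 :: nat})" by simp
  then show ?thesis using integral_uniform_mset_measure[OF assms, of "{0, 1 :: nat}" "\<lambda>j. if j = 0 then u else v"]
    by simp
qed

lemma expectation_\<xi>:
  fixes f :: "complex \<Rightarrow> real"
  assumes [measurable]: "f \<in> borel_measurable borel" and i: "i \<ge> 1"
  shows "expectation (\<lambda>\<omega>. f (\<xi> i \<omega>)) = (f (a i) + f (b i)) / 2"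
proof -
  have [measurable]: "\<xi> i \<in> borel_measurable M" by (rule measurable_\<xi>[OF i])
  have "expectation (\<lambda>\<omega>. f (\<xi> i \<omega>)) = (\<integral>z. f z \<partial>distr M borel (\<xi> i))"
    by (rule integral_distr[symmetric]) measurable
  then show ?thesis unfolding law[OF i] integral_law[OF assms(1)] .
qed

lemma prob_\<xi>_eq:
  assumes i: "i \<ge> 1"
  shows "prob (\<xi> i -` {w} \<inter> space M) = (of_bool (b i = w) + of_bool (a i = w)) / 2"
proof -
  have [measurable]: "\<xi> i \<in> borel_measurable M" by (rule measurable_\<xi>[OF i])
  have "prob (\<xi> i -` {w} \<inter> space M) = expectation (indicator (\<xi> i -` {w} \<inter> space M))"
    by simp
  also have "\<dots> = expectation (\<lambda>\<omega>. indicator {w} (\<xi> i \<omega>))"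
    by (rule Bochner_Integration.integral_cong) (auto simp: indicator_def)
  also have "\<dots> = (of_bool (b i = w) + of_bool (a i = w)) / 2"
    using expectation_\<xi>[OF _ i, of "indicator {w}"] by (simp add: indicator_def add.commute)
  finally show ?thesis .
qed

lemma AE_\<xi>: "AE \<omega> in M. \<forall>i\<ge>1. \<xi> i \<omega> = a i \<or> \<xi> i \<omega> = b i"
proof -
  have "AE \<omega> in M. i \<ge> 1 \<longrightarrow> \<xi> i \<omega> = a i \<or> \<xi> i \<omega> = b i" for i
  proof (cases "i \<ge> 1")
    case True
    have [measurable]: "\<xi> i \<in> borel_measurable M" by (rule measurable_\<xi>[OF True])
    have "prob (\<xi> i -` {a i, b i} \<inter> space M) = 1"
    proof -
      have "prob (\<xi> i -` {a i, b i} \<inter> space M) = expectation (indicator (\<xi> i -` {a i, b i} \<inter> space M))"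
        by simp
      also have "\<dots> = expectation (\<lambda>\<omega>. indicator {a i, b i} (\<xi> i \<omega>))"
        by (rule Bochner_Integration.integral_cong) (auto simp: indicator_def)
      also have "\<dots> = 1"
        using expectation_\<xi>[OF _ True, of "indicator {a i, b i}"] by simp
      finally show ?thesis .
    qed
    then have "AE \<omega> in M. \<omega> \<in> \<xi> i -` {a i, b i} \<inter> space M" by (subst (asm) prob_eq_1) auto
    then show ?thesis by eventually_elim auto
  qed simp
  then show ?thesis by (simp add: AE_all_countable)
qed

text \<open>Turns proportions of subsets into probabilities, for properties of the first
  \<open>n\<close> entries. Almost every \<open>\<omega>\<close> realises the choice of some
  \<open>S\<close>; where \<open>a i = b i\<close> several \<open>S\<close> give the same outcome,
  so each outcome is weighted by the number of \<open>S\<close> producing it.\<close>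

lemma prob_le_card_pick:
  assumes "n \<ge> 1" and Q: "\<And>x y. (\<And>i. i \<in> {1..n} \<Longrightarrow> x i = y i) \<Longrightarrow> Q x = Q y"
    and meas: "{\<omega> \<in> space M. Q (\<lambda>i. \<xi> i \<omega>)} \<in> events"
  shows "prob {\<omega> \<in> space M. Q (\<lambda>i. \<xi> i \<omega>)} \<le> real (card {S \<in> Pow {1..n}. Q (pick a b S)}) / 2 ^ n"
proof -
  \<comment> \<open>Restriction identifies all choices with the same first \<open>n\<close>
    entries.\<close>
  define r where "r S = restrict (pick a b S) {1..n}" for S
  define V where "V = r ` {S \<in> Pow {1..n}. Q (pick a b S)}"
  define E where "E v = (\<Inter>i\<in>{1..n}. \<xi> i -` {v i} \<inter> space M)" for v
  have finV: "finite V" unfolding V_def by simp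
  have E_meas: "E v \<in> events" for v
    unfolding E_def using assms(1) measurable_\<xi> by (intro sets.finite_INT) (auto intro!: measurable_sets)
  have prob_E: "prob (E v) = real (card {S \<in> Pow {1..n}. r S = v}) / 2 ^ n" if "v \<in> V" for v
  proof -
    have "prob (E v) = (\<Prod>i\<in>{1..n}. prob (\<xi> i -` {v i} \<inter> space M))"
      unfolding E_def using assms(1) by (intro indep_varsD[OF indep]) auto
    also have "\<dots> = (\<Prod>i\<in>{1..n}. (of_bool (b i = v i) + of_bool (a i = v i)) / 2)"
      by (intro prod.cong prob_\<xi>_eq) auto
    also have "\<dots> = (\<Prod>i\<in>{1..n}. of_bool (b i = v i) + of_bool (a i = v i)) / 2 ^ n"
      by (simp add: prod_dividef)
    \<comment> \<open>Expanding the product takes the \<open>b\<close> term for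
      \<open>i \<in> S\<close> and the \<open>a\<close> term otherwise; the resulting summand is 1
      exactly when \<open>S\<close> produces \<open>v\<close>.\<close>
    also have "(\<Prod>i\<in>{1..n}. of_bool (b i = v i) + of_bool (a i = v i) :: real)
        = (\<Sum>S\<in>Pow {1..n}. (\<Prod>i\<in>S. of_bool (b i = v i)) * (\<Prod>i\<in>{1..n} - S. of_bool (a i = v i)))"
      by (rule prod_add) simp
    also have "\<dots> = (\<Sum>S\<in>Pow {1..n}. of_bool (r S = v))"
    proof (intro sum.cong refl)
      fix S assume S: "S \<in> Pow {1..n}"
      have prod_bool: "(\<Prod>i\<in>A. of_bool (P i) :: real) = of_bool (\<forall>i\<in>A. P i)" if "finite A" for A :: "nat set" and P
        using that by (induction A rule: finite_induct) auto
      have fin: "finite S" using S finite_subset by auto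
      have "v \<in> extensional {1..n}" using \<open>v \<in> V\<close> by (auto simp: V_def r_def)
      then have "r S = v \<longleftrightarrow> (\<forall>i\<in>{1..n}. pick a b S i = v i)"
        unfolding r_def by (auto simp: fun_eq_iff restrict_def extensional_def)
      also have "\<dots> \<longleftrightarrow> (\<forall>i\<in>S. b i = v i) \<and> (\<forall>i\<in>{1..n} - S. a i = v i)"
        using S by (auto simp: pick_def)
      finally show "(\<Prod>i\<in>S. of_bool (b i = v i)) * (\<Prod>i\<in>{1..n} - S. of_bool (a i = v i)) = (of_bool (r S = v) :: real)"
        using fin by (simp add: prod_bool flip: of_bool_conj)
    qed
    also have "\<dots> = real (card {S \<in> Pow {1..n}. r S = v})" by (simp add: sum_of_bool_eq Int_def)
    finally show ?thesis .
  qed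
  have "prob {\<omega> \<in> space M. Q (\<lambda>i. \<xi> i \<omega>)} \<le> prob (\<Union>v\<in>V. E v)"
  proof (rule finite_measure_mono_AE)
    show "AE \<omega> in M. \<omega> \<in> {\<omega> \<in> space M. Q (\<lambda>i. \<xi> i \<omega>)} \<longrightarrow> \<omega> \<in> (\<Union>v\<in>V. E v)"
      using AE_\<xi> AE_space
    proof eventually_elim
      case (elim \<omega>)
      show ?case
      proof
        assume Q\<omega>: "\<omega> \<in> {\<omega> \<in> space M. Q (\<lambda>i. \<xi> i \<omega>)}"
        define S where "S = {i \<in> {1..n}. \<xi> i \<omega> = b i}"
        have S: "pick a b S i = \<xi> i \<omega>" if "i \<in> {1..n}" for i
          using elim that by (auto simp: pick_def S_def)
        have "Q (pick a b S)" using Q[OF S] Q\<omega> by auto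
        then have "r S \<in> V" unfolding V_def by (auto simp: S_def)
        moreover have "\<omega> \<in> E (r S)" unfolding E_def using elim S assms(1) by (auto simp: r_def)
        ultimately show "\<omega> \<in> (\<Union>v\<in>V. E v)" by blast
      qed
    qed
    show "(\<Union>v\<in>V. E v) \<in> events" using finV E_meas by auto
  qed
  also have "\<dots> \<le> (\<Sum>v\<in>V. prob (E v))" using finV E_meas by (intro finite_measure_subadditive_finite) auto
  also have "\<dots> = (\<Sum>v\<in>V. real (card {S \<in> Pow {1..n}. r S = v})) / 2 ^ n"
    by (simp add: prob_E sum_divide_distrib)
  also have "(\<Sum>v\<in>V. real (card {S \<in> Pow {1..n}. r S = v})) = real (card (\<Union>v\<in>V. {S \<in> Pow {1..n}. r S = v}))"
    using finV by (subst card_UN_disjoint) auto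
  also have "(\<Union>v\<in>V. {S \<in> Pow {1..n}. r S = v}) = {S \<in> Pow {1..n}. Q (pick a b S)}"
  proof -
    have "Q (pick a b S) = Q (pick a b S')" if "r S = r S'" for S S'
    proof (rule Q)
      fix i assume "i \<in> {1..n}"
      then show "pick a b S i = pick a b S' i" using fun_cong[OF that, of i] by (auto simp: r_def)
    qed
    then have "r S \<in> V \<longleftrightarrow> Q (pick a b S)" if "S \<in> Pow {1..n}" for S
      using that unfolding V_def by blast
    then show ?thesis by blast
  qed
  finally show ?thesis .
qed

lemma strong_law:
  fixes g :: "complex \<Rightarrow> real"
  assumes [measurable]: "g \<in> borel_measurable borel" and g: "\<And>x. 0 \<le> g x" "\<And>x. g x \<le> C"
  shows "AE \<omega> in M. (\<lambda>n. (\<Sum>i=1..n. g (\<xi> i \<omega>)) / n - (\<Sum>i=1..n. (g (a i) + g (b i)) / 2) / n) \<longlonglongrightarrow> 0"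
proof -
  \<comment> \<open>The added 1 keeps the interval of Hoeffding's inequality nondegenerate even if
    \<open>g\<close> vanishes.\<close>
  define C' where "C' = C + 1"
  have C': "C' > 0" "g x \<le> C'" for x using g[of 0] g[of x] by (auto simp: C'_def)
  define m where "m n = (\<Sum>i=1..n. (g (a i) + g (b i)) / 2)" for n
  \<comment> \<open>\<open>n = 0\<close> is set apart because Hoeffding's inequality needs a
    positive total width.\<close>
  define A where "A e n = (if n = 0 then {} else {\<omega> \<in> space M. \<bar>(\<Sum>i=1..n. g (\<xi> i \<omega>)) - m n\<bar> \<ge> e * real n})" for e n
  have meas: "i \<in> {1..n} \<Longrightarrow> (\<lambda>\<omega>. g (\<xi> i \<omega>)) \<in> borel_measurable M" for i n
    using measurable_compose[OF measurable_\<xi>[of i], of g] by auto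
  have A_meas: "A e n \<in> events" for e n
  proof -
    have [measurable]: "(\<lambda>\<omega>. \<Sum>i=1..n. g (\<xi> i \<omega>)) \<in> borel_measurable M"
      by (intro borel_measurable_sum meas)
    have "{\<omega> \<in> space M. \<bar>(\<Sum>i=1..n. g (\<xi> i \<omega>)) - m n\<bar> \<ge> e * real n} \<in> events" by measurable
    then show ?thesis unfolding A_def by simp
  qed
  have A_prob: "prob (A e n) \<le> 2 * exp (- 2 * e\<^sup>2 / C'\<^sup>2) ^ n" if e: "e > 0" for e n
  proof (cases "n = 0")
    case False
    interpret H: Hoeffding_ineq M "{1..n}" "\<lambda>i \<omega>. g (\<xi> i \<omega>)" "\<lambda>_. 0" "\<lambda>_. C'"
      "\<Sum>i\<in>{1..n}. expectation (\<lambda>\<omega>. g (\<xi> i \<omega>))"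
    proof unfold_locales
      show "indep_vars (\<lambda>_. borel) (\<lambda>i \<omega>. g (\<xi> i \<omega>)) {1..n}"
        by (rule indep_vars_compose2[OF indep_vars_subset[OF indep]]) auto
    qed (use g C' in auto)
    have "(\<Sum>i\<in>{1..n}. expectation (\<lambda>\<omega>. g (\<xi> i \<omega>))) = m n"
      unfolding m_def by (intro sum.cong refl expectation_\<xi>) auto
    then have "prob (A e n) = prob {\<omega> \<in> space M. \<bar>(\<Sum>i=1..n. g (\<xi> i \<omega>)) - (\<Sum>i\<in>{1..n}. expectation (\<lambda>\<omega>. g (\<xi> i \<omega>)))\<bar> \<ge> e * real n}"
      using False by (simp add: A_def)
    also have "\<dots> \<le> 2 * exp (- 2 * (e * real n)\<^sup>2 / (\<Sum>i\<in>{1..n}. (C' - 0)\<^sup>2))"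
      by (rule H.Hoeffding_ineq_abs_ge) (use e C' False in auto)
    also have "- 2 * (e * real n)\<^sup>2 / (\<Sum>i\<in>{1..n}. (C' - 0)\<^sup>2) = real n * (- 2 * e\<^sup>2 / C'\<^sup>2)"
      using False C' by (simp add: power2_eq_square)
    also have "exp \<dots> = exp (- 2 * e\<^sup>2 / C'\<^sup>2) ^ n" by (rule exp_of_nat_mult)
    finally show ?thesis .
  qed (simp add: A_def)
  have ev: "AE \<omega> in M. \<forall>\<^sub>F n in sequentially. \<omega> \<in> space M - A e n" if e: "e > 0" for e
  proof (rule borel_cantelli_AE1)
    show "summable (\<lambda>n. prob (A e n))"
    proof (rule summable_comparison_test')
      have "summable (\<lambda>n. exp (- 2 * e\<^sup>2 / C'\<^sup>2) ^ n)"
        using e C' by (intro summable_geometric) (auto simp: field_simps)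
      then show "summable (\<lambda>n. 2 * exp (- 2 * e\<^sup>2 / C'\<^sup>2) ^ n)" by (rule summable_mult)
      show "norm (prob (A e n)) \<le> 2 * exp (- 2 * e\<^sup>2 / C'\<^sup>2) ^ n" for n using A_prob[OF e, of n] by simp
    qed
  qed (auto simp: A_meas emeasure_eq_measure)
  have "AE \<omega> in M. \<forall>j. \<forall>\<^sub>F n in sequentially. \<omega> \<in> space M - A (1 / real (Suc j)) n"
    unfolding AE_all_countable by (intro allI ev) simp
  then show ?thesis
  proof eventually_elim
    case (elim \<omega>)
    show ?case unfolding m_def[symmetric]
    proof (rule tendstoI)
      fix e :: real assume "e > 0"
      then obtain j where j: "1 / real (Suc j) < e" using nat_approx_posE by blast
      have "\<forall>\<^sub>F n in sequentially. \<omega> \<in> space M - A (1 / real (Suc j)) n" using elim by blast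
      then show "\<forall>\<^sub>F n in sequentially. dist ((\<Sum>i=1..n. g (\<xi> i \<omega>)) / n - m n / n) 0 < e"
        using eventually_gt_at_top[of 0]
      proof eventually_elim
        case (elim n)
        then have "\<bar>(\<Sum>i=1..n. g (\<xi> i \<omega>)) - m n\<bar> < 1 / real (Suc j) * real n" by (auto simp: A_def)
        then have "\<bar>(\<Sum>i=1..n. g (\<xi> i \<omega>)) - m n\<bar> / real n < 1 / real (Suc j)"
          using elim by (simp add: pos_divide_less_eq)
        then show ?case using j elim by (simp add: dist_real_def abs_divide flip: diff_divide_distrib)
      qed
    qed
  qed
qed

text \<open>Averages along \<open>a\<close> and \<open>b\<close> have the same limit, hence so do
  the expectations. The quantifier over \<open>ps\<close> may stand inside because there are only
  countably many lists.\<close>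

lemma zeros_converge:
  assumes \<mu>: "prob_space \<mu>" "sets \<mu> = sets borel"
    and a: "distributed_as a \<mu>" and b: "distributed_as b \<mu>"
  shows "AE \<omega> in M. \<forall>ps. (\<lambda>n. \<integral>z. spikes ps z \<partial>zeros_measure (root_poly (\<lambda>i. \<xi> i \<omega>) n)) \<longlonglongrightarrow> (\<integral>z. spikes ps z \<partial>\<mu>)"
  unfolding AE_all_countable
proof
  fix ps
  define L where "L = (\<integral>z. spikes ps z \<partial>\<mu>)"
  obtain C where C: "\<And>x. spikes ps x \<le> C" using spikes_bounded by blast
  have mean: "(\<lambda>n. (\<Sum>i=1..n. spikes ps (u i)) / n) \<longlonglongrightarrow> L" if u: "distributed_as u \<mu>" for u
  proof (rule Lim_transform_eventually)
    show "(\<lambda>n. \<integral>z. spikes ps z \<partial>uniform_mset_measure (image_mset u (mset_set {1..n}))) \<longlonglongrightarrow> L"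
      unfolding L_def using u unfolding distributed_as_def
      by (rule limitin_weak_topologyD) (use \<mu> continuous_spikes bounded_spikes in auto)
    show "\<forall>\<^sub>F n in sequentially. (\<integral>z. spikes ps z \<partial>uniform_mset_measure (image_mset u (mset_set {1..n})))
        = (\<Sum>i=1..n. spikes ps (u i)) / n"
      using eventually_gt_at_top[of 0]
      by eventually_elim (subst integral_uniform_mset_measure, auto)
  qed
  have "(\<lambda>n. ((\<Sum>i=1..n. spikes ps (a i)) / n + (\<Sum>i=1..n. spikes ps (b i)) / n) / 2) \<longlonglongrightarrow> (L + L) / 2"
    by (intro tendsto_intros mean a b) simp
  then have half: "(\<lambda>n. (\<Sum>i=1..n. (spikes ps (a i) + spikes ps (b i)) / 2) / n) \<longlonglongrightarrow> L"
    by (simp add: sum.distrib add_divide_distrib flip: sum_divide_distrib) (simp add: mult.commute)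
  have "AE \<omega> in M. (\<lambda>n. (\<Sum>i=1..n. spikes ps (\<xi> i \<omega>)) / n - (\<Sum>i=1..n. (spikes ps (a i) + spikes ps (b i)) / 2) / n) \<longlonglongrightarrow> 0"
    by (rule strong_law[of _ C]) (auto simp: C)
  then show "AE \<omega> in M. (\<lambda>n. \<integral>z. spikes ps z \<partial>zeros_measure (root_poly (\<lambda>i. \<xi> i \<omega>) n)) \<longlonglongrightarrow> (\<integral>z. spikes ps z \<partial>\<mu>)"
  proof eventually_elim
    case (elim \<omega>)
    from tendsto_add[OF elim half] have "(\<lambda>n. (\<Sum>i=1..n. spikes ps (\<xi> i \<omega>)) / n) \<longlonglongrightarrow> L" by simp
    moreover have "\<forall>\<^sub>F n in sequentially. (\<Sum>i=1..n. spikes ps (\<xi> i \<omega>)) / n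
        = (\<integral>z. spikes ps z \<partial>zeros_measure (root_poly (\<lambda>i. \<xi> i \<omega>) n))"
      using eventually_gt_at_top[of 0]
    proof eventually_elim
      case (elim n)
      then show ?case using integral_zeros_measure[of "spikes ps" 1 n "\<lambda>i. \<xi> i \<omega>"] by simp
    qed
    ultimately show ?case unfolding L_def by (rule Lim_transform_eventually)
  qed
qed

lemma integral_zeros_event:
  assumes "open V"
  shows "{\<omega> \<in> space M. (\<integral>z. spikes ps z \<partial>zeros_measure ((pderiv ^^ k) (root_poly (\<lambda>i. \<xi> i \<omega>) n))) \<in> V} \<in> events"
  using zeros_measure_event[OF openin_weak_topology_basic[OF continuous_spikes bounded_spikes assms], of \<xi> M k n ps]
  by (simp add: prob_space_zeros_measure measurable_\<xi>)

lemma measurable_integral_zeros: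
  "(\<lambda>\<omega>. \<integral>z. spikes ps z \<partial>zeros_measure ((pderiv ^^ k) (root_poly (\<lambda>i. \<xi> i \<omega>) n))) \<in> borel_measurable M"
  by (rule borel_measurableI) (use integral_zeros_event in \<open>simp add: vimage_def Int_def conj_commute\<close>)

text \<open>Markov's inequality for a uniformly chosen \<open>S\<close>, moved to the probability
  space by \<open>prob_le_card_pick\<close>.\<close>

lemma crit_diff_tendsto_prob:
  assumes ab: "infinite {i. i \<ge> 1 \<and> a i \<noteq> b i}" and "log_Cesaro_bounded a" "log_Cesaro_bounded b" and "e > 0"
  shows "(\<lambda>n. prob {\<omega> \<in> space M. e \<le> \<bar>crit_diff k (\<lambda>i. \<xi> i \<omega>) n (spikes ps)\<bar>}) \<longlonglongrightarrow> 0"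
proof -
  have Cesaro: "\<exists>A. \<forall>n\<ge>1. (\<Sum>i=1..n. log_plus (cmod (u i))) \<le> A * real n" if u: "log_Cesaro_bounded u" for u
  proof -
    obtain A where "\<forall>x\<in>(\<lambda>n. (\<Sum>i=1..n. log_plus (cmod (u i))) / real n) ` {1..}. norm x \<le> A"
      using u unfolding log_Cesaro_bounded_def bounded_iff by blast
    then have A: "\<bar>(\<Sum>i=1..n. log_plus (cmod (u i))) / real n\<bar> \<le> A" if "n \<ge> 1" for n
      using that by auto
    have "(\<Sum>i=1..n. log_plus (cmod (u i))) \<le> A * n" if "n \<ge> 1" for n
      using A[OF that] that by (simp add: abs_le_iff pos_divide_le_eq)
    then show ?thesis by (intro exI[of _ A] allI impI)
  qed
  obtain A1 where A1: "\<forall>n\<ge>1. (\<Sum>i=1..n. log_plus (cmod (a i))) \<le> A1 * real n"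
    using Cesaro[OF assms(2)] by (elim exE)
  obtain A2 where A2: "\<forall>n\<ge>1. (\<Sum>i=1..n. log_plus (cmod (b i))) \<le> A2 * real n"
    using Cesaro[OF assms(3)] by (elim exE)
  \<comment> \<open>Charging both sequences at once gives a bound valid for every choice
    \<open>S\<close>, not merely for most of them.\<close>
  have A: "(\<Sum>i=1..n. log_plus (cmod (pick a b S i))) \<le> (A1 + A2) * n" if "n \<ge> 1" for S n
  proof -
    have "(\<Sum>i=1..n. log_plus (cmod (pick a b S i))) \<le> (\<Sum>i=1..n. log_plus (cmod (a i)) + log_plus (cmod (b i)))"
      by (intro sum_mono) (auto simp: pick_def log_plus_def)
    also have "\<dots> \<le> A1 * n + A2 * n" unfolding sum.distrib by (intro add_mono A1[rule_format] A2[rule_format] that)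
    finally show ?thesis by (simp add: distrib_right)
  qed
  define f where "f n = (\<Sum>S\<in>Pow {1..n}. \<bar>crit_diff k (pick a b S) n (spikes ps)\<bar>) / 2 ^ n" for n
  have lim: "(\<lambda>n. f n / e) \<longlonglongrightarrow> 0 / e"
    unfolding f_def by (intro tendsto_divide crit_diff_mean_tendsto_0[OF ab A] tendsto_const) (use \<open>e > 0\<close> in auto)
  have [measurable]: "(\<lambda>\<omega>. crit_diff k (\<lambda>i. \<xi> i \<omega>) n (spikes ps)) \<in> borel_measurable M" for n
    unfolding crit_diff_def
    using measurable_integral_zeros[of k n ps] measurable_integral_zeros[of 0 n ps] by (intro borel_measurable_diff) auto
  show ?thesis
  proof (rule tendsto_sandwich[of "\<lambda>_. 0"])
    show "(\<lambda>n. f n / e) \<longlonglongrightarrow> 0" using lim by simp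
    show "\<forall>\<^sub>F n in sequentially. prob {\<omega> \<in> space M. e \<le> \<bar>crit_diff k (\<lambda>i. \<xi> i \<omega>) n (spikes ps)\<bar>} \<le> f n / e"
      using eventually_ge_at_top[of 1]
    proof eventually_elim
      case (elim n)
      define B where "B = {S \<in> Pow {1..n}. e \<le> \<bar>crit_diff k (pick a b S) n (spikes ps)\<bar>}"
      have "prob {\<omega> \<in> space M. e \<le> \<bar>crit_diff k (\<lambda>i. \<xi> i \<omega>) n (spikes ps)\<bar>} \<le> real (card B) / 2 ^ n"
        unfolding B_def
      proof (rule prob_le_card_pick[OF elim])
        fix x y :: "nat \<Rightarrow> complex" assume "\<And>i. i \<in> {1..n} \<Longrightarrow> x i = y i"
        then have "root_poly x n = root_poly y n" by (rule root_poly_cong)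
        then show "(e \<le> \<bar>crit_diff k x n (spikes ps)\<bar>) = (e \<le> \<bar>crit_diff k y n (spikes ps)\<bar>)"
          by (simp add: crit_diff_def)
      qed measurable
      moreover have "real (card B) * e \<le> (\<Sum>S\<in>Pow {1..n}. \<bar>crit_diff k (pick a b S) n (spikes ps)\<bar>)"
      proof -
        have "real (card B) * e \<le> (\<Sum>S\<in>B. \<bar>crit_diff k (pick a b S) n (spikes ps)\<bar>)"
          by (rule sum_bounded_below) (simp add: B_def)
        also have "\<dots> \<le> (\<Sum>S\<in>Pow {1..n}. \<bar>crit_diff k (pick a b S) n (spikes ps)\<bar>)"
          by (rule sum_mono2) (auto simp: B_def)
        finally show ?thesis .
      qed
      then have "real (card B) / 2 ^ n \<le> f n / e"
        unfolding f_def using \<open>e > 0\<close> by (simp add: field_simps)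
      ultimately show ?case by linarith
    qed
  qed simp_all
qed

lemma AE_tendsto_imp_prob:
  fixes X :: "nat \<Rightarrow> 'w \<Rightarrow> real"
  assumes [measurable]: "\<And>n. X n \<in> borel_measurable M" and lim: "AE \<omega> in M. (\<lambda>n. X n \<omega>) \<longlonglongrightarrow> L" and "e > 0"
  shows "(\<lambda>n. prob {\<omega> \<in> space M. e \<le> \<bar>X n \<omega> - L\<bar>}) \<longlonglongrightarrow> 0"
proof -
  have "(\<lambda>n. \<integral>\<omega>. indicator {\<omega> \<in> space M. e \<le> \<bar>X n \<omega> - L\<bar>} \<omega> \<partial>M) \<longlonglongrightarrow> (\<integral>\<omega>. 0 \<partial>M :: real)"
  proof (rule integral_dominated_convergence[where w = "\<lambda>_. 1"])
    show "AE \<omega> in M. (\<lambda>n. indicator {\<omega> \<in> space M. e \<le> \<bar>X n \<omega> - L\<bar>} \<omega> :: real) \<longlonglongrightarrow> 0"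
      using lim
    proof eventually_elim
      case (elim \<omega>)
      have "\<forall>\<^sub>F n in sequentially. dist (X n \<omega>) L < e" using elim \<open>e > 0\<close> by (rule tendstoD)
      then have "\<forall>\<^sub>F n in sequentially. indicator {\<omega> \<in> space M. e \<le> \<bar>X n \<omega> - L\<bar>} \<omega> = (0 :: real)"
        by eventually_elim (auto simp: dist_real_def)
      then show ?case by (rule tendsto_eventually)
    qed
  qed (auto simp: indicator_def)
  then show ?thesis by simp
qed

text \<open>The zeros of the polynomial itself serve as intermediary: their almost sure convergence
  implies convergence in probability, and each of the two deviations gets
  \<open>e / 2\<close>.\<close>

lemma critical_points_converge:
  assumes \<mu>: "prob_space \<mu>" "sets \<mu> = sets borel"
    and "distributed_as a \<mu>" "log_Cesaro_bounded a" "distributed_as b \<mu>" "log_Cesaro_bounded b"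
    and ab: "infinite {i. i \<ge> 1 \<and> a i \<noteq> b i}"
  shows "converges_in_probability M weak_topology
    (\<lambda>n \<omega>. zeros_measure ((pderiv ^^ k) (root_poly (\<lambda>i. \<xi> i \<omega>) n))) \<mu>"
proof (rule converges_in_probability_weak_topologyI)
  fix ps and e :: real assume e: "e > 0"
  define L where "L = (\<integral>x. spikes ps x \<partial>\<mu>)"
  define X where "X j n \<omega> = (\<integral>x. spikes ps x \<partial>zeros_measure ((pderiv ^^ j) (root_poly (\<lambda>i. \<xi> i \<omega>) n)))" for j n \<omega>
  have [measurable]: "X j n \<in> borel_measurable M" for j n
    unfolding X_def by (rule measurable_integral_zeros)
  have diff: "crit_diff k (\<lambda>i. \<xi> i \<omega>) n (spikes ps) = X k n \<omega> - X 0 n \<omega>" for n \<omega>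
    by (simp add: crit_diff_def X_def)
  have "AE \<omega> in M. (\<lambda>n. X 0 n \<omega>) \<longlonglongrightarrow> L"
    using zeros_converge[OF \<mu> assms(3,5)] by eventually_elim (simp add: X_def L_def)
  then have zero: "(\<lambda>n. prob {\<omega> \<in> space M. e / 2 \<le> \<bar>X 0 n \<omega> - L\<bar>}) \<longlonglongrightarrow> 0"
    by (intro AE_tendsto_imp_prob) (use e in auto)
  have crit: "(\<lambda>n. prob {\<omega> \<in> space M. e / 2 \<le> \<bar>X k n \<omega> - X 0 n \<omega>\<bar>}) \<longlonglongrightarrow> 0"
    using crit_diff_tendsto_prob[OF ab assms(4,6), of "e / 2" k ps] e unfolding diff by simp
  define A B C where "A n = {\<omega> \<in> space M. e / 2 \<le> \<bar>X k n \<omega> - X 0 n \<omega>\<bar>}"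
    and "B n = {\<omega> \<in> space M. e / 2 \<le> \<bar>X 0 n \<omega> - L\<bar>}"
    and "C n = {\<omega> \<in> space M. \<bar>X k n \<omega> - L\<bar> < e}" for n
  have [measurable]: "A n \<in> events" "B n \<in> events" "C n \<in> events" for n
    unfolding A_def B_def C_def by measurable
  have "(\<lambda>n. prob (C n)) \<longlonglongrightarrow> 1"
  proof (rule tendsto_sandwich[of _ _ _ "\<lambda>_. 1"])
    have "(\<lambda>n. 1 - (prob (A n) + prob (B n))) \<longlonglongrightarrow> 1 - (0 + 0)"
      unfolding A_def B_def by (intro tendsto_intros zero crit)
    then show "(\<lambda>n. 1 - (prob (A n) + prob (B n))) \<longlonglongrightarrow> 1" by simp
    have "1 - (prob (A n) + prob (B n)) \<le> prob (C n)" for n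
    proof -
      have "1 - prob (C n) = prob (space M - C n)" by (rule prob_compl[symmetric]) measurable
      also have "\<dots> \<le> prob (A n \<union> B n)"
      proof (rule finite_measure_mono)
        have "e / 2 \<le> \<bar>p - q\<bar> \<or> e / 2 \<le> \<bar>q - L\<bar>" if "\<not> \<bar>p - L\<bar> < e" for p q :: real
          using that by linarith
        then show "space M - C n \<subseteq> A n \<union> B n" unfolding A_def B_def C_def by blast
      qed measurable
      also have "\<dots> \<le> prob (A n) + prob (B n)" by (rule measure_Un_le) measurable
      finally show ?thesis by linarith
    qed
    then show "\<forall>\<^sub>F n in sequentially. 1 - (prob (A n) + prob (B n)) \<le> prob (C n)" by simp
  qed simp_all
  then show "(\<lambda>n. prob {\<omega> \<in> space M. \<bar>(\<integral>x. spikes ps x \<partial>zeros_measure ((pderiv ^^ k) (root_poly (\<lambda>i. \<xi> i \<omega>) n)))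
      - (\<integral>x. spikes ps x \<partial>\<mu>)\<bar> < e}) \<longlonglongrightarrow> 1"
    unfolding C_def X_def L_def .
next
  show "{\<omega> \<in> space M. zeros_measure ((pderiv ^^ k) (root_poly (\<lambda>i. \<xi> i \<omega>) n)) \<in> U} \<in> events"
    if "openin weak_topology U" for n U
    using that measurable_\<xi> by (rule zeros_measure_event)
qed (use \<mu> in \<open>auto simp: prob_space_zeros_measure\<close>)

end

theorem theorem1p2:
  fixes \<mu> :: "complex measure"
    and a b :: "nat \<Rightarrow> complex"
    and M :: "'w measure"
    and \<xi> :: "nat \<Rightarrow> 'w \<Rightarrow> complex"
  assumes "prob_space \<mu>" and "sets \<mu> = sets borel"
    and "distributed_as a \<mu>" and "log_Cesaro_bounded a"
    and "distributed_as b \<mu>" and "log_Cesaro_bounded b"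
    and "infinite {i. i \<ge> 1 \<and> a i \<noteq> b i}"
    and "prob_space M"
    and "prob_space.indep_vars M (\<lambda>_. borel) \<xi> {1..}"
    and "\<And>i. i \<ge> 1 \<Longrightarrow> distr M borel (\<xi> i) = uniform_mset_measure {#a i, b i#}"
  shows "(AE \<omega> in M.
            limitin weak_topology (\<lambda>n. zeros_measure (root_poly (\<lambda>i. \<xi> i \<omega>) n)) \<mu> sequentially)
       \<and> (\<forall>k. converges_in_probability M weak_topology
            (\<lambda>n \<omega>. zeros_measure ((pderiv ^^ k) (root_poly (\<lambda>i. \<xi> i \<omega>) n))) \<mu>)"
proof -
  interpret random_choice M a b \<xi>
    using assms by (auto simp: random_choice_def random_choice_axioms_def)
  have "AE \<omega> in M. limitin weak_topology (\<lambda>n. zeros_measure (root_poly (\<lambda>i. \<xi> i \<omega>) n)) \<mu> sequentially"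
    using zeros_converge[OF assms(1,2,3,5)]
    by eventually_elim (auto intro!: limitin_weak_topologyI assms prob_space_zeros_measure)
  then show ?thesis using critical_points_converge assms by blast
qed

end
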